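(* Assume $s>d/2$, $\lambda_n>0$, $\mu_n\ge0$. Let $a_m$ and $v_m$ be the eigenvalues and the $L^2([-2L,2L]^d)$-orthonormal eigenfunctions of $\mathscr{O}_n$. Then the space $H^s_{\mathrm{per}}([-2L,2L]^d)$, equipped with the inner product $\langle f,g\rangle_{\mathrm{RKHS}}=\langle\mathscr{O}_n^{-1/2}f,\mathscr{O}_n^{-1/2}g\rangle_{L^2([-2L,2L]^d)}$, is a reproducing kernel Hilbert space. In particular: (i) its kernel $K:[-2L,2L]^d\times[-2L,2L]^d\to\mathbb{R}$ is $K(x,y)=\sum_{m\in\mathbb{N}}a_mv_m(x)v_m(y)$; (ii) for all $x\in[-2L,2L]^d$, $K(x,\cdot)\in H^s_{\mathrm{per}}([-2L,2L]^d)$; (iii) for all $f\in H^s_{\mathrm{per}}([-2L,2L]^d)$ and all $x\in[-2L,2L]^d$, $f(x)=\langle f,K(x,\cdot)\rangle_{\mathrm{RKHS}}$; (iv) for all $f\in H^s_{\mathrm{per}}([-2L,2L]^d)$, $\|f\|^2_{\mathrm{RKHS}}=\lambda_n\|f\|^2_{H^s_{\mathrm{per}}([-2L,2L]^d)}+\mu_n\|\mathscr{D}(f)\|^2_{L^2(\Omega)}$.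
   Context: Let $d\ge1$, $L>0$, $\Omega\subseteq[-L,L]^d$ a bounded Lipschitz domain, $s$ a positive integer. $H^s_{\mathrm{per}}([-2L,2L]^d)$ is the set of $f\in L^2([-2L,2L]^d)$ whose $4L$-periodic extension to $[-4L,4L]^d$ lies in $H^s([-4L,4L]^d)$, with norm $\|f\|^2_{H^s_{\mathrm{per}}}=\sum_{|\alpha|\le s}\int_{[-2L,2L]^d}|\partial^\alpha f|^2$; since $s>d/2$ its elements are identified with their continuous representatives. $\mathscr{D}(f)=\sum_{|\alpha|\le s}p_\alpha\partial^\alpha f$ with $p_\alpha:\Omega\to\mathbb{R}$, $\max_\alpha\|p_\alpha\|_\infty<\infty$. Let $B[u,v]=\lambda_n\sum_{|\alpha|\le s}\int_{[-2L,2L]^d}\partial^\alpha u\,\partial^\alpha v+\mu_n\int_\Omega\mathscr{D}u\,\mathscr{D}v$ on $H^s_{\mathrm{per}}\times H^s_{\mathrm{per}}$. The operator $\mathscr{O}_n:L^2([-2L,2L]^d)\to H^s_{\mathrm{per}}([-2L,2L]^d)$ maps $f$ to the unique $w\in H^s_{\mathrm{per}}([-2L,2L]^d)$ with $B[w,\phi]=\int_{[-2L,2L]^d}\phi f$ for all $\phi\in H^s_{\mathrm{per}}([-2L,2L]^d)$; it is a positive self-adjoint compact operator on $L^2([-2L,2L]^d)$ with an orthonormal eigenbasis $(v_m)$ and eigenvalues $a_m>0$, and $\mathscr{O}_n^{-1/2}f:=\sum_m a_m^{-1/2}\langle v_m,f\rangle_{L^2}v_m$ for $f\in H^s_{\mathrm{per}}$.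 *)

theory Defs
  imports "HOL-Analysis.Analysis"
begin

definition ccube :: "real \<Rightarrow> (real^'d) set" where
  "ccube a = {x. \<forall>i. \<bar>x$i\<bar> \<le> a}"

definition ocube :: "real \<Rightarrow> (real^'d) set" where
  "ocube a = {x. \<forall>i. \<bar>x$i\<bar> < a}"

definition L2_on :: "(real^'d) set \<Rightarrow> (real^'d \<Rightarrow> real) \<Rightarrow> bool" where
  "L2_on S f \<longleftrightarrow> f \<in> borel_measurable (lebesgue_on S) \<and>
                   integrable (lebesgue_on S) (\<lambda>x. (f x)^2)"

definition l2_inner :: "(real^'d) set \<Rightarrow> (real^'d \<Rightarrow> real) \<Rightarrow> (real^'d \<Rightarrow> real) \<Rightarrow> real" where
  "l2_inner S f g = (\<integral>x. f x * g x \<partial>lebesgue_on S)"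

definition partial :: "'d::finite \<Rightarrow> (real^'d \<Rightarrow> real) \<Rightarrow> real^'d \<Rightarrow> real" where
  "partial i f x = deriv (\<lambda>t. f (x + t *\<^sub>R axis i 1)) 0"

fun dpartials :: "'d::finite list \<Rightarrow> (real^'d \<Rightarrow> real) \<Rightarrow> real^'d \<Rightarrow> real" where
  "dpartials [] f = f"
| "dpartials (i # is) f = partial i (dpartials is f)"

definition smooth :: "(real^'d::finite \<Rightarrow> real) \<Rightarrow> bool" where
  "smooth f \<longleftrightarrow> (\<forall>is. continuous_on UNIV (dpartials is f) \<and>
      (\<forall>i x. ((\<lambda>t. dpartials is f (x + t *\<^sub>R axis i 1)) has_real_derivative
               dpartials (i # is) f x) (at 0)))"

definition test_fun :: "(real^'d::finite) set \<Rightarrow> (real^'d \<Rightarrow> real) \<Rightarrow> bool" where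
  "test_fun U \<phi> \<longleftrightarrow> smooth \<phi> \<and> compact (closure {x. \<phi> x \<noteq> 0}) \<and> closure {x. \<phi> x \<noteq> 0} \<subseteq> U"

definition mi_order :: "('d::finite \<Rightarrow> nat) \<Rightarrow> nat" where
  "mi_order \<alpha> = (\<Sum>i\<in>UNIV. \<alpha> i)"

definition realises :: "'d::finite list \<Rightarrow> ('d \<Rightarrow> nat) \<Rightarrow> bool" where
  "realises is \<alpha> \<longleftrightarrow> (\<forall>i. count (mset is) i = \<alpha> i)"

definition is_weak_deriv :: "(real^'d::finite) set \<Rightarrow> ('d \<Rightarrow> nat) \<Rightarrow> (real^'d \<Rightarrow> real) \<Rightarrow> (real^'d \<Rightarrow> real) \<Rightarrow> bool" where
  "is_weak_deriv U \<alpha> f g \<longleftrightarrow>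
     (\<forall>\<phi> is. test_fun U \<phi> \<longrightarrow> realises is \<alpha> \<longrightarrow>
        (\<integral>x. f x * dpartials is \<phi> x \<partial>lebesgue_on U) = (-1)^(mi_order \<alpha>) * (\<integral>x. g x * \<phi> x \<partial>lebesgue_on U))"

definition sobolev :: "(real^'d::finite) set \<Rightarrow> nat \<Rightarrow> (real^'d \<Rightarrow> real) \<Rightarrow> bool" where
  "sobolev U s f \<longleftrightarrow> L2_on U f \<and> (\<forall>\<alpha>. mi_order \<alpha> \<le> s \<longrightarrow> (\<exists>g. L2_on U g \<and> is_weak_deriv U \<alpha> f g))"

definition wderiv :: "real \<Rightarrow> ('d::finite \<Rightarrow> nat) \<Rightarrow> (real^'d \<Rightarrow> real) \<Rightarrow> real^'d \<Rightarrow> real" where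
  "wderiv L \<alpha> f = (SOME g. L2_on (ocube (2*L)) g \<and> is_weak_deriv (ocube (2*L)) \<alpha> f g)"

definition per_ext :: "real \<Rightarrow> (real^'d::finite \<Rightarrow> real) \<Rightarrow> real^'d \<Rightarrow> real" where
  "per_ext L f x = f (\<chi> i. x$i - 4*L * of_int \<lfloor>(x$i + 2*L) / (4*L)\<rfloor>)"

text \<open>Elements are identified with their continuous representatives (s > d/2).\<close>
definition Hper :: "real \<Rightarrow> nat \<Rightarrow> (real^'d::finite \<Rightarrow> real) set" where
  "Hper L s = {f. continuous_on (ccube (2*L)) f \<and> L2_on (ccube (2*L)) f \<and>
                  sobolev (ocube (4*L)) s (per_ext L f)}"

definition Hper_norm2 :: "real \<Rightarrow> nat \<Rightarrow> (real^'d::finite \<Rightarrow> real) \<Rightarrow> real" where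
  "Hper_norm2 L s f = (\<Sum>\<alpha>\<in>{\<alpha>. mi_order \<alpha> \<le> s}. \<integral>x. (wderiv L \<alpha> f x)^2 \<partial>lebesgue_on (ocube (2*L)))"

definition lipschitz_domain :: "(real^'d::finite) set \<Rightarrow> bool" where
  "lipschitz_domain \<Omega> \<longleftrightarrow> open \<Omega> \<and> connected \<Omega> \<and> \<Omega> \<noteq> {} \<and>
     (\<forall>z\<in>frontier \<Omega>. \<exists>r>0. \<exists>e g M. norm e = 1 \<and>
        (\<forall>p q. p \<bullet> e = 0 \<longrightarrow> q \<bullet> e = 0 \<longrightarrow> \<bar>g p - g q\<bar> \<le> M * norm (p - q)) \<and>
        \<Omega> \<inter> ball z r = {y \<in> ball z r. y \<bullet> e < g (y - (y \<bullet> e) *\<^sub>R e)})"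

definition Dop :: "real \<Rightarrow> nat \<Rightarrow> (('d::finite \<Rightarrow> nat) \<Rightarrow> real^'d \<Rightarrow> real) \<Rightarrow> (real^'d \<Rightarrow> real) \<Rightarrow> real^'d \<Rightarrow> real" where
  "Dop L s p f x = (\<Sum>\<alpha>\<in>{\<alpha>. mi_order \<alpha> \<le> s}. p \<alpha> x * wderiv L \<alpha> f x)"

definition Bform :: "real \<Rightarrow> nat \<Rightarrow> real \<Rightarrow> real \<Rightarrow> (real^'d::finite) set \<Rightarrow> (('d \<Rightarrow> nat) \<Rightarrow> real^'d \<Rightarrow> real)
    \<Rightarrow> (real^'d \<Rightarrow> real) \<Rightarrow> (real^'d \<Rightarrow> real) \<Rightarrow> real" where
  "Bform L s lam mu \<Omega> p u v =
     lam * (\<Sum>\<alpha>\<in>{\<alpha>. mi_order \<alpha> \<le> s}. \<integral>x. wderiv L \<alpha> u x * wderiv L \<alpha> v x \<partial>lebesgue_on (ocube (2*L)))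
     + mu * (\<integral>x. Dop L s p u x * Dop L s p v x \<partial>lebesgue_on \<Omega>)"

definition Oop :: "real \<Rightarrow> nat \<Rightarrow> real \<Rightarrow> real \<Rightarrow> (real^'d::finite) set \<Rightarrow> (('d \<Rightarrow> nat) \<Rightarrow> real^'d \<Rightarrow> real)
    \<Rightarrow> (real^'d \<Rightarrow> real) \<Rightarrow> real^'d \<Rightarrow> real" where
  "Oop L s lam mu \<Omega> p f = (SOME w. w \<in> Hper L s \<and>
      (\<forall>\<phi>\<in>Hper L s. Bform L s lam mu \<Omega> p w \<phi> = l2_inner (ccube (2*L)) \<phi> f))"

definition Oinvsqrt :: "real \<Rightarrow> (nat \<Rightarrow> real) \<Rightarrow> (nat \<Rightarrow> real^'d::finite \<Rightarrow> real) \<Rightarrow> (real^'d \<Rightarrow> real) \<Rightarrow> real^'d \<Rightarrow> real" where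
  "Oinvsqrt L a v f = (SOME h. L2_on (ccube (2*L)) h \<and>
      (\<lambda>N. \<integral>x. ((\<Sum>m<N. (a m) powr (-1/2) * l2_inner (ccube (2*L)) (v m) f * v m x) - h x)^2
                 \<partial>lebesgue_on (ccube (2*L))) \<longlonglongrightarrow> 0)"

definition rkhs_inner :: "real \<Rightarrow> (nat \<Rightarrow> real) \<Rightarrow> (nat \<Rightarrow> real^'d::finite \<Rightarrow> real) \<Rightarrow> (real^'d \<Rightarrow> real) \<Rightarrow> (real^'d \<Rightarrow> real) \<Rightarrow> real" where
  "rkhs_inner L a v f g = l2_inner (ccube (2*L)) (Oinvsqrt L a v f) (Oinvsqrt L a v g)"

definition kernel :: "(nat \<Rightarrow> real) \<Rightarrow> (nat \<Rightarrow> real^'d::finite \<Rightarrow> real) \<Rightarrow> real^'d \<Rightarrow> real^'d \<Rightarrow> real" where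
  "kernel a v x y = (\<Sum>m. a m * v m x * v m y)"

end

theory Submission
  imports Defs "HOL-Computational_Algebra.Polynomial"
begin

text \<open>
  A function in \<open>Hper\<close> tested against waves \<open>\<Prod>i. cos (\<omega> k\<^sub>i (x\<^sub>i - y\<^sub>i))\<close> has coefficients whose decay is
  controlled, via Bessel's inequality, by the \<open>L\<^sup>2\<close>-norms of \<open>f\<close> and of its pure derivatives of order \<open>s\<close>.
  Since \<open>\<Sum>k. 1 / (1 + \<Sum>i. (\<omega> k\<^sub>i)\<^bsup>2s\<^esup>)\<close> converges for \<open>2 s > d\<close> and products of Fejer kernels
  approximate the identity, point evaluation is bounded on \<open>Hper\<close> (the Sobolev embedding). This makes
  \<open>Hper\<close> complete for the \<open>H\<^sup>s\<close>-norm, hence for the equivalent norm of the form \<open>B\<close>.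

  The Riesz representation theorem then shows that \<open>Oop\<close> is well defined, so the eigenfunctions satisfy
  \<open>B[v\<^sub>m, \<phi>] = \<langle>v\<^sub>m, \<phi>\<rangle> / a\<^sub>m\<close> and \<open>\<surd>a\<^sub>m v\<^sub>m\<close> is a \<open>B\<close>-orthonormal basis. Parseval's identity in this
  basis says that the RKHS inner product is \<open>B\<close>, and expanding the Riesz representer of the evaluation at
  \<open>x\<close> in it gives the kernel series.
\<close>

section \<open>Semi-inner product spaces of functions\<close>

text \<open>All objects are functions, not classes modulo null sets, and \<open>wderiv\<close>,
  \<open>Oop\<close> and \<open>Oinvsqrt\<close> are \<open>SOME\<close> choices. So the forms below
  need not be definite, a weak derivative is determined and linear only almost everywhere, and a
  chosen object has its properties only once a witness is known: the fundamental lemma of the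
  calculus of variations has to precede linearity of the H^s form, and Riesz has to precede any use
  of the eigenvalue equation.

  Periodicity is recorded only through weak derivatives of the extension on the open cube of
  half-width 4L, where test functions have compact support, so a wave is not admissible as it
  stands. A factor supported in [-3L, 3L] in each coordinate, whose translates by 4L sum to 1, makes
  it admissible; cutting the large cube into period cells removes that factor again.

  The embedding bounds the continuous representative at every point of the closed cube. This turns
  the almost-everywhere conclusion of L2-completeness of the eigenfunctions into pointwise
  identities for the kernel.\<close>

locale semi_inner =
  fixes V :: "('x \<Rightarrow> real) set" and B :: "('x \<Rightarrow> real) \<Rightarrow> ('x \<Rightarrow> real) \<Rightarrow> real"
  assumes zero_mem: "(\<lambda>x. 0) \<in> V"
    and lin_mem: "\<And>f g c d. f \<in> V \<Longrightarrow> g \<in> V \<Longrightarrow> (\<lambda>x. c * f x + d * g x) \<in> V"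
    and sym: "\<And>f g. f \<in> V \<Longrightarrow> g \<in> V \<Longrightarrow> B f g = B g f"
    and lin: "\<And>f g h c d. f \<in> V \<Longrightarrow> g \<in> V \<Longrightarrow> h \<in> V \<Longrightarrow>
                B (\<lambda>x. c * f x + d * g x) h = c * B f h + d * B g h"
    and nonneg: "\<And>f. f \<in> V \<Longrightarrow> B f f \<ge> 0"
begin

lemma lin2: "f \<in> V \<Longrightarrow> g \<in> V \<Longrightarrow> h \<in> V \<Longrightarrow> B h (\<lambda>x. c * f x + d * g x) = c * B h f + d * B h g"
  using lin[of f g h c d] sym[of h] lin_mem[of f g c d] by simp

lemma diff_mem: "f \<in> V \<Longrightarrow> g \<in> V \<Longrightarrow> (\<lambda>x. f x - g x) \<in> V"
  using lin_mem[of f g 1 "-1"] by simp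

lemma diff_left: "f \<in> V \<Longrightarrow> g \<in> V \<Longrightarrow> h \<in> V \<Longrightarrow> B (\<lambda>x. f x - g x) h = B f h - B g h"
  using lin[of f g h 1 "-1"] by simp

lemma diff_right: "f \<in> V \<Longrightarrow> g \<in> V \<Longrightarrow> h \<in> V \<Longrightarrow> B h (\<lambda>x. f x - g x) = B h f - B h g"
  using lin2[of f g h 1 "-1"] by simp

lemma scale_mem: "f \<in> V \<Longrightarrow> (\<lambda>x. c * f x) \<in> V"
  using lin_mem[of f f c 0] by simp

lemma scale_left: "f \<in> V \<Longrightarrow> g \<in> V \<Longrightarrow> B (\<lambda>x. c * f x) g = c * B f g"
  using lin[of f f g c 0] by simp

lemma scale_right: "f \<in> V \<Longrightarrow> g \<in> V \<Longrightarrow> B f (\<lambda>x. c * g x) = c * B f g"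
  using lin2[of g g f c 0] by simp

lemma zero_left: "f \<in> V \<Longrightarrow> B (\<lambda>x. 0) f = 0"
  using scale_left[of "\<lambda>x. 0" f 0] zero_mem by simp

lemma sum_mem: "finite K \<Longrightarrow> (\<And>k. k \<in> K \<Longrightarrow> u k \<in> V) \<Longrightarrow> (\<lambda>x. \<Sum>k\<in>K. c k * u k x) \<in> V"
proof (induction K rule: finite_induct)
  case empty
  then show ?case using zero_mem by simp
next
  case (insert k K)
  then have "(\<lambda>x. c k * u k x + 1 * (\<Sum>k\<in>K. c k * u k x)) \<in> V"
    by (intro lin_mem) auto
  then show ?case using insert by simp
qed

lemma sum_left: "finite K \<Longrightarrow> (\<And>k. k \<in> K \<Longrightarrow> u k \<in> V) \<Longrightarrow> f \<in> V \<Longrightarrow>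
    B (\<lambda>x. \<Sum>k\<in>K. c k * u k x) f = (\<Sum>k\<in>K. c k * B (u k) f)"
proof (induction K rule: finite_induct)
  case empty
  then show ?case using zero_left by simp
next
  case (insert k K)
  then have "B (\<lambda>x. c k * u k x + 1 * (\<Sum>k\<in>K. c k * u k x)) f
      = c k * B (u k) f + 1 * B (\<lambda>x. \<Sum>k\<in>K. c k * u k x) f"
    by (intro lin sum_mem) auto
  then show ?case using insert by simp
qed

lemma sum_right:
  assumes "finite K" "\<And>k. k \<in> K \<Longrightarrow> u k \<in> V" "f \<in> V"
  shows "B f (\<lambda>x. \<Sum>k\<in>K. c k * u k x) = (\<Sum>k\<in>K. c k * B f (u k))"
proof -
  have "B f (\<lambda>x. \<Sum>k\<in>K. c k * u k x) = B (\<lambda>x. \<Sum>k\<in>K. c k * u k x) f"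
    by (intro sym sum_mem assms)
  also have "\<dots> = (\<Sum>k\<in>K. c k * B (u k) f)" by (intro sum_left assms)
  also have "\<dots> = (\<Sum>k\<in>K. c k * B f (u k))" using assms sym by (intro sum.cong) auto
  finally show ?thesis .
qed

lemma square_diff: "f \<in> V \<Longrightarrow> g \<in> V \<Longrightarrow>
    B (\<lambda>x. f x - g x) (\<lambda>x. f x - g x) = B f f - 2 * B f g + B g g"
  using diff_left[of f g "\<lambda>x. f x - g x"] diff_right[of f g f] diff_right[of f g g] diff_mem[of f g] sym[of f g]
  by simp

lemma square_lin: "f \<in> V \<Longrightarrow> g \<in> V \<Longrightarrow>
    B (\<lambda>x. c * f x + d * g x) (\<lambda>x. c * f x + d * g x) = c^2 * B f f + 2 * c * d * B f g + d^2 * B g g"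
  using lin[of f g "\<lambda>x. c * f x + d * g x" c d] lin2[of f g f c d] lin2[of f g g c d] lin_mem[of f g c d] sym[of f g]
  by (simp add: algebra_simps power2_eq_square)

text \<open>The square of f + t g is a nonnegative quadratic in t. As \<open>B\<close> may be
  degenerate, \<open>B g g = 0\<close> needs its own case: the quadratic is then affine in t and
  bounded below, so its slope vanishes.\<close>

lemma Cauchy_Schwarz:
  assumes f: "f \<in> V" and g: "g \<in> V"
  shows "(B f g)\<^sup>2 \<le> B f f * B g g"
proof -
  have q: "0 \<le> B f f + 2 * t * B f g + t^2 * B g g" for t
    using nonneg[OF lin_mem[OF f g, of 1 t]] square_lin[OF f g, of 1 t] by simp
  show ?thesis
  proof (cases "B g g = 0")
    case True
    have "B f g = 0"
    proof (rule ccontr)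
      assume n: "B f g \<noteq> 0"
      have "0 \<le> B f f + 2 * (- (B f f + 1) / (2 * B f g)) * B f g"
        using q[of "- (B f f + 1) / (2 * B f g)"] True by simp
      also have "\<dots> = -1" using n by (simp add: field_simps)
      finally show False by simp
    qed
    then show ?thesis using True by simp
  next
    case False
    then have p: "B g g > 0" using nonneg[OF g] by simp
    have "0 \<le> B f f + 2 * (- B f g / B g g) * B f g + (- B f g / B g g)^2 * B g g" by (rule q)
    also have "\<dots> = B f f - (B f g)\<^sup>2 / B g g"
      using p by (simp add: power2_eq_square field_simps)
    finally show ?thesis using p by (simp add: field_simps)
  qed
qed

lemma tendsto_left:
  assumes F: "\<And>n. F n \<in> V" and f: "f \<in> V" and g: "g \<in> V"
    and lim: "(\<lambda>n. B (\<lambda>x. F n x - f x) (\<lambda>x. F n x - f x)) \<longlonglongrightarrow> 0"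
  shows "(\<lambda>n. B (F n) g) \<longlonglongrightarrow> B f g"
proof -
  have "(\<lambda>n. sqrt (B (\<lambda>x. F n x - f x) (\<lambda>x. F n x - f x) * B g g)) \<longlonglongrightarrow> sqrt (0 * B g g)"
    by (intro tendsto_intros lim)
  then have l: "(\<lambda>n. sqrt (B (\<lambda>x. F n x - f x) (\<lambda>x. F n x - f x) * B g g)) \<longlonglongrightarrow> 0" by simp
  have b: "norm (B (F n) g - B f g) \<le> sqrt (B (\<lambda>x. F n x - f x) (\<lambda>x. F n x - f x) * B g g)" for n
    using Cauchy_Schwarz[OF diff_mem[OF F f] g, of n] diff_left[OF F f g, of n]
    by (intro real_le_rsqrt) simp
  have "(\<lambda>n. B (F n) g - B f g) \<longlonglongrightarrow> 0"
    using Lim_null_comparison[OF _ l, of "\<lambda>n. B (F n) g - B f g"] b by simp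
  then show ?thesis by (simp add: LIM_zero_iff)
qed

text \<open>Expand the square of f - S, where S has the coefficients \<open>B f (u k) / A\<close>.
  Dividing by the common bound \<open>A\<close> instead of \<open>B (u k) (u k)\<close> allows
  vectors of different and even zero length: a phase-shifted wave with a frequency 0 can vanish
  identically.\<close>

lemma Bessel_orthogonal:
  assumes K: "finite K" and u: "\<And>k. k \<in> K \<Longrightarrow> u k \<in> V" and f: "f \<in> V"
    and orth: "\<And>k l. k \<in> K \<Longrightarrow> l \<in> K \<Longrightarrow> k \<noteq> l \<Longrightarrow> B (u k) (u l) = 0"
    and bd: "\<And>k. k \<in> K \<Longrightarrow> B (u k) (u k) \<le> A" and A: "A > 0"
  shows "(\<Sum>k\<in>K. (B f (u k))\<^sup>2) \<le> A * B f f"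
proof -
  define S where "S = (\<lambda>x. \<Sum>k\<in>K. (B f (u k) / A) * u k x)"
  have SV: "S \<in> V" unfolding S_def by (intro sum_mem K u)
  have fS: "B f S = (\<Sum>k\<in>K. (B f (u k))\<^sup>2) / A"
    unfolding S_def by (subst sum_right[OF K u f]) (auto simp: power2_eq_square sum_divide_distrib)
  have uS: "B (u k) S = (B f (u k) / A) * B (u k) (u k)" if k: "k \<in> K" for k
  proof -
    have "B (u k) S = (\<Sum>l\<in>K. (B f (u l) / A) * B (u k) (u l))"
      unfolding S_def by (intro sum_right K u k)
    also have "\<dots> = (\<Sum>l\<in>K. if l = k then (B f (u k) / A) * B (u k) (u k) else 0)"
      using orth k by (intro sum.cong) auto
    finally show ?thesis using k K by simp
  qed
  have "B S S = (\<Sum>k\<in>K. (B f (u k) / A) * B (u k) S)"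
    unfolding S_def by (subst sum_left) (use K u SV in \<open>auto simp: S_def\<close>)
  also have "\<dots> = (\<Sum>k\<in>K. (B f (u k))\<^sup>2 * B (u k) (u k) / A\<^sup>2)"
    using uS by (intro sum.cong) (auto simp: power2_eq_square)
  also have "\<dots> \<le> (\<Sum>k\<in>K. (B f (u k))\<^sup>2 * A / A\<^sup>2)"
    using bd by (intro sum_mono divide_right_mono mult_left_mono) auto
  also have "\<dots> = (\<Sum>k\<in>K. (B f (u k))\<^sup>2) / A"
    using A by (simp add: sum_divide_distrib power2_eq_square)
  finally have SS: "B S S \<le> (\<Sum>k\<in>K. (B f (u k))\<^sup>2) / A" .
  have "0 \<le> B f f - 2 * B f S + B S S"
    using nonneg[OF diff_mem[OF f SV]] square_diff[OF f SV] by simp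
  then have "(\<Sum>k\<in>K. (B f (u k))\<^sup>2) / A \<le> B f f" using SS fS by simp
  then show ?thesis using A by (simp add: field_simps)
qed

end

locale semi_hilbert = semi_inner +
  assumes complete: "\<And>F. (\<And>k. F k \<in> V) \<Longrightarrow>
      (\<And>e. e > 0 \<Longrightarrow> \<exists>N. \<forall>j\<ge>N. \<forall>k\<ge>N. B (\<lambda>x. F j x - F k x) (\<lambda>x. F j x - F k x) < e) \<Longrightarrow>
      \<exists>f\<in>V. (\<lambda>k. B (\<lambda>x. F k x - f x) (\<lambda>x. F k x - f x)) \<longlonglongrightarrow> 0"
begin

text \<open>The representing element is the limit of a minimising sequence of \<open>B f f - 2 * l f\<close>.\<close>

lemma Riesz_representation:
  assumes l_lin: "\<And>f g c d. f \<in> V \<Longrightarrow> g \<in> V \<Longrightarrow> l (\<lambda>x. c * f x + d * g x) = c * l f + d * l g"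
    and l_bd: "\<And>f. f \<in> V \<Longrightarrow> (l f)\<^sup>2 \<le> C * B f f"
  shows "\<exists>w\<in>V. \<forall>f\<in>V. B w f = (l f :: real)"
proof -
  define J where "J f = B f f - 2 * l f" for f
  define m where "m = Inf (J ` V)"
  \<comment> \<open>A bounded functional makes \<open>J\<close> bounded below: \<open>l f\<close> is
    at most the geometric, hence the arithmetic, mean of \<open>\<bar>C\<bar>\<close> and
    \<open>B f f\<close>. The absolute value covers a constant of either sign.\<close>
  have low: "- \<bar>C\<bar> \<le> J f" if "f \<in> V" for f
  proof -
    have "(l f)\<^sup>2 \<le> \<bar>C\<bar> * B f f"
      using l_bd[OF that] nonneg[OF that] by (smt (verit) mult_right_mono)
    also have "\<dots> \<le> ((\<bar>C\<bar> + B f f) / 2)\<^sup>2"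
      using sum_squares_bound[of "\<bar>C\<bar>" "B f f"] by (simp add: power2_eq_square field_simps)
    finally have "l f \<le> (\<bar>C\<bar> + B f f) / 2"
      by (rule power2_le_imp_le) (use nonneg[OF that] in auto)
    then show ?thesis unfolding J_def by (simp add: field_simps)
  qed
  have bdd: "bdd_below (J ` V)" using low by (intro bdd_belowI[of _ "- \<bar>C\<bar>"]) auto
  have ml: "m \<le> J f" if "f \<in> V" for f unfolding m_def using bdd that by (intro cInf_lower) auto
  have "\<exists>f\<in>V. J f < m + 1 / Suc n" for n
  proof -
    have "\<exists>y\<in>J ` V. y < m + 1 / Suc n"
      by (rule cInf_lessD) (use zero_mem in \<open>auto simp: m_def\<close>)
    then show ?thesis by auto
  qed
  then obtain F where FV: "\<And>n. F n \<in> V" and FJ: "\<And>n. J (F n) < m + 1 / Suc n" by metis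
  have l_half: "l (\<lambda>x. (1/2) * F j x + (1/2) * F k x) = (1/2) * l (F j) + (1/2) * l (F k)" for j k
    by (rule l_lin) (rule FV)+
  \<comment> \<open>Parallelogram argument: \<open>J\<close> is at least \<open>m\<close> at the
    midpoint of \<open>F j\<close> and \<open>F k\<close> too, which forces two near-minimisers to
    be close.\<close>
  have par: "B (\<lambda>x. F j x - F k x) (\<lambda>x. F j x - F k x) \<le> 2 / Suc j + 2 / Suc k" for j k
  proof -
    have "m \<le> J (\<lambda>x. (1/2) * F j x + (1/2) * F k x)" by (intro ml lin_mem FV)
    also have "\<dots> = B (F j) (F j) / 4 + B (F j) (F k) / 2 + B (F k) (F k) / 4 - l (F j) - l (F k)"
      unfolding J_def l_half square_lin[OF FV FV] by (simp add: power2_eq_square)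
    finally show ?thesis
      using FJ[of j] FJ[of k] square_diff[OF FV FV, of j k] unfolding J_def by simp
  qed
  have "\<exists>w\<in>V. (\<lambda>k. B (\<lambda>x. F k x - w x) (\<lambda>x. F k x - w x)) \<longlonglongrightarrow> 0"
  proof (rule complete)
    fix e :: real assume e: "e > 0"
    obtain N where N: "1 / real (Suc N) < e / 4" using e nat_approx_posE[of "e/4"] by auto
    have "B (\<lambda>x. F j x - F k x) (\<lambda>x. F j x - F k x) < e" if "j \<ge> N" "k \<ge> N" for j k
    proof -
      have "1 / real (Suc j) \<le> 1 / real (Suc N)" "1 / real (Suc k) \<le> 1 / real (Suc N)"
        using that by (auto simp: field_simps)
      then show ?thesis using par[of j k] N by simp
    qed
    then show "\<exists>N. \<forall>j\<ge>N. \<forall>k\<ge>N. B (\<lambda>x. F j x - F k x) (\<lambda>x. F j x - F k x) < e" by blast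
  qed (rule FV)
  then obtain w where wV: "w \<in> V" and w: "(\<lambda>k. B (\<lambda>x. F k x - w x) (\<lambda>x. F k x - w x)) \<longlonglongrightarrow> 0" by blast
  have "B w f = l f" if f: "f \<in> V" for f
  proof -
    \<comment> \<open>Moving the near-minimiser \<open>F n\<close> by t f cannot bring
      \<open>J\<close> below \<open>m\<close>; the excess 1/(n + 1) vanishes in the limit and the
      first variation of \<open>J\<close> at \<open>w\<close> remains.\<close>
    have q: "0 \<le> 2 * t * (B w f - l f) + t^2 * B f f" for t
    proof -
      have "- (1 / Suc n) \<le> 2 * t * (B (F n) f - l f) + t^2 * B f f" for n
        using ml[OF lin_mem[OF FV f, of 1 n t]] FJ[of n]
        unfolding J_def square_lin[OF FV f] l_lin[OF FV f] by (simp add: algebra_simps)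
      moreover have "(\<lambda>n. - (1 / real (Suc n))) \<longlonglongrightarrow> 0"
        using tendsto_minus[OF lim_inverse_n'[THEN LIMSEQ_Suc]] by simp
      moreover have "(\<lambda>n. 2 * t * (B (F n) f - l f) + t^2 * B f f) \<longlonglongrightarrow> 2 * t * (B w f - l f) + t^2 * B f f"
        by (intro tendsto_intros tendsto_left[OF FV wV f w])
      ultimately show ?thesis by (intro LIMSEQ_le) auto
    qed
    define D where "D = B w f - l f"
    \<comment> \<open>The added 1 keeps the divisor positive when \<open>B f f = 0\<close>.\<close>
    define b where "b = B f f + 1"
    have b: "b > 0" "B f f < b" using nonneg[OF f] by (auto simp: b_def)
    have "0 \<le> 2 * (- D / b) * D + (- D / b)^2 * B f f" using q[of "- D / b"] by (simp add: D_def)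
    also have "\<dots> \<le> 2 * (- D / b) * D + (- D / b)^2 * b" using b by (intro add_left_mono mult_left_mono) auto
    also have "\<dots> = - (D^2) / b" using b by (simp add: power2_eq_square field_simps)
    finally have "D^2 \<le> 0" using b by (simp add: divide_le_0_iff)
    then show ?thesis by (simp add: D_def)
  qed
  then show ?thesis using wV by blast
qed

text \<open>By orthonormality the squared distance of two partial sums is the difference of partial
  sums of the squared coefficients, so summability is exactly the Cauchy condition.\<close>

lemma orthonormal_series:
  assumes e: "\<And>m. e m \<in> V" and orth: "\<And>m k::nat. B (e m) (e k) = (if m = k then 1 else 0)"
    and sum: "summable (\<lambda>m. (c m)\<^sup>2)"
  obtains h where "h \<in> V"
    "(\<lambda>N. B (\<lambda>x. (\<Sum>m<N. c m * e m x) - h x) (\<lambda>x. (\<Sum>m<N. c m * e m x) - h x)) \<longlonglongrightarrow> 0"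
proof -
  define S where "S N = (\<lambda>x. \<Sum>m<N. c m * e m x)" for N :: nat
  have SV: "S N \<in> V" for N unfolding S_def by (intro sum_mem e) auto
  have Se: "B (S N) (e m) = (if m < N then c m else 0)" for N m
  proof -
    have "B (S N) (e m) = (\<Sum>k<N. c k * B (e k) (e m))" unfolding S_def by (intro sum_left e) auto
    also have "\<dots> = (\<Sum>k<N. if k = m then c m else 0)" by (intro sum.cong) (auto simp: orth)
    finally show ?thesis by auto
  qed
  have SS: "B (S N) (S M) = (\<Sum>m<min N M. (c m)\<^sup>2)" for N M
  proof -
    have "B (S N) (S M) = (\<Sum>m<M. c m * B (S N) (e m))"
      unfolding S_def[of M] by (intro sum_right e SV) auto
    also have "\<dots> = (\<Sum>m<M. if m < N then (c m)\<^sup>2 else 0)"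
      by (intro sum.cong) (auto simp: Se power2_eq_square)
    also have "\<dots> = (\<Sum>m<min N M. (c m)\<^sup>2)"
      by (rule sum.mono_neutral_cong_right) auto
    finally show ?thesis .
  qed
  have diff: "B (\<lambda>x. S j x - S k x) (\<lambda>x. S j x - S k x) = \<bar>(\<Sum>m<j. (c m)\<^sup>2) - (\<Sum>m<k. (c m)\<^sup>2)\<bar>" for j k
  proof -
    have mono: "(\<Sum>m<i. (c m)\<^sup>2) \<le> (\<Sum>m<l. (c m)\<^sup>2)" if "i \<le> l" for i l
      using that by (intro sum_mono2) auto
    show ?thesis unfolding square_diff[OF SV SV] SS
      using mono[of j k] mono[of k j] by (cases "j \<le> k") (auto simp: min_def)
  qed
  have "\<exists>h\<in>V. (\<lambda>k. B (\<lambda>x. S k x - h x) (\<lambda>x. S k x - h x)) \<longlonglongrightarrow> 0"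
  proof (rule complete[OF SV])
    fix \<epsilon> :: real assume "\<epsilon> > 0"
    moreover have "Cauchy (\<lambda>N. \<Sum>m<N. (c m)\<^sup>2)"
      using sum by (simp add: summable_iff_convergent convergent_Cauchy)
    ultimately show "\<exists>N. \<forall>j\<ge>N. \<forall>k\<ge>N. B (\<lambda>x. S j x - S k x) (\<lambda>x. S j x - S k x) < \<epsilon>"
      unfolding diff by (auto simp: Cauchy_def dist_real_def)
  qed
  then show ?thesis using that unfolding S_def by blast
qed

end

section \<open>Square-integrable functions\<close>

text \<open>A set of functions over an arbitrary measure is the shape that the locales take;
  \<open>L2_on S\<close> is the case \<open>lebesgue_on S\<close>.\<close>

definition l2 :: "'a measure \<Rightarrow> ('a \<Rightarrow> real) set" where
  "l2 M = {f \<in> borel_measurable M. integrable M (\<lambda>x. (f x)\<^sup>2)}"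

lemma l2_product_integrable:
  assumes "f \<in> l2 M" "g \<in> l2 M"
  shows "integrable M (\<lambda>x. f x * g x)"
proof (rule Bochner_Integration.integrable_bound)
  show "integrable M (\<lambda>x. (f x)\<^sup>2 + (g x)\<^sup>2)" using assms by (auto simp: l2_def)
  show "(\<lambda>x. f x * g x) \<in> borel_measurable M" using assms by (auto simp: l2_def)
  have "\<bar>a * b\<bar> \<le> a\<^sup>2 + b\<^sup>2" for a b :: real
  proof -
    have "2 * (\<bar>a\<bar> * \<bar>b\<bar>) \<le> a\<^sup>2 + b\<^sup>2" using sum_squares_bound[of "\<bar>a\<bar>" "\<bar>b\<bar>"] by simp
    moreover have "0 \<le> \<bar>a\<bar> * \<bar>b\<bar>" by simp
    ultimately show ?thesis unfolding abs_mult by linarith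
  qed
  then have "norm (f x * g x) \<le> norm ((f x)\<^sup>2 + (g x)\<^sup>2)" for x by simp
  then show "AE x in M. norm (f x * g x) \<le> norm ((f x)\<^sup>2 + (g x)\<^sup>2)" by simp
qed

lemma l2_lin:
  assumes f: "f \<in> l2 M" and g: "g \<in> l2 M"
  shows "(\<lambda>x. c * f x + d * g x) \<in> l2 M"
proof -
  have "(\<lambda>x. (c * f x + d * g x)\<^sup>2) = (\<lambda>x. c\<^sup>2 * (f x)\<^sup>2 + 2 * c * d * (f x * g x) + d\<^sup>2 * (g x)\<^sup>2)"
    by (auto simp: power2_eq_square algebra_simps)
  moreover have "integrable M (\<lambda>x. c\<^sup>2 * (f x)\<^sup>2 + 2 * c * d * (f x * g x) + d\<^sup>2 * (g x)\<^sup>2)"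
    using f g by (intro Bochner_Integration.integrable_add integrable_mult_right l2_product_integrable) (auto simp: l2_def)
  moreover have "(\<lambda>x. c * f x + d * g x) \<in> borel_measurable M" using f g by (auto simp: l2_def)
  ultimately show ?thesis by (simp add: l2_def)
qed

lemma semi_inner_l2: "semi_inner (l2 M) (\<lambda>f g. \<integral>x. f x * g x \<partial>M)"
proof
  show "(\<lambda>x. 0) \<in> l2 M" by (simp add: l2_def)
next
  fix f g h :: "'a \<Rightarrow> real" and c d :: real
  assume f: "f \<in> l2 M" and g: "g \<in> l2 M" and h: "h \<in> l2 M"
  have "(\<integral>x. (c * f x + d * g x) * h x \<partial>M) = (\<integral>x. c * (f x * h x) + d * (g x * h x) \<partial>M)"
    by (simp add: algebra_simps)
  also have "\<dots> = c * (\<integral>x. f x * h x \<partial>M) + d * (\<integral>x. g x * h x \<partial>M)"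
    using l2_product_integrable[OF f h] l2_product_integrable[OF g h] by simp
  finally show "(\<integral>x. (c * f x + d * g x) * h x \<partial>M) = c * (\<integral>x. f x * h x \<partial>M) + d * (\<integral>x. g x * h x \<partial>M)" .
qed (auto intro: l2_lin simp: mult.commute)

lemma l2_bounded:
  assumes "finite_measure M" "f \<in> borel_measurable M" "\<And>x. x \<in> space M \<Longrightarrow> \<bar>f x\<bar> \<le> C"
  shows "f \<in> l2 M"
proof -
  interpret finite_measure M by fact
  have "\<bar>(f x)\<^sup>2\<bar> \<le> C\<^sup>2" if "x \<in> space M" for x
    using power_mono[OF assms(3)[OF that], of 2] by simp
  then have "integrable M (\<lambda>x. (f x)\<^sup>2)"
    using assms(2) by (intro integrable_const_bound[where B="C\<^sup>2"]) auto
  then show ?thesis using assms(2) by (simp add: l2_def)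
qed

lemma l2_integrable:
  assumes "finite_measure M" "f \<in> l2 M"
  shows "integrable M f"
proof -
  have "(\<lambda>x. 1) \<in> l2 M" by (rule l2_bounded[of M _ 1]) (use assms in auto)
  from l2_product_integrable[OF assms(2) this] show ?thesis by simp
qed

text \<open>Riesz--Fischer: a subsequence with geometrically decaying increments converges almost
  everywhere, and Fatou's lemma upgrades this to convergence in mean square.\<close>

lemma semi_hilbert_l2:
  assumes fin: "finite_measure M"
  shows "semi_hilbert (l2 M) (\<lambda>f g. \<integral>x. f x * g x \<partial>M)"
proof -
  interpret semi_inner "l2 M" "\<lambda>f g. \<integral>x. f x * g x \<partial>M" by (rule semi_inner_l2)
  interpret finite_measure M by fact
  show ?thesis
  proof
    fix F :: "nat \<Rightarrow> 'a \<Rightarrow> real"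
    assume F: "\<And>k. F k \<in> l2 M"
      and C: "\<And>e. e > 0 \<Longrightarrow> \<exists>N. \<forall>j\<ge>N. \<forall>k\<ge>N. (\<integral>x. (F j x - F k x) * (F j x - F k x) \<partial>M) < e"
    define D where "D j k = (\<integral>x. (F j x - F k x) * (F j x - F k x) \<partial>M)" for j k
    have Fm: "F k \<in> borel_measurable M" for k using F[of k] by (simp add: l2_def)
    have Fd: "(\<lambda>x. F j x - F k x) \<in> l2 M" for j k using diff_mem[OF F F] .
    \<comment> \<open>Squared distances below (1/4)^n give increments of norm at most (1/2)^n, which
      are summable.\<close>
    have "\<exists>N. \<forall>j\<ge>N. \<forall>k\<ge>N. D j k < (1/4)^n" for n
      using C[of "(1/4)^n"] by (simp add: D_def)
    then obtain N where N: "\<And>n j k. j \<ge> N n \<Longrightarrow> k \<ge> N n \<Longrightarrow> D j k < (1/4)^n" by metis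
    \<comment> \<open>Summing all thresholds up to n makes \<open>r\<close> monotone and at least
      \<open>N n\<close>; the extra n makes it tend to infinity.\<close>
    define r where "r n = (\<Sum>i\<le>n. N i) + n" for n
    have rN: "r n \<ge> N n" for n unfolding r_def using member_le_sum[of n "{..n}" N] by simp
    have rm: "r n \<le> r (Suc n)" for n by (simp add: r_def)
    have rn: "r n \<ge> n" for n by (simp add: r_def)
    define E where "E n x = F (r (Suc n)) x - F (r n) x" for n x
    have El2: "E n \<in> l2 M" for n unfolding E_def by (rule Fd)
    have Ei: "integrable M (E n)" for n by (rule l2_integrable[OF fin El2])
    have ED: "(\<integral>x. E n x * E n x \<partial>M) \<le> (1/4)^n" for n
      using N[of n "r (Suc n)" "r n"] rN[of n] rm[of n] by (simp add: D_def E_def)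
    define m where "m = measure M (space M)"
    \<comment> \<open>Here the measure has to be finite: Cauchy-Schwarz against the constant 1 turns
      the mean-square bound into an L1 bound.\<close>
    have E1: "(\<integral>x. \<bar>E n x\<bar> \<partial>M) \<le> sqrt m * (1/2)^n" for n
    proof -
      have one: "(\<lambda>x. 1) \<in> l2 M" by (rule l2_bounded[of M _ 1, OF fin]) auto
      have ab: "(\<lambda>x. \<bar>E n x\<bar>) \<in> l2 M" using El2[of n] by (auto simp: l2_def)
      have "(\<integral>x. \<bar>E n x\<bar> * 1 \<partial>M)\<^sup>2 \<le> (\<integral>x. \<bar>E n x\<bar> * \<bar>E n x\<bar> \<partial>M) * (\<integral>x. 1 * 1 \<partial>M)"
        by (rule Cauchy_Schwarz[OF ab one])
      also have "\<dots> = (\<integral>x. E n x * E n x \<partial>M) * m" by (simp add: m_def)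
      also have "\<dots> \<le> (1/4)^n * m" using ED[of n] by (intro mult_right_mono) (auto simp: m_def)
      also have "\<dots> = (sqrt m * (1/2)^n)\<^sup>2"
      proof -
        have "((1/2::real)^n)\<^sup>2 = ((1/2)\<^sup>2)^n" by (simp only: power_mult[symmetric] mult.commute)
        also have "\<dots> = (1/4)^n" by (simp add: power2_eq_square)
        finally have "((1/2::real)^n)\<^sup>2 = (1/4)^n" .
        then show ?thesis unfolding power_mult_distrib by (simp add: m_def)
      qed
      finally have "(\<integral>x. \<bar>E n x\<bar> \<partial>M)\<^sup>2 \<le> (sqrt m * (1/2)^n)\<^sup>2" by simp
      then show ?thesis by (rule power2_le_imp_le) (auto simp: m_def)
    qed
    have "AE x in M. summable (\<lambda>n. \<bar>E n x\<bar>)"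
    proof -
      have Em: "E n \<in> borel_measurable M" for n using Ei by auto
      have "(\<integral>\<^sup>+x. (\<Sum>n. ennreal \<bar>E n x\<bar>) \<partial>M) = (\<Sum>n. \<integral>\<^sup>+x. ennreal \<bar>E n x\<bar> \<partial>M)"
        using Em by (intro nn_integral_suminf) auto
      also have "\<dots> = (\<Sum>n. ennreal (\<integral>x. \<bar>E n x\<bar> \<partial>M))"
        using Ei by (intro suminf_cong nn_integral_eq_integral) auto
      also have "\<dots> \<le> (\<Sum>n. ennreal (sqrt m * (1/2)^n))"
        by (intro suminf_le ennreal_leI E1) auto
      also have "\<dots> < \<infinity>"
        by (subst suminf_ennreal2) (auto simp: m_def intro!: summable_mult)
      finally have "(\<integral>\<^sup>+x. (\<Sum>n. ennreal \<bar>E n x\<bar>) \<partial>M) \<noteq> \<infinity>" by simp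
      then have "AE x in M. (\<Sum>n. ennreal \<bar>E n x\<bar>) \<noteq> \<infinity>"
        using Em by (intro nn_integral_noteq_infinite) auto
      then show ?thesis by eventually_elim (auto intro: summable_suminf_not_top)
    qed
    then have conv: "AE x in M. convergent (\<lambda>n. F (r n) x)"
    proof eventually_elim
      case (elim x)
      then have "summable (\<lambda>n. E n x)" by (rule summable_rabs_cancel)
      then have "convergent (\<lambda>n. \<Sum>i<n. E i x)" by (simp add: summable_iff_convergent)
      moreover have "(\<Sum>i<n. E i x) = F (r n) x - F (r 0) x" for n
        unfolding E_def by (rule sum_lessThan_telescope)
      ultimately have "convergent (\<lambda>n. F (r n) x - F (r 0) x)" by simp
      from convergent_add[OF this convergent_const[of "F (r 0) x"]] show ?case by simp
    qed
    \<comment> \<open>On the null set where the subsequence diverges \<open>lim\<close> has an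
      arbitrary value; measurability holds all the same.\<close>
    define f where "f x = lim (\<lambda>n. F (r n) x)" for x
    have fm: "f \<in> borel_measurable M" unfolding f_def using Fm by (intro borel_measurable_lim_metric) auto
    have lim: "AE x in M. (\<lambda>n. F (r n) x) \<longlonglongrightarrow> f x"
      using conv by eventually_elim (simp add: f_def convergent_LIMSEQ_iff)
    have Fatou: "(\<integral>\<^sup>+x. ennreal ((F k x - f x)\<^sup>2) \<partial>M) \<le> ennreal e" if e: "e \<ge> 0" and k: "\<forall>\<^sub>F n in sequentially. D k (r n) \<le> e" for k e
    proof -
      have "(\<integral>\<^sup>+x. ennreal ((F k x - f x)\<^sup>2) \<partial>M) = (\<integral>\<^sup>+x. liminf (\<lambda>n. ennreal ((F k x - F (r n) x)\<^sup>2)) \<partial>M)"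
      proof (rule nn_integral_cong_AE)
        show "AE x in M. ennreal ((F k x - f x)\<^sup>2) = liminf (\<lambda>n. ennreal ((F k x - F (r n) x)\<^sup>2))"
          using lim
        proof eventually_elim
          case (elim x)
          have "(\<lambda>n. ennreal ((F k x - F (r n) x)\<^sup>2)) \<longlonglongrightarrow> ennreal ((F k x - f x)\<^sup>2)"
            by (intro tendsto_ennrealI tendsto_intros elim)
          then show ?case by (intro lim_imp_Liminf[symmetric]) auto
        qed
      qed
      also have "\<dots> \<le> liminf (\<lambda>n. \<integral>\<^sup>+x. ennreal ((F k x - F (r n) x)\<^sup>2) \<partial>M)"
        using Fm by (intro nn_integral_liminf) auto
      also have "\<dots> = liminf (\<lambda>n. ennreal (D k (r n)))"
      proof -
        have "(\<integral>\<^sup>+x. ennreal ((F k x - F (r n) x)\<^sup>2) \<partial>M) = ennreal (D k (r n))" for n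
          unfolding D_def power2_eq_square using Fd[of k "r n"]
          by (intro nn_integral_eq_integral) (auto simp: l2_def power2_eq_square)
        then show ?thesis by simp
      qed
      also have "\<dots> \<le> limsup (\<lambda>n. ennreal (D k (r n)))" by (intro Liminf_le_Limsup) simp
      also have "\<dots> \<le> ennreal e"
        using k by (intro Limsup_bounded) (auto elim!: eventually_mono intro: ennreal_leI)
      finally show ?thesis .
    qed
    have l2: "(\<lambda>x. F k x - f x) \<in> l2 M \<and> (\<integral>x. (F k x - f x) * (F k x - f x) \<partial>M) \<le> e" 
      if e: "e \<ge> 0" and k: "\<forall>\<^sub>F n in sequentially. D k (r n) \<le> e" for k e
    proof -
      have i: "integrable M (\<lambda>x. (F k x - f x)\<^sup>2)"
        using Fatou[OF that] fm Fm by (intro integrableI_bounded) (auto simp: le_less_trans)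
      moreover have "ennreal (\<integral>x. (F k x - f x)\<^sup>2 \<partial>M) \<le> ennreal e"
        using Fatou[OF that] i by (subst (asm) nn_integral_eq_integral) auto
      ultimately show ?thesis using fm Fm e by (auto simp: l2_def power2_eq_square)
    qed
    have ev: "\<exists>K. \<forall>k\<ge>K. \<forall>\<^sub>F n in sequentially. D k (r n) \<le> e" if "e > 0" for e
    proof -
      obtain K where K: "\<forall>j\<ge>K. \<forall>k\<ge>K. D j k < e" using C[OF \<open>e > 0\<close>] by (auto simp: D_def)
      have "\<forall>\<^sub>F n in sequentially. D k (r n) \<le> e" if "k \<ge> K" for k
        using eventually_ge_at_top[of K] 
      proof eventually_elim
        case (elim n)
        then have "r n \<ge> K" using rn[of n] by simp
        then show ?case using K that by (simp add: less_imp_le)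
      qed
      then show ?thesis by blast
    qed
    obtain k where "\<forall>\<^sub>F n in sequentially. D k (r n) \<le> 1" using ev[of 1] by auto
    then have "(\<lambda>x. F k x - f x) \<in> l2 M" using l2[of 1 k] by simp
    from diff_mem[OF F this, of k] have f: "f \<in> l2 M" by simp
    have "(\<lambda>k. \<integral>x. (F k x - f x) * (F k x - f x) \<partial>M) \<longlonglongrightarrow> 0"
    proof (rule LIMSEQ_I)
      fix e :: real assume "e > 0"
      then obtain K where K: "\<forall>k\<ge>K. \<forall>\<^sub>F n in sequentially. D k (r n) \<le> e / 2" using ev[of "e/2"] by auto
      have "norm ((\<integral>x. (F k x - f x) * (F k x - f x) \<partial>M) - 0) < e" if "k \<ge> K" for k
      proof -
        have "(\<integral>x. (F k x - f x) * (F k x - f x) \<partial>M) \<le> e / 2" using l2[of "e/2" k] K that \<open>e > 0\<close> by auto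
        moreover have "(\<integral>x. (F k x - f x) * (F k x - f x) \<partial>M) \<ge> 0" by simp
        ultimately show ?thesis using \<open>e > 0\<close> by simp
      qed
      then show "\<exists>no. \<forall>k\<ge>no. norm ((\<integral>x. (F k x - f x) * (F k x - f x) \<partial>M) - 0) < e" by blast
    qed
    then show "\<exists>f\<in>l2 M. (\<lambda>k. \<integral>x. (F k x - f x) * (F k x - f x) \<partial>M) \<longlonglongrightarrow> 0" using f by blast
  qed
qed

section \<open>Smooth tensor products as test functions\<close>

text \<open>A smooth function of one variable is represented by the sequence of its derivatives.\<close>

definition smooth_jet :: "(nat \<Rightarrow> real \<Rightarrow> real) \<Rightarrow> bool" where
  "smooth_jet D \<longleftrightarrow> (\<forall>n t. (D n has_real_derivative D (Suc n) t) (at t))"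

definition jet_affine :: "real \<Rightarrow> real \<Rightarrow> (nat \<Rightarrow> real \<Rightarrow> real) \<Rightarrow> nat \<Rightarrow> real \<Rightarrow> real" where
  "jet_affine c b D = (\<lambda>n t. c ^ n * D n (c * t + b))"

definition jet_mult :: "(nat \<Rightarrow> real \<Rightarrow> real) \<Rightarrow> (nat \<Rightarrow> real \<Rightarrow> real) \<Rightarrow> nat \<Rightarrow> real \<Rightarrow> real" where
  "jet_mult D E = (\<lambda>n t. \<Sum>k\<le>n. real (n choose k) * (D k t * E (n - k) t))"

lemma smooth_jetD: "smooth_jet D \<Longrightarrow> (D n has_real_derivative D (Suc n) t) (at t)"
  by (simp add: smooth_jet_def)

lemma smooth_jet_continuous: "smooth_jet D \<Longrightarrow> continuous_on A (D n)"
  by (meson DERIV_continuous_on continuous_on_subset smooth_jetD has_field_derivative_at_within)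

lemma smooth_jet_affine:
  assumes "smooth_jet D"
  shows "smooth_jet (jet_affine c b D)"
  unfolding smooth_jet_def jet_affine_def
proof (intro allI)
  fix n t
  have "((\<lambda>t. D n (c * t + b)) has_real_derivative D (Suc n) (c * t + b) * c) (at t)"
    by (rule DERIV_chain2[OF smooth_jetD[OF assms]]) (auto intro!: derivative_eq_intros)
  from DERIV_cmult[OF this, of "c ^ n"]
  show "((\<lambda>t. c ^ n * D n (c * t + b)) has_real_derivative c ^ Suc n * D (Suc n) (c * t + b)) (at t)"
    by (simp add: mult_ac)
qed

text \<open>Pascal's rule after an index shift: the passage from the n-th to the next Leibniz
  formula, stated for plain sequences so that it applies to two jets evaluated at one point.\<close>

lemma Leibniz_sum:
  fixes a b :: "nat \<Rightarrow> real"
  shows "(\<Sum>k\<le>n. real (n choose k) * (a (Suc k) * b (n - k) + a k * b (Suc (n - k))))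
       = (\<Sum>k\<le>Suc n. real (Suc n choose k) * (a k * b (Suc n - k)))"
proof -
  have A: "(\<Sum>k\<le>n. real (n choose Suc k) * (a (Suc k) * b (n - k))) + a 0 * b (Suc n)
      = (\<Sum>k\<le>n. real (n choose k) * (a k * b (Suc (n - k))))"
  proof -
    have "(\<Sum>k\<le>n. real (n choose k) * (a k * b (Suc (n - k)))) = (\<Sum>k\<le>n. real (n choose k) * (a k * b (Suc n - k)))"
      by (intro sum.cong) (auto simp: Suc_diff_le)
    also have "\<dots> = (\<Sum>k\<le>Suc n. real (n choose k) * (a k * b (Suc n - k)))" by simp
    also have "\<dots> = a 0 * b (Suc n) + (\<Sum>k\<le>n. real (n choose Suc k) * (a (Suc k) * b (n - k)))"
      by (subst sum.atMost_Suc_shift) simp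
    finally show ?thesis by simp
  qed
  have "(\<Sum>k\<le>Suc n. real (Suc n choose k) * (a k * b (Suc n - k)))
      = a 0 * b (Suc n) + (\<Sum>k\<le>n. real (Suc n choose Suc k) * (a (Suc k) * b (n - k)))"
    by (subst sum.atMost_Suc_shift) simp
  also have "\<dots> = a 0 * b (Suc n) + (\<Sum>k\<le>n. real (n choose k) * (a (Suc k) * b (n - k)))
       + (\<Sum>k\<le>n. real (n choose Suc k) * (a (Suc k) * b (n - k)))"
    by (simp add: algebra_simps sum.distrib)
  also have "\<dots> = (\<Sum>k\<le>n. real (n choose k) * (a (Suc k) * b (n - k) + a k * b (Suc (n - k))))"
    using A by (simp add: distrib_left sum.distrib)
  finally show ?thesis by simp
qed

lemma smooth_jet_mult:
  assumes "smooth_jet D" "smooth_jet E"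
  shows "smooth_jet (jet_mult D E)"
  unfolding smooth_jet_def jet_mult_def
proof (intro allI)
  fix n t
  have "((\<lambda>t. \<Sum>k\<le>n. real (n choose k) * (D k t * E (n - k) t)) has_real_derivative
      (\<Sum>k\<le>n. real (n choose k) * (D (Suc k) t * E (n - k) t + D k t * E (Suc (n - k)) t))) (at t)"
    by (intro DERIV_sum DERIV_cmult) (rule DERIV_cong[OF DERIV_mult[OF smooth_jetD[OF assms(1)] smooth_jetD[OF assms(2)]]], simp)
  then show "((\<lambda>t. \<Sum>k\<le>n. real (n choose k) * (D k t * E (n - k) t)) has_real_derivative
      (\<Sum>k\<le>Suc n. real (Suc n choose k) * (D k t * E (Suc n - k) t))) (at t)"
    unfolding Leibniz_sum[of n "\<lambda>k. D k t" "\<lambda>k. E k t"] .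
qed

lemma jet_mult_0: "jet_mult D E 0 t = D 0 t * E 0 t"
  by (simp add: jet_mult_def)

section \<open>A smooth step function, flat at the origin\<close>

lemma poly_times_exp_minus_tendsto_0:
  fixes p :: "real poly"
  shows "((\<lambda>u. poly p u * exp (- u)) \<longlongrightarrow> 0) at_top"
proof -
  have "((\<lambda>u. \<Sum>i\<le>degree p. coeff p i * (u ^ i / exp u)) \<longlongrightarrow> (\<Sum>i\<le>degree p. coeff p i * 0)) at_top"
    by (intro tendsto_intros tendsto_power_div_exp_0)
  moreover have "poly p u * exp (- u) = (\<Sum>i\<le>degree p. coeff p i * (u ^ i / exp u))" for u
    by (simp add: poly_altdef exp_minus field_simps sum_distrib_left sum_divide_distrib)
  ultimately show ?thesis by simp
qed

text \<open>The functions p(1/t) exp(-1/t), extended by 0, form a family closed under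
  differentiation: the derivative replaces p(u) by u^2 (p(u) - p'(u)). One derivative formula thus
  covers all derivatives of exp(-1/t), the case p = 1.\<close>

definition flat_poly :: "real poly \<Rightarrow> real \<Rightarrow> real" where
  "flat_poly p t = (if t \<le> 0 then 0 else poly p (inverse t) * exp (- inverse t))"

lemma DERIV_flat_poly:
  "(flat_poly p has_real_derivative flat_poly ([:0, 0, 1:] * (p - pderiv p)) t) (at t)"
proof -
  consider "t > 0" | "t < 0" | "t = 0" by linarith
  then show ?thesis
  proof cases
    case 1
    have i: "(inverse has_real_derivative - (inverse t)\<^sup>2) (at t)"
      using 1 DERIV_inverse[of t] by (simp add: power2_eq_square)
    have P: "((\<lambda>t. poly p (inverse t)) has_real_derivative poly (pderiv p) (inverse t) * - (inverse t)\<^sup>2) (at t)"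
      by (rule DERIV_chain2[OF poly_DERIV i])
    have E: "((\<lambda>t. exp (- inverse t)) has_real_derivative exp (- inverse t) * (inverse t)\<^sup>2) (at t)"
      by (rule DERIV_cong[OF DERIV_chain2[OF DERIV_exp DERIV_minus[OF i]]]) simp
    have "((\<lambda>t. poly p (inverse t) * exp (- inverse t)) has_real_derivative
        flat_poly ([:0, 0, 1:] * (p - pderiv p)) t) (at t)"
      by (rule DERIV_cong[OF DERIV_mult[OF P E]])
         (use 1 in \<open>simp add: flat_poly_def power2_eq_square algebra_simps\<close>)
    then show ?thesis
      by (rule has_field_derivative_transform_within_open[where S="{0<..}"]) (use 1 in \<open>auto simp: flat_poly_def\<close>)
  next
    case 2
    have "((\<lambda>t. 0) has_real_derivative flat_poly ([:0, 0, 1:] * (p - pderiv p)) t) (at t)"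
      using 2 by (simp add: flat_poly_def)
    then show ?thesis
      by (rule has_field_derivative_transform_within_open[where S="{..<0}"]) (use 2 in \<open>auto simp: flat_poly_def\<close>)
  next
    case 3
    have L: "((\<lambda>y. flat_poly p y / y) \<longlongrightarrow> 0) (at_left 0)"
      by (rule tendsto_eventually) (auto simp: eventually_at_filter flat_poly_def)
    \<comment> \<open>With u = 1/y the difference quotient at 0 is u p(u) exp(-u), and
      \<open>pCons 0 p\<close> is the polynomial u p(u).\<close>
    have "((\<lambda>y. poly (pCons 0 p) (inverse y) * exp (- inverse y)) \<longlongrightarrow> 0) (at_right 0)"
      by (rule filterlim_compose[OF poly_times_exp_minus_tendsto_0 filterlim_inverse_at_top_right])
    moreover have "\<forall>\<^sub>F y in at_right 0. poly (pCons 0 p) (inverse y) * exp (- inverse y) = flat_poly p y / y"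
      by (auto simp: eventually_at_filter flat_poly_def field_simps)
    ultimately have R: "((\<lambda>y. flat_poly p y / y) \<longlongrightarrow> 0) (at_right 0)"
      by (rule Lim_transform_eventually)
    show ?thesis using L R 3 unfolding has_field_derivative_iff
      by (subst filterlim_at_split) (simp add: flat_poly_def)
  qed
qed

fun step_poly :: "nat \<Rightarrow> real poly" where
  "step_poly 0 = 1"
| "step_poly (Suc n) = [:0, 0, 1:] * (step_poly n - pderiv (step_poly n))"

definition step_jet :: "nat \<Rightarrow> real \<Rightarrow> real" where
  "step_jet n = flat_poly (step_poly n)"

lemma smooth_step_jet: "smooth_jet step_jet"
  unfolding smooth_jet_def step_jet_def using DERIV_flat_poly by simp

lemma step_jet_nonpos: "t \<le> 0 \<Longrightarrow> step_jet 0 t = 0"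
  and step_jet_pos: "t > 0 \<Longrightarrow> step_jet 0 t = exp (- inverse t)"
  by (simp_all add: step_jet_def flat_poly_def)

lemma step_jet_nonneg: "0 \<le> step_jet 0 t" and step_jet_le_1: "step_jet 0 t \<le> 1"
  by (simp_all add: step_jet_def flat_poly_def)

section \<open>Tensor products and their partial derivatives\<close>

definition tensor :: "('d::finite \<Rightarrow> real \<Rightarrow> real) \<Rightarrow> real^'d \<Rightarrow> real" where
  "tensor g x = (\<Prod>i\<in>UNIV. g i (x $ i))"

lemma DERIV_tensor:
  fixes D :: "'d::finite \<Rightarrow> nat \<Rightarrow> real \<Rightarrow> real"
  assumes "\<And>i. smooth_jet (D i)"
  shows "((\<lambda>t. tensor (\<lambda>i. D i (c i)) (x + t *\<^sub>R axis j 1)) has_real_derivative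
     tensor (\<lambda>i. D i ((c(j := Suc (c j))) i)) x) (at 0)"
proof -
  have eq: "tensor (\<lambda>i. D i (c i)) (x + t *\<^sub>R axis j 1)
      = D j (c j) (t + x $ j) * (\<Prod>i\<in>UNIV - {j}. D i (c i) (x $ i))" for t
    unfolding tensor_def
    by (subst prod.remove[of UNIV j]) (auto simp: axis_def add.commute intro!: prod.cong)
  have "((\<lambda>t. D j (c j) (t + x $ j)) has_real_derivative D j (Suc (c j)) (0 + x $ j) * 1) (at 0)"
    by (rule DERIV_chain2[OF smooth_jetD[OF assms]]) (auto intro!: derivative_eq_intros)
  from DERIV_cmult_right[OF this, of "\<Prod>i\<in>UNIV - {j}. D i (c i) (x $ i)"]
  have "((\<lambda>t. tensor (\<lambda>i. D i (c i)) (x + t *\<^sub>R axis j 1)) has_real_derivative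
      D j (Suc (c j)) (x $ j) * (\<Prod>i\<in>UNIV - {j}. D i (c i) (x $ i))) (at 0)"
    unfolding eq by simp
  moreover have "D j (Suc (c j)) (x $ j) * (\<Prod>i\<in>UNIV - {j}. D i (c i) (x $ i))
     = tensor (\<lambda>i. D i ((c(j := Suc (c j))) i)) x"
    unfolding tensor_def by (subst prod.remove[of UNIV j]) (auto intro!: prod.cong)
  ultimately show ?thesis by simp
qed

text \<open>A derivative in direction j advances the jet of factor j alone, so only the number of
  occurrences of each direction in the list matters. This is the link to
  \<open>realises\<close>.\<close>

lemma dpartials_tensor:
  fixes D :: "'d::finite \<Rightarrow> nat \<Rightarrow> real \<Rightarrow> real"
  assumes "\<And>i. smooth_jet (D i)"
  shows "dpartials is (tensor (\<lambda>i. D i 0)) = tensor (\<lambda>i. D i (count (mset is) i))"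
proof (induction "is")
  case Nil
  then show ?case by simp
next
  case (Cons j js)
  show ?case
  proof
    fix x
    have e: "((count (mset js))(j := Suc (count (mset js) j))) = count (mset (j # js))" by auto
    show "dpartials (j # js) (tensor (\<lambda>i. D i 0)) x = tensor (\<lambda>i. D i (count (mset (j # js)) i)) x"
      unfolding dpartials.simps Cons partial_def
      using DERIV_imp_deriv[OF DERIV_tensor[where D=D and c="count (mset js)" and x=x and j=j, OF assms]] e by simp
  qed
qed

lemma continuous_on_tensor:
  assumes "\<And>i. continuous_on UNIV (g i)"
  shows "continuous_on A (tensor g)"
  unfolding tensor_def
  by (intro continuous_on_prod continuous_on_compose2[OF assms] continuous_intros) auto

lemma smooth_tensor:
  fixes D :: "'d::finite \<Rightarrow> nat \<Rightarrow> real \<Rightarrow> real"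
  assumes "\<And>i. smooth_jet (D i)"
  shows "smooth (tensor (\<lambda>i. D i 0))"
  unfolding smooth_def dpartials_tensor[OF assms]
proof (intro allI conjI)
  fix js :: "'d list" and i :: 'd and x :: "real^'d"
  show "continuous_on UNIV (tensor (\<lambda>i. D i (count (mset js) i)))"
    by (intro continuous_on_tensor smooth_jet_continuous assms)
  have e: "((count (mset js))(i := Suc (count (mset js) i))) = count (mset (i # js))" by auto
  show "((\<lambda>t. tensor (\<lambda>i. D i (count (mset js) i)) (x + t *\<^sub>R axis i 1)) has_real_derivative
           tensor (\<lambda>ia. D ia (count (mset (i # js)) ia)) x) (at 0)"
    using DERIV_tensor[where D=D and c="count (mset js)" and x=x and j=i, OF assms] unfolding e .
qed

lemma test_fun_tensor:
  fixes D :: "'d::finite \<Rightarrow> nat \<Rightarrow> real \<Rightarrow> real"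
  assumes D: "\<And>i. smooth_jet (D i)" and z: "\<And>i t. t \<notin> {a $ i..b $ i} \<Longrightarrow> D i 0 t = 0"
    and sub: "cbox a b \<subseteq> U"
  shows "test_fun U (tensor (\<lambda>i. D i 0))"
proof -
  have "{x. tensor (\<lambda>i. D i 0) x \<noteq> 0} \<subseteq> cbox a b"
    using z by (auto simp: tensor_def mem_box_cart) (meson atLeastAtMost_iff)+
  then have c: "closure {x. tensor (\<lambda>i. D i 0) x \<noteq> 0} \<subseteq> cbox a b"
    by (rule closure_minimal) (rule closed_cbox)
  moreover have "compact (closure {x. tensor (\<lambda>i. D i 0) x \<noteq> 0})"
    using c by (meson bounded_cbox bounded_subset closed_closure compact_eq_bounded_closed)
  ultimately show ?thesis using smooth_tensor[OF D] sub by (auto simp: test_fun_def)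
qed

text \<open>The positive and the negative part of a Borel version of \<open>G\<close> are densities
  of two measures that agree on open boxes. Boxes are an intersection-stable generator, so the
  measures coincide, then their densities almost everywhere, and equal positive and negative parts
  are both 0.\<close>

lemma box_integrals_zero_imp_AE_zero:
  fixes G :: "'a::euclidean_space \<Rightarrow> real"
  assumes G: "integrable lebesgue G"
    and z: "\<And>a b. (\<integral>x. indicator (box a b) x * G x \<partial>lebesgue) = 0"
  shows "AE x in lebesgue. G x = 0"
proof -
  have Gm: "G \<in> borel_measurable lebesgue" using G by auto
  obtain g where g: "g \<in> borel_measurable lborel" and eq: "AE x in lborel. G x = g x"
    using completion_ex_borel_measurable_real[OF Gm] by blast
  have gm: "g \<in> borel_measurable lebesgue" using g by (rule measurable_completion)
  have eq': "AE x in lebesgue. G x = g x" using eq by (rule AE_completion)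
  have "integrable lebesgue g"
    using Bochner_Integration.integrable_cong_AE[OF Gm gm eq'] G by simp
  then have gi: "integrable lborel g" using g by (simp add: integrable_completion)
  have bz: "(\<integral>x. indicator (box a b) x * g x \<partial>lborel) = 0" for a b
  proof -
    have "(\<integral>x. indicator (box a b) x * g x \<partial>lborel) = (\<integral>x. indicator (box a b) x * g x \<partial>lebesgue)"
      using g by (subst integral_completion) auto
    also have "\<dots> = (\<integral>x. indicator (box a b) x * G x \<partial>lebesgue)"
      by (rule integral_cong_AE) (use gm Gm eq' in \<open>auto intro!: borel_measurable_times borel_measurable_indicator\<close>)
    finally show ?thesis using z by simp
  qed
  have bi: "integrable lborel (\<lambda>x. indicator (box a b) x * h x)" if "integrable lborel h" for h :: "'a \<Rightarrow> real" and a b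
    using integrable_mult_indicator[OF _ that, of "box a b"] by simp
  have dens: "emeasure (density lborel (\<lambda>x. ennreal (h x))) (box a b) = ennreal (\<integral>x. indicator (box a b) x * max 0 (h x) \<partial>lborel)"
    if h: "integrable lborel h" for h :: "'a \<Rightarrow> real" and a b
  proof -
    have hm: "h \<in> borel_measurable borel" using h by auto
    have "emeasure (density lborel (\<lambda>x. ennreal (h x))) (box a b) = (\<integral>\<^sup>+x. ennreal (h x) * indicator (box a b) x \<partial>lborel)"
      using hm by (intro emeasure_density) auto
    also have "\<dots> = (\<integral>\<^sup>+x. ennreal (indicator (box a b) x * max 0 (h x)) \<partial>lborel)"
      by (intro nn_integral_cong) (auto simp: indicator_def ennreal_neg max_def)
    also have "\<dots> = ennreal (\<integral>x. indicator (box a b) x * max 0 (h x) \<partial>lborel)"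
      by (intro nn_integral_eq_integral bi) (use h in auto)
    finally show ?thesis .
  qed
  \<comment> \<open>\<open>ennreal\<close> sends negative numbers to 0, so these densities are the
    positive and the negative part of \<open>g\<close>.\<close>
  have "density lborel (\<lambda>x. ennreal (g x)) = density lborel (\<lambda>x. ennreal (- g x))"
  proof (rule measure_eqI_generator_eq)
    let ?E = "range (\<lambda>(a, b). box a b::'a set)"
    show "Int_stable ?E" by (auto simp: Int_stable_def box_Int_box)
    show "?E \<subseteq> Pow UNIV" "sets (density lborel (\<lambda>x. ennreal (g x))) = sigma_sets UNIV ?E"
      "sets (density lborel (\<lambda>x. ennreal (- g x))) = sigma_sets UNIV ?E"
      by (simp_all add: borel_eq_box)
    let ?A = "\<lambda>n::nat. box (- (real n *\<^sub>R One)) (real n *\<^sub>R One) :: 'a set"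
    show "range ?A \<subseteq> ?E" "(\<Union>i. ?A i) = UNIV"
      unfolding UN_box_eq_UNIV by auto
    show "emeasure (density lborel (\<lambda>x. ennreal (g x))) (?A i) \<noteq> \<infinity>" for i
      by (simp add: dens[OF gi])
    show "emeasure (density lborel (\<lambda>x. ennreal (g x))) X = emeasure (density lborel (\<lambda>x. ennreal (- g x))) X" if X: "X \<in> ?E" for X
    proof -
      obtain a b where X: "X = box a b" using X by auto
      have mi: "integrable lborel (\<lambda>x. - g x)" using gi by simp
      have "(\<integral>x. indicator (box a b) x * max 0 (g x) \<partial>lborel) - (\<integral>x. indicator (box a b) x * max 0 (- g x) \<partial>lborel)
          = (\<integral>x. indicator (box a b) x * max 0 (g x) - indicator (box a b) x * max 0 (- g x) \<partial>lborel)"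
        by (rule Bochner_Integration.integral_diff[symmetric]) (intro bi integrable_max integrable_zero gi mi)+
      also have "\<dots> = (\<integral>x. indicator (box a b) x * g x \<partial>lborel)"
        by (intro Bochner_Integration.integral_cong) (auto simp: indicator_def max_def)
      finally show ?thesis unfolding X dens[OF gi] dens[OF mi] bz by simp
    qed
  qed
  then have "AE x in lborel. ennreal (g x) = ennreal (- g x)"
    by (rule sigma_finite_measure.density_unique[OF sigma_finite_lborel, rotated 2]) (use g in auto)
  then have "AE x in lborel. G x = 0" using eq
  proof eventually_elim
    case (elim x)
    then have "g x \<le> 0" "- g x \<le> 0"
      using ennreal_le_iff2[of "g x" "- g x"] ennreal_le_iff2[of "- g x" "g x"] by auto
    then show ?case using elim by simp
  qed
  then show ?thesis by (rule AE_completion)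
qed

text \<open>A rising and a falling step, both at speed n + 1. The offset -1 delays the onset by 1/(n
  + 1) and keeps the support in a closed interval strictly inside (a, b); the growing speed drives
  the product to 1 on (a, b), since \<open>step_jet 0\<close> tends to 1 at infinity.\<close>

definition box_bump_jet :: "nat \<Rightarrow> real \<Rightarrow> real \<Rightarrow> nat \<Rightarrow> real \<Rightarrow> real" where
  "box_bump_jet n a b = jet_mult (jet_affine (real (Suc n)) (- real (Suc n) * a - 1) step_jet)
                                 (jet_affine (- real (Suc n)) (real (Suc n) * b - 1) step_jet)"

lemma smooth_box_bump_jet: "smooth_jet (box_bump_jet n a b)"
  unfolding box_bump_jet_def by (intro smooth_jet_mult smooth_jet_affine smooth_step_jet)

lemma box_bump_jet_0:
  "box_bump_jet n a b 0 t = step_jet 0 (real (Suc n) * (t - a) - 1) * step_jet 0 (real (Suc n) * (b - t) - 1)"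
proof -
  have "real (Suc n) * t + (- real (Suc n) * a - 1) = real (Suc n) * (t - a) - 1"
    "- real (Suc n) * t + (real (Suc n) * b - 1) = real (Suc n) * (b - t) - 1"
    by (simp_all add: algebra_simps)
  then show ?thesis by (simp only: box_bump_jet_def jet_mult_0 jet_affine_def power_0 mult_1)
qed

lemma box_bump_jet_support:
  assumes "t \<notin> {a + 1 / Suc n..b - 1 / Suc n}"
  shows "box_bump_jet n a b 0 t = 0"
proof -
  have "real (Suc n) * (t - a) - 1 \<le> 0 \<or> real (Suc n) * (b - t) - 1 \<le> 0"
    using assms by (auto simp: field_simps not_le)
  then show ?thesis using step_jet_nonpos by (auto simp: box_bump_jet_0)
qed

lemma box_bump_jet_bounds: "0 \<le> box_bump_jet n a b 0 t" "box_bump_jet n a b 0 t \<le> 1"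
  using step_jet_nonneg step_jet_le_1 by (auto simp: box_bump_jet_0 mult_le_one)

lemma step_jet_tendsto_1: "(step_jet 0 \<longlongrightarrow> 1) at_top"
proof -
  have "((\<lambda>t::real. exp (- inverse t)) \<longlongrightarrow> exp (- 0)) at_top"
    by (intro tendsto_intros tendsto_inverse_0_at_top filterlim_ident)
  moreover have "\<forall>\<^sub>F t in at_top. exp (- inverse t) = step_jet 0 t"
    using eventually_gt_at_top[of 0] by eventually_elim (simp add: step_jet_pos)
  ultimately show ?thesis using Lim_transform_eventually by fastforce
qed

lemma box_bump_jet_tendsto: "(\<lambda>n. box_bump_jet n a b 0 t) \<longlonglongrightarrow> indicator {a<..<b} t"
proof (cases "t \<in> {a<..<b}")
  case True
  have "filterlim (\<lambda>n. -1 + real (Suc n) * c) at_top sequentially" if "c > 0" for c :: real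
  proof -
    have "filterlim (\<lambda>n. real (Suc n)) at_top sequentially"
      using filterlim_Suc filterlim_compose filterlim_real_sequentially by blast
    then show ?thesis
      using that by (intro filterlim_tendsto_add_at_top[OF tendsto_const] filterlim_at_top_mult_tendsto_pos[OF tendsto_const]) auto
  qed
  then have *: "filterlim (\<lambda>n. real (Suc n) * c - 1) at_top sequentially" if "c > 0" for c :: real
    using that by (simp add: add.commute[of "-1"])
  have "(\<lambda>n. box_bump_jet n a b 0 t) \<longlonglongrightarrow> 1 * 1"
    unfolding box_bump_jet_0
    by (intro tendsto_mult filterlim_compose[OF step_jet_tendsto_1 *]) (use True in auto)
  then show ?thesis using True by simp
next
  case False
  have "box_bump_jet n a b 0 t = 0" for n
  proof (rule box_bump_jet_support)
    define r where "r = 1 / real (Suc n)"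
    have "0 < r" by (simp add: r_def)
    then show "t \<notin> {a + 1 / real (Suc n)..b - 1 / real (Suc n)}" using False unfolding r_def[symmetric] by auto
  qed
  then show ?thesis using False by simp
qed

lemma indicator_box_prod: "indicator (box a b) x = (\<Prod>i\<in>UNIV. indicator {a $ i<..<b $ i} (x $ i) :: real)"
  for a b x :: "real^'d::finite"
  by (auto simp: indicator_def mem_box_cart prod_zero_iff)

text \<open>Smooth bumps with values in [0, 1] converge to the indicator of any box inside the
  domain, so dominated convergence gives integral 0 of g over such boxes, and integrals over boxes
  determine g.\<close>

lemma fundamental_lemma_variations:
  fixes c d :: "real^'d::finite"
  assumes g: "integrable (lebesgue_on (box c d)) g"
    and z: "\<And>\<phi>. test_fun (box c d) \<phi> \<Longrightarrow> (\<integral>x. g x * \<phi> x \<partial>lebesgue_on (box c d)) = 0"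
  shows "AE x in lebesgue_on (box c d). g x = 0"
proof -
  define G where "G x = indicator (box c d) x * g x" for x
  have Gi: "integrable lebesgue G"
    using g by (simp add: integrable_restrict_space G_def[abs_def])
  have sub: "(\<integral>x. indicator (box a b) x * G x \<partial>lebesgue) = 0" if ab: "box a b \<subseteq> box c d" for a b
  proof -
    define \<phi> where "\<phi> n = tensor (\<lambda>i. box_bump_jet n (a $ i) (b $ i) 0)" for n
    have test: "test_fun (box c d) (\<phi> n)" for n
      unfolding \<phi>_def
    proof (rule test_fun_tensor[where a="\<chi> i. a $ i + 1 / Suc n" and b="\<chi> i. b $ i - 1 / Suc n"])
      define r where "r = 1 / real (Suc n)"
      have "0 < r" by (simp add: r_def)
      then have "a $ i < x $ i \<and> x $ i < b $ i" if "a $ i + r \<le> x $ i \<and> x $ i \<le> b $ i - r" for x i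
        using that by linarith
      then have "cbox (\<chi> i. a $ i + 1 / Suc n) (\<chi> i. b $ i - 1 / Suc n) \<subseteq> box a b"
        unfolding r_def[symmetric] by (auto simp: mem_box_cart)
      then show "cbox (\<chi> i. a $ i + 1 / Suc n) (\<chi> i. b $ i - 1 / Suc n) \<subseteq> box c d" using ab by simp
    qed (auto intro!: smooth_box_bump_jet box_bump_jet_support)
    have \<phi>c: "continuous_on UNIV (\<phi> n)" for n
      unfolding \<phi>_def by (intro continuous_on_tensor smooth_jet_continuous smooth_box_bump_jet)
    then have \<phi>m: "\<phi> n \<in> borel_measurable lebesgue" for n
      using continuous_imp_measurable_on_sets_lebesgue[OF \<phi>c] by (simp add: lebesgue_on_UNIV_eq)
    have "(\<lambda>n. \<integral>x. \<phi> n x * G x \<partial>lebesgue) \<longlonglongrightarrow> (\<integral>x. indicator (box a b) x * G x \<partial>lebesgue)"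
    proof (rule integral_dominated_convergence[where w="\<lambda>x. \<bar>G x\<bar>"])
      show "(\<lambda>x. indicator (box a b) x * G x) \<in> borel_measurable lebesgue"
        using Gi by (intro borel_measurable_times borel_measurable_indicator) auto
      show "(\<lambda>x. \<phi> n x * G x) \<in> borel_measurable lebesgue" for n using Gi \<phi>m by auto
      show "integrable lebesgue (\<lambda>x. \<bar>G x\<bar>)" using Gi by simp
      have "(\<lambda>n. \<phi> n x) \<longlonglongrightarrow> indicator (box a b) x" for x
        unfolding \<phi>_def tensor_def indicator_box_prod by (intro tendsto_prod box_bump_jet_tendsto)
      then show "AE x in lebesgue. (\<lambda>n. \<phi> n x * G x) \<longlonglongrightarrow> indicator (box a b) x * G x"
        by (intro AE_I2 tendsto_intros)
      have "0 \<le> \<phi> n x" "\<phi> n x \<le> 1" for n x unfolding \<phi>_def tensor_def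
        by (auto intro!: prod_nonneg prod_le_1 box_bump_jet_bounds)
      then show "AE x in lebesgue. norm (\<phi> n x * G x) \<le> \<bar>G x\<bar>" for n
        by (intro AE_I2) (simp add: abs_mult mult_left_le_one_le)
    qed
    moreover have "(\<integral>x. \<phi> n x * G x \<partial>lebesgue) = 0" for n
      using z[OF test[of n]] by (simp add: integral_restrict_space G_def mult_ac)
    ultimately have "(\<lambda>n. 0::real) \<longlonglongrightarrow> (\<integral>x. indicator (box a b) x * G x \<partial>lebesgue)" by simp
    then show ?thesis using LIMSEQ_unique tendsto_const by blast
  qed
  have "AE x in lebesgue. G x = 0"
  proof (rule box_integrals_zero_imp_AE_zero[OF Gi])
    fix a b :: "real^'d"
    \<comment> \<open>The intersection of two boxes is a box and \<open>G\<close> vanishes outside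
      \<open>box c d\<close>, so boxes inside the domain suffice.\<close>
    obtain a' b' where ab: "box a b \<inter> box c d = box a' b'"
      by (rule that) (rule box_Int_box)
    then have sub': "box a' b' \<subseteq> box c d" by blast
    have "indicator (box a b) x * G x = indicator (box a' b') x * G x" for x
      using ab[THEN set_eq_iff[THEN iffD1], THEN spec, of x] by (simp add: G_def indicator_def) blast
    then show "(\<integral>x. indicator (box a b) x * G x \<partial>lebesgue) = 0"
      using sub[OF sub'] by (simp only:)
  qed
  then show ?thesis
    by (subst AE_restrict_space_iff) (auto simp: G_def indicator_def)
qed

section \<open>Weak derivatives\<close>

lemma L2_on_l2: "L2_on S f \<longleftrightarrow> f \<in> l2 (lebesgue_on S)"
  by (simp add: L2_on_def l2_def)

lemma ocube_eq_box: "ocube a = box (\<chi> i. - a) (\<chi> i. a)"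
  by (auto simp: ocube_def mem_box_cart abs_less_iff) (metis minus_less_iff)+

lemma ccube_eq_cbox: "ccube a = cbox (\<chi> i. - a) (\<chi> i. a)"
  by (auto simp: ccube_def mem_box_cart abs_le_iff) (metis minus_le_iff)+

section \<open>Translation of integrals and of test functions\<close>

lemma lebesgue_shift:
  fixes c :: "'a::euclidean_space"
  shows "distr lebesgue lebesgue (\<lambda>x. x + c) = lebesgue"
    and measurable_lebesgue_shift: "(\<lambda>x. x + c) \<in> lebesgue \<rightarrow>\<^sub>M lebesgue"
proof -
  have T: "(\<lambda>x. c + (\<Sum>j\<in>Basis. (1 * (x \<bullet> j)) *\<^sub>R j)) = (\<lambda>x. x + c)"
    by (simp add: euclidean_representation add.commute)
  show "(\<lambda>x. x + c) \<in> lebesgue \<rightarrow>\<^sub>M lebesgue"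
    using lebesgue_affine_measurable[of "\<lambda>_. 1" c] unfolding T by simp
  show "distr lebesgue lebesgue (\<lambda>x. x + c) = lebesgue"
    using lebesgue_affine_euclidean[of "\<lambda>_. 1" c] unfolding T by (simp add: density_1)
qed

lemma borel_measurable_lebesgue_on_shift:
  fixes f :: "'a::euclidean_space \<Rightarrow> real"
  assumes S: "S \<in> sets lebesgue" and T: "{x. x - c \<in> S} \<in> sets lebesgue" and f: "f \<in> borel_measurable (lebesgue_on S)"
  shows "(\<lambda>x. f (x - c)) \<in> borel_measurable (lebesgue_on {x. x - c \<in> S})"
proof -
  have "(\<lambda>x. indicator S x *\<^sub>R f x) \<in> borel_measurable lebesgue"
    using f S by (simp add: borel_measurable_restrict_space_iff)
  from measurable_compose[OF measurable_lebesgue_shift[of "- c"] this]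
  have "(\<lambda>x. indicator {x. x - c \<in> S} x *\<^sub>R f (x - c)) \<in> borel_measurable lebesgue"
    by (simp add: indicator_def)
  then show ?thesis using T by (simp add: borel_measurable_restrict_space_iff)
qed

lemma integral_lebesgue_on_shift:
  fixes f :: "'a::euclidean_space \<Rightarrow> real"
  assumes S: "S \<in> sets lebesgue" and T: "{x. x - c \<in> S} \<in> sets lebesgue" and f: "f \<in> borel_measurable (lebesgue_on S)"
  shows "integrable (lebesgue_on {x. x - c \<in> S}) (\<lambda>x. f (x - c)) \<longleftrightarrow> integrable (lebesgue_on S) f"
    and "(\<integral>x. f (x - c) \<partial>lebesgue_on {x. x - c \<in> S}) = (\<integral>x. f x \<partial>lebesgue_on S)"
proof -
  have m: "(\<lambda>x. indicator S x *\<^sub>R f x) \<in> borel_measurable lebesgue"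
    using f S by (simp add: borel_measurable_restrict_space_iff)
  have i: "indicator {x. x - c \<in> S} x * f (x - c) = indicator S (x - c) * f (x - c)" for x
    by (simp add: indicator_def)
  show "integrable (lebesgue_on {x. x - c \<in> S}) (\<lambda>x. f (x - c)) \<longleftrightarrow> integrable (lebesgue_on S) f"
    using integrable_distr_eq[OF measurable_lebesgue_shift[of "- c"] m] S T
    unfolding lebesgue_shift by (simp add: integrable_restrict_space i)
  show "(\<integral>x. f (x - c) \<partial>lebesgue_on {x. x - c \<in> S}) = (\<integral>x. f x \<partial>lebesgue_on S)"
    using integral_distr[OF measurable_lebesgue_shift[of "- c"] m] S T
    unfolding lebesgue_shift by (simp add: integral_restrict_space i)
qed

lemma dpartials_shift: "dpartials is (\<lambda>x. \<phi> (x + c)) = (\<lambda>x. dpartials is \<phi> (x + c))"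
  by (induction "is") (auto simp: partial_def add_ac)

lemma test_fun_shift:
  assumes "test_fun {x. x - c \<in> U} \<phi>"
  shows "test_fun U (\<lambda>x. \<phi> (x + c))"
proof -
  have s: "smooth \<phi>" and k: "compact (closure {x. \<phi> x \<noteq> 0})" and sub: "closure {x. \<phi> x \<noteq> 0} \<subseteq> {x. x - c \<in> U}"
    using assms by (auto simp: test_fun_def)
  have "smooth (\<lambda>x. \<phi> (x + c))"
    unfolding smooth_def
  proof (intro allI conjI)
    fix js i x
    have c: "continuous_on UNIV (dpartials js \<phi>)" using s by (simp add: smooth_def)
    show "continuous_on UNIV (dpartials js (\<lambda>x. \<phi> (x + c)))"
      unfolding dpartials_shift by (rule continuous_on_compose2[OF c]) (auto intro!: continuous_intros)
    have "((\<lambda>t. dpartials js \<phi> ((x + c) + t *\<^sub>R axis i 1)) has_real_derivative dpartials (i # js) \<phi> (x + c)) (at 0)"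
      using s unfolding smooth_def by blast
    then show "((\<lambda>t. dpartials js (\<lambda>x. \<phi> (x + c)) (x + t *\<^sub>R axis i 1)) has_real_derivative dpartials (i # js) (\<lambda>x. \<phi> (x + c)) x) (at 0)"
      unfolding dpartials_shift by (simp add: add_ac)
  qed
  moreover have e: "{x. \<phi> (x + c) \<noteq> 0} = (+) (- c) ` {x. \<phi> x \<noteq> 0}"
  proof (intro set_eqI iffI)
    fix x assume "x \<in> {x. \<phi> (x + c) \<noteq> 0}"
    then show "x \<in> (+) (- c) ` {x. \<phi> x \<noteq> 0}" by (intro image_eqI[of _ _ "x + c"]) auto
  qed auto
  then have ce: "closure {x. \<phi> (x + c) \<noteq> 0} = (+) (- c) ` closure {x. \<phi> x \<noteq> 0}"
    by (simp only: closure_translation)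
  moreover have "compact (closure {x. \<phi> (x + c) \<noteq> 0})" unfolding ce using k by (rule compact_translation)
  moreover have "closure {x. \<phi> (x + c) \<noteq> 0} \<subseteq> U" unfolding ce using sub by auto
  ultimately show ?thesis by (simp add: test_fun_def)
qed

text \<open>Off the support the function vanishes in a neighbourhood, hence so do its derivatives.
  This lets integrals against a test function be cut down to a smaller domain.\<close>

lemma dpartials_eq_0:
  assumes "x \<notin> closure {x. \<phi> x \<noteq> 0}"
  shows "dpartials is \<phi> x = 0"
  using assms
proof (induction "is" arbitrary: x)
  case Nil
  then show ?case using closure_subset[of "{x. \<phi> x \<noteq> 0}"] by auto
next
  case (Cons i js)
  let ?f = "\<lambda>t. x + t *\<^sub>R axis i 1 :: real^'a"
  have "open (- closure {x. \<phi> x \<noteq> 0})" by auto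
  moreover have "continuous_on UNIV ?f" by (intro continuous_intros)
  ultimately have o: "open (?f -` (- closure {x. \<phi> x \<noteq> 0}))" by (rule open_vimage)
  have "((\<lambda>t. 0) has_real_derivative 0) (at 0)" by simp
  then have "((\<lambda>t. dpartials js \<phi> (?f t)) has_real_derivative 0) (at 0)"
    by (rule has_field_derivative_transform_within_open[OF _ o]) (use Cons in auto)
  then show ?case by (simp add: partial_def DERIV_imp_deriv)
qed

lemma smooth_dpartials_l2:
  assumes \<phi>: "smooth \<phi>" and U: "U \<in> sets lebesgue" "bounded U"
  shows "dpartials is \<phi> \<in> l2 (lebesgue_on U)"
proof -
  have c: "continuous_on A (dpartials is \<phi>)" for A
    using \<phi> continuous_on_subset[OF _ subset_UNIV] unfolding smooth_def by blast
  have "compact (dpartials is \<phi> ` closure U)"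
    using U by (intro compact_continuous_image c) (simp add: compact_closure)
  then obtain C where C: "\<And>x. x \<in> closure U \<Longrightarrow> \<bar>dpartials is \<phi> x\<bar> \<le> C"
    by (metis bounded_iff compact_imp_bounded image_eqI real_norm_def)
  show ?thesis
  proof (rule l2_bounded)
    show "finite_measure (lebesgue_on U)"
      using U by (intro finite_measure_lebesgue_on bounded_set_imp_lmeasurable)
    show "dpartials is \<phi> \<in> borel_measurable (lebesgue_on U)"
      using U c by (intro continuous_imp_measurable_on_sets_lebesgue)
    show "\<bar>dpartials is \<phi> x\<bar> \<le> C" if "x \<in> space (lebesgue_on U)" for x
      using that closure_subset[of U] by (intro C) (auto simp: space_restrict_space)
  qed
qed

lemma test_fun_smooth: "test_fun U \<phi> \<Longrightarrow> smooth \<phi>"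
  by (simp add: test_fun_def)

section \<open>Linearity, restriction, uniqueness and translation of weak derivatives\<close>

lemma is_weak_deriv_lin:
  assumes U: "U \<in> sets lebesgue" "bounded U"
    and f: "f1 \<in> l2 (lebesgue_on U)" "f2 \<in> l2 (lebesgue_on U)"
    and g: "g1 \<in> l2 (lebesgue_on U)" "g2 \<in> l2 (lebesgue_on U)"
    and w: "is_weak_deriv U \<alpha> f1 g1" "is_weak_deriv U \<alpha> f2 g2"
  shows "is_weak_deriv U \<alpha> (\<lambda>x. c * f1 x + d * f2 x) (\<lambda>x. c * g1 x + d * g2 x)"
  unfolding is_weak_deriv_def
proof (intro allI impI)
  fix \<phi> js assume \<phi>: "test_fun U \<phi>" and r: "realises js \<alpha>"
  interpret semi_inner "l2 (lebesgue_on U)" "\<lambda>f g. \<integral>x. f x * g x \<partial>lebesgue_on U" by (rule semi_inner_l2)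
  have l: "dpartials js \<phi> \<in> l2 (lebesgue_on U)" for js
    by (rule smooth_dpartials_l2[OF test_fun_smooth[OF \<phi>] U])
  show "(\<integral>x. (c * f1 x + d * f2 x) * dpartials js \<phi> x \<partial>lebesgue_on U) =
        (- 1) ^ mi_order \<alpha> * (\<integral>x. (c * g1 x + d * g2 x) * \<phi> x \<partial>lebesgue_on U)"
    using lin[OF f l[of js], of c d] lin[OF g l[of "[]"], of c d] w \<phi> r
    by (simp add: is_weak_deriv_def algebra_simps)
qed

lemma is_weak_deriv_cong_AE:
  assumes U: "U \<in> sets lebesgue" "bounded U"
    and f: "f1 \<in> borel_measurable (lebesgue_on U)" "f2 \<in> borel_measurable (lebesgue_on U)" "AE x in lebesgue_on U. f1 x = f2 x"
    and g: "g1 \<in> borel_measurable (lebesgue_on U)" "g2 \<in> borel_measurable (lebesgue_on U)" "AE x in lebesgue_on U. g1 x = g2 x"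
    and w: "is_weak_deriv U \<alpha> f1 g1"
  shows "is_weak_deriv U \<alpha> f2 g2"
  unfolding is_weak_deriv_def
proof (intro allI impI)
  fix \<phi> js assume \<phi>: "test_fun U \<phi>" and r: "realises js \<alpha>"
  have l: "dpartials js \<phi> \<in> borel_measurable (lebesgue_on U)" for js
    using smooth_dpartials_l2[OF test_fun_smooth[OF \<phi>] U] by (auto simp: l2_def)
  have l0: "\<phi> \<in> borel_measurable (lebesgue_on U)" using l[of "[]"] by simp
  have "(\<integral>x. f2 x * dpartials js \<phi> x \<partial>lebesgue_on U) = (\<integral>x. f1 x * dpartials js \<phi> x \<partial>lebesgue_on U)"
    using f l by (intro integral_cong_AE) auto
  moreover have "(\<integral>x. g2 x * \<phi> x \<partial>lebesgue_on U) = (\<integral>x. g1 x * \<phi> x \<partial>lebesgue_on U)"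
    using g l0 by (intro integral_cong_AE) auto
  ultimately show "(\<integral>x. f2 x * dpartials js \<phi> x \<partial>lebesgue_on U) = (- 1) ^ mi_order \<alpha> * (\<integral>x. g2 x * \<phi> x \<partial>lebesgue_on U)"
    using w \<phi> r by (simp add: is_weak_deriv_def)
qed

lemma integral_lebesgue_on_superset:
  fixes F :: "'a::euclidean_space \<Rightarrow> real"
  assumes "U \<in> sets lebesgue" "V \<in> sets lebesgue" "V \<subseteq> U" "\<And>x. x \<in> U - V \<Longrightarrow> F x = 0"
  shows "(\<integral>x. F x \<partial>lebesgue_on U) = (\<integral>x. F x \<partial>lebesgue_on V)"
proof -
  have "(\<integral>x. indicator U x *\<^sub>R F x \<partial>lebesgue) = (\<integral>x. indicator V x *\<^sub>R F x \<partial>lebesgue)"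
    using assms by (intro Bochner_Integration.integral_cong) (auto simp: indicator_def)
  then show ?thesis using assms by (simp add: integral_restrict_space)
qed

lemma is_weak_deriv_subset:
  assumes U: "U \<in> sets lebesgue" and V: "V \<in> sets lebesgue" "V \<subseteq> U" and w: "is_weak_deriv U \<alpha> f g"
  shows "is_weak_deriv V \<alpha> f g"
  unfolding is_weak_deriv_def
proof (intro allI impI)
  fix \<phi> js assume \<phi>: "test_fun V \<phi>" and r: "realises js \<alpha>"
  have t: "test_fun U \<phi>" using \<phi> V by (auto simp: test_fun_def)
  have z: "dpartials is \<phi> x = 0" if "x \<in> U - V" for "is" x
    using \<phi> that by (intro dpartials_eq_0) (auto simp: test_fun_def)
  have "(\<integral>x. f x * dpartials js \<phi> x \<partial>lebesgue_on U) = (\<integral>x. f x * dpartials js \<phi> x \<partial>lebesgue_on V)"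
    by (rule integral_lebesgue_on_superset[OF U V]) (simp add: z)
  moreover have "(\<integral>x. g x * \<phi> x \<partial>lebesgue_on U) = (\<integral>x. g x * \<phi> x \<partial>lebesgue_on V)"
    by (rule integral_lebesgue_on_superset[OF U V]) (use z[of _ "[]"] in simp)
  ultimately show "(\<integral>x. f x * dpartials js \<phi> x \<partial>lebesgue_on V) = (- 1) ^ mi_order \<alpha> * (\<integral>x. g x * \<phi> x \<partial>lebesgue_on V)"
    using w t r by (simp add: is_weak_deriv_def)
qed

text \<open>\<open>is_weak_deriv\<close> quantifies over all lists that realise the multi-index, so
  it yields an equation only once such a list exists. Over a finite index type every multi-index is
  the count function of a multiset.\<close>

lemma realises_exists: "\<exists>js. realises js (\<alpha> :: 'd::finite \<Rightarrow> nat)"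
proof -
  obtain js where "mset js = Abs_multiset \<alpha>" using ex_mset by blast
  then have "realises js \<alpha>" by (simp add: realises_def)
  then show ?thesis by blast
qed

text \<open>Both candidates pair equally with every test function, so the fundamental lemma applies
  to their difference. As \<open>wderiv\<close> is a choice, its linearity rests on this.\<close>

lemma is_weak_deriv_unique:
  fixes c d :: "real^'d::finite"
  assumes g: "g1 \<in> l2 (lebesgue_on (box c d))" "g2 \<in> l2 (lebesgue_on (box c d))"
    and w: "is_weak_deriv (box c d) \<alpha> f g1" "is_weak_deriv (box c d) \<alpha> f g2"
  shows "AE x in lebesgue_on (box c d). g1 x = g2 x"
proof -
  interpret semi_inner "l2 (lebesgue_on (box c d))" "\<lambda>f g. \<integral>x. f x * g x \<partial>lebesgue_on (box c d)" by (rule semi_inner_l2)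
  have "AE x in lebesgue_on (box c d). g1 x - g2 x = 0"
  proof (rule fundamental_lemma_variations)
    show "integrable (lebesgue_on (box c d)) (\<lambda>x. g1 x - g2 x)"
      by (rule l2_integrable[OF finite_measure_lebesgue_on diff_mem[OF g]]) simp
    fix \<phi> assume \<phi>: "test_fun (box c d) \<phi>"
    have l: "\<phi> \<in> l2 (lebesgue_on (box c d))"
      using smooth_dpartials_l2[OF test_fun_smooth[OF \<phi>], of "box c d" "[]"] by simp
    obtain js where r: "realises js \<alpha>" using realises_exists by blast
    have "(- 1) ^ mi_order \<alpha> * (\<integral>x. g1 x * \<phi> x \<partial>lebesgue_on (box c d)) = (- 1) ^ mi_order \<alpha> * (\<integral>x. g2 x * \<phi> x \<partial>lebesgue_on (box c d))"
      using w(1)[unfolded is_weak_deriv_def, rule_format, OF \<phi> r] w(2)[unfolded is_weak_deriv_def, rule_format, OF \<phi> r]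
      by linarith
    then show "(\<integral>x. (g1 x - g2 x) * \<phi> x \<partial>lebesgue_on (box c d)) = 0"
      using diff_left[OF g l] by simp
  qed
  then show ?thesis by simp
qed

lemma is_weak_deriv_shift:
  assumes S: "S \<in> sets lebesgue" "bounded S" and T: "{x. x - c \<in> S} \<in> sets lebesgue"
    and f: "f \<in> borel_measurable (lebesgue_on S)" and g: "g \<in> borel_measurable (lebesgue_on S)"
    and w: "is_weak_deriv S \<alpha> f g"
  shows "is_weak_deriv {x. x - c \<in> S} \<alpha> (\<lambda>x. f (x - c)) (\<lambda>x. g (x - c))"
  unfolding is_weak_deriv_def
proof (intro allI impI)
  fix \<phi> js assume \<phi>: "test_fun {x. x - c \<in> S} \<phi>" and r: "realises js \<alpha>"
  have t: "test_fun S (\<lambda>x. \<phi> (x + c))" by (rule test_fun_shift[OF \<phi>])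
  have m: "dpartials is (\<lambda>x. \<phi> (x + c)) \<in> borel_measurable (lebesgue_on S)" for "is"
    using smooth_dpartials_l2[OF test_fun_smooth[OF t] S] by (auto simp: l2_def)
  have m0: "(\<lambda>x. \<phi> (x + c)) \<in> borel_measurable (lebesgue_on S)" using m[of "[]"] by simp
  have "(\<integral>x. f (x - c) * dpartials js \<phi> x \<partial>lebesgue_on {x. x - c \<in> S}) = (\<integral>x. f x * dpartials js (\<lambda>x. \<phi> (x + c)) x \<partial>lebesgue_on S)"
    using integral_lebesgue_on_shift(2)[OF S(1) T, of "\<lambda>x. f x * dpartials js (\<lambda>x. \<phi> (x + c)) x"] f m
    by (simp add: dpartials_shift)
  moreover have "(\<integral>x. g (x - c) * \<phi> x \<partial>lebesgue_on {x. x - c \<in> S}) = (\<integral>x. g x * \<phi> (x + c) \<partial>lebesgue_on S)"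
    using integral_lebesgue_on_shift(2)[OF S(1) T, of "\<lambda>x. g x * \<phi> (x + c)"] g m0 by simp
  ultimately show "(\<integral>x. f (x - c) * dpartials js \<phi> x \<partial>lebesgue_on {x. x - c \<in> S}) =
     (- 1) ^ mi_order \<alpha> * (\<integral>x. g (x - c) * \<phi> x \<partial>lebesgue_on {x. x - c \<in> S})"
    using w t r by (simp add: is_weak_deriv_def)
qed

section \<open>Periodic extension\<close>

lemma is_weak_deriv_cong:
  assumes "U \<in> sets lebesgue" "\<And>x. x \<in> U \<Longrightarrow> f1 x = f2 x" "\<And>x. x \<in> U \<Longrightarrow> g1 x = g2 x"
  shows "is_weak_deriv U \<alpha> f1 g1 \<longleftrightarrow> is_weak_deriv U \<alpha> f2 g2"
proof -
  have "(\<integral>x. f1 x * h x \<partial>lebesgue_on U) = (\<integral>x. f2 x * h x \<partial>lebesgue_on U)"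
    "(\<integral>x. g1 x * h x \<partial>lebesgue_on U) = (\<integral>x. g2 x * h x \<partial>lebesgue_on U)" for h
    using assms by (auto intro!: Bochner_Integration.integral_cong simp: space_restrict_space)
  then show ?thesis unfolding is_weak_deriv_def by simp
qed

lemma l2_cong:
  assumes "\<And>x. x \<in> space M \<Longrightarrow> f x = g x"
  shows "f \<in> l2 M \<longleftrightarrow> g \<in> l2 M"
proof -
  have "f \<in> borel_measurable M \<longleftrightarrow> g \<in> borel_measurable M" by (rule measurable_cong) (rule assms)
  moreover have "integrable M (\<lambda>x. (f x)\<^sup>2) \<longleftrightarrow> integrable M (\<lambda>x. (g x)\<^sup>2)"
    by (rule Bochner_Integration.integrable_cong) (auto simp: assms)
  ultimately show ?thesis by (simp add: l2_def)
qed

lemma integrable_lebesgue_on_subset: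
  fixes f :: "'a::euclidean_space \<Rightarrow> real"
  assumes "U \<in> sets lebesgue" "V \<in> sets lebesgue" "V \<subseteq> U" "integrable (lebesgue_on U) f"
  shows "integrable (lebesgue_on V) f"
proof -
  have "integrable lebesgue (\<lambda>x. indicator V x *\<^sub>R (indicator U x *\<^sub>R f x))"
    by (rule integrable_mult_indicator) (use assms in \<open>auto simp: integrable_restrict_space\<close>)
  also have "(\<lambda>x. indicator V x *\<^sub>R (indicator U x *\<^sub>R f x)) = (\<lambda>x. indicator V x *\<^sub>R f x)"
    using assms(3) by (auto simp: fun_eq_iff split: split_indicator)
  finally show ?thesis using assms by (simp add: integrable_restrict_space)
qed

lemma l2_subset:
  fixes f :: "'a::euclidean_space \<Rightarrow> real"
  assumes "U \<in> sets lebesgue" "V \<in> sets lebesgue" "V \<subseteq> U" "f \<in> l2 (lebesgue_on U)"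
  shows "f \<in> l2 (lebesgue_on V)"
proof -
  have "f \<in> borel_measurable (lebesgue_on V)"
    using assms(3,4) by (auto simp: l2_def intro: measurable_restrict_mono)
  then show ?thesis using assms integrable_lebesgue_on_subset[OF assms(1-3)] by (simp add: l2_def)
qed

lemma sets_lebesgue_cube [simp, intro]: "ocube a \<in> sets lebesgue" "ccube a \<in> sets lebesgue"
  by (simp_all add: ocube_eq_box ccube_eq_cbox)

lemma bounded_cube [simp]: "bounded (ocube a)" "bounded (ccube a)"
  by (simp_all add: ocube_eq_box ccube_eq_cbox)

lemma finite_measure_cube [simp]: "finite_measure (lebesgue_on (ocube a))" "finite_measure (lebesgue_on (ccube a))"
  by (simp_all add: ocube_eq_box ccube_eq_cbox finite_measure_lebesgue_on)

section \<open>Tiling of the large cube by period cells\<close>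

definition lattice_shift :: "real \<Rightarrow> ('d::finite \<Rightarrow> int) \<Rightarrow> real^'d" where
  "lattice_shift L j = (\<chi> i. 4 * L * of_int (j i))"

definition tile :: "real \<Rightarrow> ('d::finite \<Rightarrow> int) \<Rightarrow> (real^'d) set" where
  "tile L j = {x. x - lattice_shift L j \<in> ocube (2 * L)}"

text \<open>The 3^d translates of the period cell that meet the cube of half-width 4L. In a
  coordinate with index 1 the tile is (2L, 6L), so outer tiles overhang the cube. This is why
  \<open>tile_integral\<close> gives equality for functions vanishing outside the cube and an
  inequality for nonnegative ones.\<close>

definition neighbours :: "('d::finite \<Rightarrow> int) set" where
  "neighbours = PiE UNIV (\<lambda>_. {-1, 0, 1})"

lemma finite_neighbours [simp]: "finite (neighbours :: ('d::finite \<Rightarrow> int) set)"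
  unfolding neighbours_def by (intro finite_PiE) auto

lemma tile_box: "tile L j = box (lattice_shift L j - (\<chi> i. 2 * L)) (lattice_shift L j + (\<chi> i. 2 * L))"
  unfolding tile_def ocube_eq_box by (auto simp: mem_box_cart) (smt (verit))+

lemma sets_lebesgue_tile [simp, intro]: "tile L j \<in> sets lebesgue"
  by (simp add: tile_box)

lemma tile_zero: "tile L (\<lambda>_. 0) = ocube (2 * L)"
  by (simp add: tile_def lattice_shift_def zero_vec_def[symmetric])

lemma tile_unique:
  assumes L: "L > 0" and x: "x \<in> tile L j" "x \<in> tile L k"
  shows "j = k"
proof
  fix i
  have "\<bar>x $ i - 4 * L * of_int (j i)\<bar> < 2 * L" "\<bar>x $ i - 4 * L * of_int (k i)\<bar> < 2 * L"
    using x by (auto simp: tile_def ocube_def lattice_shift_def)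
  then have "\<bar>4 * L * of_int (j i) - 4 * L * of_int (k i)\<bar> < 4 * L" by linarith
  then have "4 * L * \<bar>of_int (j i - k i)\<bar> < 4 * L * 1"
    using L by (simp add: abs_mult right_diff_distrib[symmetric])
  then have "\<bar>of_int (j i - k i) :: real\<bar> < 1" using L by (simp only: mult_less_cancel_left_pos)
  then show "j i = k i" by linarith
qed

lemma per_ext_tile:
  assumes L: "L > 0" and x: "x \<in> tile L j"
  shows "per_ext L f x = f (x - lattice_shift L j)"
proof -
  have "\<lfloor>(x $ i + 2 * L) / (4 * L)\<rfloor> = j i" for i
  proof -
    have "\<bar>x $ i - 4 * L * of_int (j i)\<bar> < 2 * L"
      using x by (auto simp: tile_def ocube_def lattice_shift_def)
    then have "of_int (j i) \<le> (x $ i + 2 * L) / (4 * L)" "(x $ i + 2 * L) / (4 * L) < of_int (j i) + 1"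
      using L by (auto simp: field_simps abs_less_iff)
    then show ?thesis by (simp add: floor_eq_iff)
  qed
  then have "(\<chi> i. x $ i - 4 * L * of_int \<lfloor>(x $ i + 2 * L) / (4 * L)\<rfloor>) = x - lattice_shift L j"
    by (simp add: vec_eq_iff lattice_shift_def)
  then show ?thesis by (simp add: per_ext_def)
qed

lemma per_ext_ocube: "L > 0 \<Longrightarrow> x \<in> ocube (2 * L) \<Longrightarrow> per_ext L f x = f x"
  using per_ext_tile[of L x "\<lambda>_. 0" f] by (simp add: tile_zero lattice_shift_def zero_vec_def[symmetric])

text \<open>The exceptional points lie on the hyperplanes where a coordinate is 2L or -2L, and these
  are negligible.\<close>

lemma AE_tile_cover:
  assumes L: "L > 0"
  shows "AE x in lebesgue. x \<in> ocube (4 * L) \<longrightarrow> (\<exists>j\<in>neighbours. x \<in> tile L (j :: 'd::finite \<Rightarrow> int))"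
proof -
  have "AE x :: real^'d in lebesgue. x \<notin> {x. x $ i = c}" for i c
    using negligible_standard_hyperplane[of "axis i 1 :: real^'d" c]
    by (intro AE_not_in) (simp add: negligible_iff_null_sets inner_axis axis_in_Basis_iff)
  then have "AE x :: real^'d in lebesgue. x $ i \<noteq> c" for i c by simp
  then have "AE x :: real^'d in lebesgue. x $ i \<noteq> 2 * L \<and> x $ i \<noteq> - 2 * L" for i by (intro AE_conjI)
  then have "AE x :: real^'d in lebesgue. \<forall>i. x $ i \<noteq> 2 * L \<and> x $ i \<noteq> - 2 * L"
    by (subst AE_all_countable) blast
  then show ?thesis
  proof eventually_elim
    case (elim x)
    show ?case
    proof
      assume x: "x \<in> ocube (4 * L)"
      define j where "j i = (if x $ i > 2 * L then 1 else if x $ i < - 2 * L then -1 else 0 :: int)" for i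
      have "j \<in> neighbours" unfolding neighbours_def by (rule PiE_I) (simp_all add: j_def)
      moreover have "x \<in> tile L j"
      proof -
        have "\<bar>x $ i - 4 * L * of_int (j i)\<bar> < 2 * L" for i
        proof -
          have "\<bar>x $ i\<bar> < 4 * L" using x by (simp add: ocube_def)
          moreover have "x $ i \<noteq> 2 * L" "x $ i \<noteq> - 2 * L" using elim by auto
          ultimately show ?thesis unfolding j_def abs_less_iff
            by (cases "x $ i > 2 * L"; cases "x $ i < - 2 * L"; simp)
        qed
        then show ?thesis by (simp add: tile_def ocube_def lattice_shift_def)
      qed
      ultimately show "\<exists>j\<in>neighbours. x \<in> tile L j" by blast
    qed
  qed
qed

lemma tile_sum_indicator:
  assumes L: "L > 0" and x: "x \<in> tile L j" and j: "j \<in> neighbours"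
  shows "(\<Sum>k\<in>neighbours. indicator (tile L k) x * F x) = (F x :: real)"
proof -
  have "(\<Sum>k\<in>neighbours. indicator (tile L k) x * F x) = (\<Sum>k\<in>neighbours. if k = j then F x else 0)"
  proof (intro sum.cong refl)
    fix k
    show "indicator (tile L k) x * F x = (if k = j then F x else 0)"
      using tile_unique[OF L x, of k] x by (cases "k = j") (auto simp: indicator_def)
  qed
  then show ?thesis using j by simp
qed

lemma AE_tile_sum:
  fixes F :: "real^'d::finite \<Rightarrow> real"
  assumes L: "L > 0"
  shows "AE x in lebesgue. indicator (ocube (4 * L)) x * (\<Sum>j\<in>neighbours. indicator (tile L j) x * F x)
     = indicator (ocube (4 * L)) x * F x"
  using AE_tile_cover[OF L]
proof eventually_elim
  case (elim x)
  then show ?case using tile_sum_indicator[OF L] by (auto simp: indicator_def)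
qed

lemma tile_measurable:
  fixes F :: "real^'d::finite \<Rightarrow> real"
  assumes L: "L > 0" and F: "\<And>j :: 'd \<Rightarrow> int. j \<in> neighbours \<Longrightarrow> F \<in> borel_measurable (lebesgue_on (tile L j))"
  shows "F \<in> borel_measurable (lebesgue_on (ocube (4 * L)))"
proof -
  have "(\<lambda>x. indicator (tile L j) x * F x) \<in> borel_measurable lebesgue" if "j \<in> neighbours" for j
    using F[OF that] by (simp add: borel_measurable_restrict_space_iff)
  then have "(\<lambda>x. \<Sum>j\<in>neighbours. indicator (tile L j) x * F x) \<in> borel_measurable lebesgue"
    by (rule borel_measurable_sum)
  then have "(\<lambda>x. indicator (ocube (4 * L)) x * (\<Sum>j\<in>neighbours. indicator (tile L j) x * F x)) \<in> borel_measurable lebesgue"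
    by (intro borel_measurable_times borel_measurable_indicator) auto
  then have "(\<lambda>x. indicator (ocube (4 * L)) x * F x) \<in> borel_measurable lebesgue"
    by (rule borel_measurable_AE) (rule AE_tile_sum[OF L])
  then show ?thesis by (simp add: borel_measurable_restrict_space_iff)
qed

lemma tile_integral:
  fixes F :: "real^'d::finite \<Rightarrow> real"
  assumes L: "L > 0" and F: "\<And>j :: 'd \<Rightarrow> int. j \<in> neighbours \<Longrightarrow> integrable (lebesgue_on (tile L j)) F"
  shows "integrable (lebesgue_on (ocube (4 * L))) F"
    and "(\<And>x. x \<notin> ocube (4 * L) \<Longrightarrow> F x = 0) \<Longrightarrow>
           (\<integral>x. F x \<partial>lebesgue_on (ocube (4 * L))) = (\<Sum>j\<in>neighbours. \<integral>x. F x \<partial>lebesgue_on (tile L j))"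
    and "(\<And>x. F x \<ge> 0) \<Longrightarrow>
           (\<integral>x. F x \<partial>lebesgue_on (ocube (4 * L))) \<le> (\<Sum>j\<in>neighbours. \<integral>x. F x \<partial>lebesgue_on (tile L j))"
proof -
  define H where "H x = (\<Sum>j\<in>neighbours. indicator (tile L j) x * F x)" for x
  have Fi: "integrable lebesgue (\<lambda>x. indicator (tile L j) x * F x)" if "j \<in> neighbours" for j
    using F[OF that] by (simp add: integrable_restrict_space)
  have Hi: "integrable lebesgue H" unfolding H_def[abs_def] by (intro Bochner_Integration.integrable_sum Fi)
  have HI: "(\<integral>x. H x \<partial>lebesgue) = (\<Sum>j\<in>neighbours. \<integral>x. F x \<partial>lebesgue_on (tile L j))"
    unfolding H_def[abs_def] by (subst Bochner_Integration.integral_sum) (auto simp: Fi integral_restrict_space)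
  have UHi: "integrable lebesgue (\<lambda>x. indicator (ocube (4 * L)) x * H x)"
    using integrable_mult_indicator[OF _ Hi, of "ocube (4 * L)"] by simp
  have ae: "AE x in lebesgue. indicator (ocube (4 * L)) x * H x = indicator (ocube (4 * L)) x * F x"
    unfolding H_def by (rule AE_tile_sum[OF L])
  have m: "(\<lambda>x. indicator (ocube (4 * L)) x * F x) \<in> borel_measurable lebesgue"
    by (rule borel_measurable_AE[OF _ ae]) (use UHi in auto)
  have "integrable lebesgue (\<lambda>x. indicator (ocube (4 * L)) x * F x)"
    by (rule Bochner_Integration.integrable_cong_AE[THEN iffD1, OF _ m ae UHi]) (use UHi in auto)
  then show "integrable (lebesgue_on (ocube (4 * L))) F" by (simp add: integrable_restrict_space)
  have I: "(\<integral>x. F x \<partial>lebesgue_on (ocube (4 * L))) = (\<integral>x. indicator (ocube (4 * L)) x * H x \<partial>lebesgue)"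
    using integral_cong_AE[OF _ m ae] UHi by (simp add: integral_restrict_space)
  show "(\<integral>x. F x \<partial>lebesgue_on (ocube (4 * L))) = (\<Sum>j\<in>neighbours. \<integral>x. F x \<partial>lebesgue_on (tile L j))"
    if z: "\<And>x. x \<notin> ocube (4 * L) \<Longrightarrow> F x = 0"
  proof -
    have "indicator (ocube (4 * L)) x * H x = H x" for x using z[of x] by (auto simp: H_def indicator_def)
    then show ?thesis using I HI by (simp only:)
  qed
  show "(\<integral>x. F x \<partial>lebesgue_on (ocube (4 * L))) \<le> (\<Sum>j\<in>neighbours. \<integral>x. F x \<partial>lebesgue_on (tile L j))"
    if p: "\<And>x. F x \<ge> 0"
  proof -
    have "indicator (ocube (4 * L)) x * H x \<le> H x" for x
      using p[of x] by (auto simp: H_def indicator_def intro!: sum_nonneg)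
    then have "(\<integral>x. indicator (ocube (4 * L)) x * H x \<partial>lebesgue) \<le> (\<integral>x. H x \<partial>lebesgue)"
      using UHi Hi by (intro integral_mono) auto
    then show ?thesis using I HI by simp
  qed
qed

lemma tile_shift_integral:
  fixes f :: "real^'d::finite \<Rightarrow> real"
  assumes "f \<in> borel_measurable (lebesgue_on (ocube (2 * L)))"
  shows "(\<lambda>x. f (x - lattice_shift L j)) \<in> borel_measurable (lebesgue_on (tile L j))"
    and "integrable (lebesgue_on (tile L j)) (\<lambda>x. f (x - lattice_shift L j)) \<longleftrightarrow> integrable (lebesgue_on (ocube (2 * L))) f"
    and "(\<integral>x. f (x - lattice_shift L j) \<partial>lebesgue_on (tile L j)) = (\<integral>x. f x \<partial>lebesgue_on (ocube (2 * L)))"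
  using borel_measurable_lebesgue_on_shift[of "ocube (2 * L)" "lattice_shift L j" f]
    integral_lebesgue_on_shift[of "ocube (2 * L)" "lattice_shift L j" f] assms sets_lebesgue_tile[of L j]
  unfolding tile_def by auto

text \<open>On each tile the extension is a translate of \<open>g\<close> with the same integral of
  squares, so the number of tiles bounds the total. The estimate makes periodic extension continuous
  in mean square, which the completeness of \<open>Hper\<close> uses.\<close>

lemma per_ext_l2:
  fixes g :: "real^'d::finite \<Rightarrow> real"
  assumes L: "L > 0" and g: "g \<in> l2 (lebesgue_on (ocube (2 * L)))"
  shows "per_ext L g \<in> l2 (lebesgue_on (ocube (4 * L)))"
    and "(\<integral>x. (per_ext L g x)\<^sup>2 \<partial>lebesgue_on (ocube (4 * L)))
          \<le> card (neighbours :: ('d \<Rightarrow> int) set) * (\<integral>x. (g x)\<^sup>2 \<partial>lebesgue_on (ocube (2 * L)))"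
proof -
  have gm: "g \<in> borel_measurable (lebesgue_on (ocube (2 * L)))" and gi: "integrable (lebesgue_on (ocube (2 * L))) (\<lambda>x. (g x)\<^sup>2)"
    using g by (auto simp: l2_def)
  have gm2: "(\<lambda>x. (g x)\<^sup>2) \<in> borel_measurable (lebesgue_on (ocube (2 * L)))" using gm by auto
  have s: "x \<in> tile L j" if "x \<in> space (lebesgue_on (tile L j))" for x :: "real^'d" and j
    using that by (simp add: space_restrict_space)
  have m: "per_ext L g \<in> borel_measurable (lebesgue_on (tile L j))" for j
    using tile_shift_integral(1)[OF gm, of j]
    by (rule measurable_cong[THEN iffD2, rotated]) (simp add: per_ext_tile[OF L s])
  have i: "integrable (lebesgue_on (tile L j)) (\<lambda>x. (per_ext L g x)\<^sup>2)" for j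
    using tile_shift_integral(2)[OF gm2, of j] gi
    by (subst Bochner_Integration.integrable_cong[OF refl, of _ _ "\<lambda>x. (g (x - lattice_shift L j))\<^sup>2"])
       (simp_all add: per_ext_tile[OF L s])
  have e: "(\<integral>x. (per_ext L g x)\<^sup>2 \<partial>lebesgue_on (tile L j)) = (\<integral>x. (g x)\<^sup>2 \<partial>lebesgue_on (ocube (2 * L)))" for j
    using tile_shift_integral(3)[OF gm2, of j]
    by (subst Bochner_Integration.integral_cong[OF refl, of _ _ "\<lambda>x. (g (x - lattice_shift L j))\<^sup>2"])
       (simp_all add: per_ext_tile[OF L s])
  show "per_ext L g \<in> l2 (lebesgue_on (ocube (4 * L)))"
    using tile_measurable[OF L m] tile_integral(1)[OF L i] by (simp add: l2_def)
  show "(\<integral>x. (per_ext L g x)\<^sup>2 \<partial>lebesgue_on (ocube (4 * L)))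
          \<le> card (neighbours :: ('d \<Rightarrow> int) set) * (\<integral>x. (g x)\<^sup>2 \<partial>lebesgue_on (ocube (2 * L)))"
    using tile_integral(3)[OF L i] by (simp add: e)
qed

lemma Hper_l2:
  assumes "f \<in> Hper L s"
  shows "f \<in> l2 (lebesgue_on (ocube (2 * L)))" "f \<in> l2 (lebesgue_on (ccube (2 * L)))"
proof -
  show c: "f \<in> l2 (lebesgue_on (ccube (2 * L)))" using assms by (simp add: Hper_def L2_on_l2)
  have "ocube (2 * L) \<subseteq> ccube (2 * L)" by (auto simp: ocube_def ccube_def less_imp_le)
  then show "f \<in> l2 (lebesgue_on (ocube (2 * L)))" by (rule l2_subset[rotated 2]) (use c in auto)
qed

text \<open>Restricting a weak derivative of the periodic extension to the small cube supplies the
  witness for the \<open>SOME\<close> in \<open>wderiv\<close>.\<close>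

lemma wderiv_Hper:
  fixes f :: "real^'d::finite \<Rightarrow> real"
  assumes L: "L > 0" and f: "f \<in> Hper L s" and \<alpha>: "mi_order \<alpha> \<le> s"
  shows "wderiv L \<alpha> f \<in> l2 (lebesgue_on (ocube (2 * L)))" "is_weak_deriv (ocube (2 * L)) \<alpha> f (wderiv L \<alpha> f)"
proof -
  obtain G where G: "G \<in> l2 (lebesgue_on (ocube (4 * L)))" "is_weak_deriv (ocube (4 * L)) \<alpha> (per_ext L f) G"
    using f \<alpha> by (auto simp: Hper_def sobolev_def L2_on_l2)
  have sub: "ocube (2 * L) \<subseteq> (ocube (4 * L) :: (real^'d) set)"
    using L by (fastforce simp: ocube_def intro: less_trans)
  have "L2_on (ocube (2 * L)) G" unfolding L2_on_l2 by (rule l2_subset[rotated 2, OF sub]) (use G in auto)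
  moreover have "is_weak_deriv (ocube (2 * L)) \<alpha> (per_ext L f) G"
    by (rule is_weak_deriv_subset[OF _ _ sub G(2)]) auto
  then have "is_weak_deriv (ocube (2 * L)) \<alpha> f G"
    by (subst is_weak_deriv_cong[where ?f2.0="per_ext L f" and ?g2.0=G]) (auto simp: per_ext_ocube[OF L])
  ultimately have "\<exists>g. L2_on (ocube (2 * L)) g \<and> is_weak_deriv (ocube (2 * L)) \<alpha> f g" by blast
  from someI_ex[OF this]
  show "wderiv L \<alpha> f \<in> l2 (lebesgue_on (ocube (2 * L)))" "is_weak_deriv (ocube (2 * L)) \<alpha> f (wderiv L \<alpha> f)"
    by (auto simp: wderiv_def L2_on_l2)
qed

text \<open>On each tile the periodic extension of \<open>g\<close> is a translate of a weak derivative, so by uniqueness it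
  agrees almost everywhere with any weak derivative on the large cube.\<close>

lemma is_weak_deriv_per_ext:
  fixes f :: "real^'d::finite \<Rightarrow> real"
  assumes L: "L > 0" and f: "f \<in> Hper L s" and \<alpha>: "mi_order \<alpha> \<le> s"
    and g: "g \<in> l2 (lebesgue_on (ocube (2 * L)))" "is_weak_deriv (ocube (2 * L)) \<alpha> f g"
  shows "is_weak_deriv (ocube (4 * L)) \<alpha> (per_ext L f) (per_ext L g)"
proof -
  obtain G where G: "G \<in> l2 (lebesgue_on (ocube (4 * L)))" "is_weak_deriv (ocube (4 * L)) \<alpha> (per_ext L f) G"
    using f \<alpha> by (auto simp: Hper_def sobolev_def L2_on_l2)
  have fl: "f \<in> l2 (lebesgue_on (ocube (2 * L)))" by (rule Hper_l2[OF f])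
  have pg: "per_ext L g \<in> l2 (lebesgue_on (ocube (4 * L)))" by (rule per_ext_l2[OF L g(1)])
  have pf: "per_ext L f \<in> l2 (lebesgue_on (ocube (4 * L)))" by (rule per_ext_l2[OF L fl])
  have "AE x in lebesgue. x \<in> tile L j \<inter> ocube (4 * L) \<longrightarrow> G x = per_ext L g x" for j
  proof -
    \<comment> \<open>Uniqueness is available on boxes, and the part of a tile inside the large cube
      is again a box.\<close>
    obtain a b where W: "tile L j \<inter> ocube (4 * L) = box a b"
      by (rule that) (unfold tile_box ocube_eq_box, rule box_Int_box)
    have Ws: "box a b \<in> sets lebesgue" "box a b \<subseteq> tile L j" "box a b \<subseteq> ocube (4 * L)" using W by auto
    have "is_weak_deriv (tile L j) \<alpha> (\<lambda>x. f (x - lattice_shift L j)) (\<lambda>x. g (x - lattice_shift L j))"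
      using is_weak_deriv_shift[of "ocube (2 * L)" "lattice_shift L j" f g \<alpha>] g fl sets_lebesgue_tile[of L j]
      unfolding tile_def by (auto simp: l2_def)
    then have "is_weak_deriv (tile L j) \<alpha> (per_ext L f) (per_ext L g)"
      by (subst is_weak_deriv_cong[where ?f2.0="\<lambda>x. f (x - lattice_shift L j)" and ?g2.0="\<lambda>x. g (x - lattice_shift L j)"])
         (auto simp: per_ext_tile[OF L])
    then have 1: "is_weak_deriv (box a b) \<alpha> (per_ext L f) (per_ext L g)"
      by (rule is_weak_deriv_subset[OF _ Ws(1,2), rotated]) auto
    have 2: "is_weak_deriv (box a b) \<alpha> (per_ext L f) G"
      by (rule is_weak_deriv_subset[OF _ Ws(1,3) G(2)]) auto
    have "AE x in lebesgue_on (box a b). G x = per_ext L g x"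
      using l2_subset[OF _ Ws(1,3) G(1)] l2_subset[OF _ Ws(1,3) pg] by (intro is_weak_deriv_unique[OF _ _ 2 1]) auto
    then show ?thesis using Ws unfolding W by (simp add: AE_restrict_space_iff)
  qed
  then have "AE x in lebesgue. \<forall>j\<in>neighbours. x \<in> tile L j \<inter> ocube (4 * L) \<longrightarrow> G x = per_ext L g x"
    by (intro AE_finite_allI) auto
  with AE_tile_cover[OF L, where ?'d='d] have "AE x in lebesgue. x \<in> ocube (4 * L) \<longrightarrow> G x = per_ext L g x"
    by eventually_elim blast
  then have "AE x in lebesgue_on (ocube (4 * L)). G x = per_ext L g x"
    by (simp add: AE_restrict_space_iff)
  then show ?thesis
    by (intro is_weak_deriv_cong_AE[OF _ _ _ _ _ _ _ _ G(2)]) (use G pg pf in \<open>auto simp: l2_def\<close>)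
qed

section \<open>Trigonometric integrals and the Fejer kernel\<close>

text \<open>Fubini, through the description of \<open>lborel\<close> as a product measure indexed by
  \<open>Basis\<close>. The restriction to the open cube is absorbed into the factors as
  indicators.\<close>

lemma integral_tensor:
  fixes g :: "'d::finite \<Rightarrow> real \<Rightarrow> real"
  assumes g: "\<And>i. continuous_on UNIV (g i)"
  shows "(\<integral>x. tensor g x \<partial>lebesgue_on (ocube r)) = (\<Prod>i\<in>UNIV. integral {-r..r} (g i))"
proof -
  define h where "h i t = indicator {-r<..<r} t * g i t" for i t
  \<comment> \<open>The product measure is indexed by basis vectors but the tensor by coordinates;
    \<open>idx\<close> recovers i from \<open>axis i 1\<close>.\<close>
  define idx where "idx b = (THE i. b = (axis i 1 :: real^'d))" for b
  have idx: "idx (axis i 1) = i" for i by (auto simp: idx_def axis_eq_axis)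
  have B: "(Basis :: (real^'d) set) = range (\<lambda>i. axis i 1)" by (auto simp: Basis_vec_def)
  have inj: "inj (\<lambda>i. axis i 1 :: real^'d)" by (auto simp: inj_def axis_eq_axis)
  have hm: "h i \<in> borel_measurable borel" for i
    unfolding h_def[abs_def]
    by (rule borel_measurable_times[OF borel_measurable_indicator borel_measurable_continuous_onI[OF g]]) simp
  have gi: "set_integrable lborel {-r..r} (g i)" for i
    by (rule borel_integrable_atLeastAtMost') (rule continuous_on_subset[OF g], simp)
  then have gi': "set_integrable lborel {-r<..<r} (g i)" for i
    by (rule set_integrable_subset) auto
  then have hi: "integrable lborel (h i)" for i
    by (simp add: set_integrable_def h_def[abs_def])
  have hI: "(\<integral>t. h i t \<partial>lborel) = integral {-r..r} (g i)" for i
    using set_borel_integral_eq_integral(2)[OF gi'[of i]]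
    by (simp add: set_lebesgue_integral_def h_def integral_open_interval_real)
  have ind: "indicator (ocube r) x * tensor g x = tensor h x" for x
    unfolding ocube_eq_box indicator_box_prod tensor_def h_def by (simp add: prod.distrib)
  have tm: "tensor h \<in> borel_measurable lborel"
    unfolding tensor_def[abs_def] using hm by (intro borel_measurable_prod) (auto intro!: measurable_compose[OF _ hm])
  have c: "(\<Sum>b\<in>Basis. x b *\<^sub>R b) $ i = x (axis i 1)" for x :: "real^'d \<Rightarrow> real" and i
  proof -
    have "(\<Sum>b\<in>Basis. x b *\<^sub>R b) $ i = (\<Sum>b\<in>Basis. x b *\<^sub>R b) \<bullet> axis i 1"
      by (simp add: cart_eq_inner_axis)
    also have "\<dots> = x (axis i 1)" by (simp add: inner_sum_left_Basis axis_in_Basis_iff)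
    finally show ?thesis .
  qed
  interpret product_sigma_finite "\<lambda>_ :: real^'d. lborel :: real measure" ..
  have "(\<integral>x. tensor g x \<partial>lebesgue_on (ocube r)) = (\<integral>x. tensor h x \<partial>lebesgue)"
    by (simp add: integral_restrict_space ind)
  also have "\<dots> = (\<integral>x. tensor h x \<partial>lborel)" by (rule integral_completion[OF tm])
  also have "\<dots> = (\<integral>x. tensor h (\<Sum>b\<in>Basis. x b *\<^sub>R b) \<partial>(\<Pi>\<^sub>M b\<in>Basis. lborel))"
    by (subst lborel_eq, rule integral_distr) (use tm in \<open>auto\<close>)
  also have "\<dots> = (\<integral>x. (\<Prod>b\<in>Basis. h (idx b) (x b)) \<partial>(\<Pi>\<^sub>M b\<in>Basis. lborel))"
    by (simp only: tensor_def c) (simp add: B prod.reindex[OF inj] idx)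
  also have "\<dots> = (\<Prod>b\<in>Basis. \<integral>t. h (idx b) t \<partial>lborel)"
    by (rule product_integral_prod) (auto intro: hi)
  also have "\<dots> = (\<Prod>i\<in>UNIV. integral {-r..r} (g i))"
    unfolding B prod.reindex[OF inj] by (simp add: idx hI)
  finally show ?thesis .
qed

lemma tensor_l2:
  fixes g :: "'d::finite \<Rightarrow> real \<Rightarrow> real"
  assumes g: "\<And>i. continuous_on UNIV (g i)"
  shows "tensor g \<in> l2 (lebesgue_on (ocube r))"
proof -
  have c: "continuous_on A (tensor g)" for A by (rule continuous_on_tensor[OF g])
  have "compact (tensor g ` ccube r)"
    unfolding ccube_eq_cbox by (intro compact_continuous_image c compact_cbox)
  then obtain C where C: "\<And>x. x \<in> ccube r \<Longrightarrow> \<bar>tensor g x\<bar> \<le> C"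
    by (metis bounded_iff compact_imp_bounded image_eqI real_norm_def)
  show ?thesis
  proof (rule l2_bounded)
    show "tensor g \<in> borel_measurable (lebesgue_on (ocube r))"
      by (rule continuous_imp_measurable_on_sets_lebesgue[OF c]) simp
    show "\<bar>tensor g x\<bar> \<le> C" if "x \<in> space (lebesgue_on (ocube r))" for x
      using that by (intro C) (auto simp: space_restrict_space ocube_def ccube_def less_imp_le)
  qed simp
qed

lemma tensor_mult: "tensor g x * tensor h x = tensor (\<lambda>i t. g i t * h i t) x"
  by (simp add: tensor_def prod.distrib)

section \<open>Integrals of cosines over a period\<close>

lemma continuous_on_cos_affine: "continuous_on A (\<lambda>t::real. cos (\<beta> * (x - t) + \<theta>))"
  by (intro continuous_intros)

lemma sin_plus_2pi_int: "sin (x + 2 * pi * of_int m) = sin x"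
  by (simp add: sin_add sin_int_2pin cos_int_2pin)

lemma cos_plus_2pi_int: "cos (x + 2 * pi * of_int m) = cos x"
  by (simp add: cos_add sin_int_2pin cos_int_2pin)

lemma integral_cos_period:
  assumes L: "L > 0" and m: "m \<noteq> (0::int)"
  shows "integral {-2*L..2*L} (\<lambda>t. cos (pi / (2*L) * of_int m * (x - t) + \<theta>)) = 0"
proof -
  define \<beta> where "\<beta> = pi / (2*L) * of_int m"
  have \<beta>: "\<beta> \<noteq> 0" using L m by (simp add: \<beta>_def)
  have "((\<lambda>t. cos (\<beta> * (x - t) + \<theta>)) has_integral
     (- sin (\<beta> * (x - 2*L) + \<theta>) / \<beta> - - sin (\<beta> * (x - - 2*L) + \<theta>) / \<beta>)) {-2*L..2*L}"
  proof (rule fundamental_theorem_of_calculus)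
    show "- 2 * L \<le> 2 * L" using L by simp
    fix t
    show "((\<lambda>t. - sin (\<beta> * (x - t) + \<theta>) / \<beta>) has_vector_derivative cos (\<beta> * (x - t) + \<theta>)) (at t within {-2*L..2*L})"
      unfolding has_real_derivative_iff_has_vector_derivative[symmetric]
      using \<beta> by (auto intro!: derivative_eq_intros simp: field_simps)
  qed
  moreover have "\<beta> * (x - - 2*L) + \<theta> = (\<beta> * (x - 2*L) + \<theta>) + 2 * pi * of_int m"
    using L by (simp add: \<beta>_def field_simps)
  then have "sin (\<beta> * (x - - 2*L) + \<theta>) = sin (\<beta> * (x - 2*L) + \<theta>)"
    by (simp only: sin_plus_2pi_int)
  ultimately show ?thesis unfolding \<beta>_def[symmetric] by (simp add: has_integral_iff)
qed

lemma cos_integrable: "(\<lambda>t::real. cos (\<beta> * (x - t) + \<theta>)) integrable_on {a..b}"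
  by (rule integrable_continuous_interval[OF continuous_on_cos_affine])

text \<open>Product-to-sum: the phases cancel in the difference frequency and add up in the sum
  frequency. For k > 0 the doubled frequency is nonzero and integrates to 0 over a period.\<close>

lemma integral_cos_mult_cos:
  fixes k l :: nat
  assumes L: "L > 0"
  defines "\<omega> \<equiv> pi / (2*L)"
  shows "k \<noteq> l \<Longrightarrow> integral {-2*L..2*L} (\<lambda>t. cos (\<omega> * k * (x - t) + \<theta>) * cos (\<omega> * l * (x - t) + \<theta>)) = 0"
    and "k > 0 \<Longrightarrow> integral {-2*L..2*L} (\<lambda>t. cos (\<omega> * k * (x - t) + \<theta>) * cos (\<omega> * k * (x - t) + \<theta>)) = 2 * L"
proof -
  have prod: "cos (\<omega> * k * (x - t) + \<theta>) * cos (\<omega> * l * (x - t) + \<theta>)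
      = (1/2) * (cos (\<omega> * of_int (int k - int l) * (x - t) + 0) + cos (\<omega> * of_int (int k + int l) * (x - t) + 2 * \<theta>))" for t and k l :: nat
    unfolding cos_times_cos by (simp add: algebra_simps)
  have split: "integral {-2*L..2*L} (\<lambda>t. cos (\<omega> * k * (x - t) + \<theta>) * cos (\<omega> * l * (x - t) + \<theta>))
    = (1/2) * (integral {-2*L..2*L} (\<lambda>t. cos (\<omega> * of_int (int k - int l) * (x - t) + 0))
             + integral {-2*L..2*L} (\<lambda>t. cos (\<omega> * of_int (int k + int l) * (x - t) + 2 * \<theta>)))" for k l :: nat
    unfolding prod by (simp only: integral_mult_right integral_add[OF cos_integrable cos_integrable])
  show "integral {-2*L..2*L} (\<lambda>t. cos (\<omega> * k * (x - t) + \<theta>) * cos (\<omega> * l * (x - t) + \<theta>)) = 0" if "k \<noteq> l"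
  proof -
    have "int k - int l \<noteq> 0" "int k + int l \<noteq> 0" using that by auto
    from integral_cos_period[OF L this(1), of x 0] integral_cos_period[OF L this(2), of x "2 * \<theta>"]
    have z: "integral {-2*L..2*L} (\<lambda>t. cos (\<omega> * of_int (int k - int l) * (x - t) + 0)) = 0"
      "integral {-2*L..2*L} (\<lambda>t. cos (\<omega> * of_int (int k + int l) * (x - t) + 2 * \<theta>)) = 0"
      by (simp_all only: \<omega>_def)
    show ?thesis unfolding split z by simp
  qed
  show "integral {-2*L..2*L} (\<lambda>t. cos (\<omega> * k * (x - t) + \<theta>) * cos (\<omega> * k * (x - t) + \<theta>)) = 2 * L" if "k > 0"
  proof -
    have "int k + int k \<noteq> 0" using that by auto
    from integral_cos_period[OF L this, of x "2 * \<theta>"]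
    have z: "integral {-2*L..2*L} (\<lambda>t. cos (\<omega> * of_int (int k + int k) * (x - t) + 2 * \<theta>)) = 0"
      by (simp only: \<omega>_def)
    have z0: "integral {-2*L..2*L} (\<lambda>t. cos (\<omega> * of_int (int k - int k) * (x - t) + 0)) = 4 * L"
      using L by simp
    show ?thesis unfolding split z z0 by simp
  qed
qed

text \<open>At frequency 0 the exact value depends on the phase and may be 0; an upper bound is what
  Bessel's inequality asks for.\<close>

lemma integral_cos_square_bounds:
  assumes "L > 0"
  shows "0 \<le> integral {-2*L..2*L} (\<lambda>t::real. cos (\<beta> * (x - t) + \<theta>) * cos (\<beta> * (x - t) + \<theta>))"
    and "integral {-2*L..2*L} (\<lambda>t::real. cos (\<beta> * (x - t) + \<theta>) * cos (\<beta> * (x - t) + \<theta>)) \<le> 4 * L"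
proof -
  have i: "(\<lambda>t::real. cos (\<beta> * (x - t) + \<theta>) * cos (\<beta> * (x - t) + \<theta>)) integrable_on {-2*L..2*L}"
    by (intro integrable_continuous_interval continuous_intros)
  show "0 \<le> integral {-2*L..2*L} (\<lambda>t::real. cos (\<beta> * (x - t) + \<theta>) * cos (\<beta> * (x - t) + \<theta>))"
    by (rule integral_nonneg[OF i]) simp
  have "integral {-2*L..2*L} (\<lambda>t::real. cos (\<beta> * (x - t) + \<theta>) * cos (\<beta> * (x - t) + \<theta>)) \<le> integral {-2*L..2*L} (\<lambda>t. 1)"
    by (rule integral_le[OF i]) (auto simp: abs_square_le_1 power2_eq_square[symmetric])
  then show "integral {-2*L..2*L} (\<lambda>t::real. cos (\<beta> * (x - t) + \<theta>) * cos (\<beta> * (x - t) + \<theta>)) \<le> 4 * L"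
    using assms by simp
qed

text \<open>\<open>(N + 1)\<close> times the Fejer kernel is the squared modulus of the geometric sum of \<open>exp (\<i> k t)\<close>.\<close>

lemma Fejer_sum_nonneg:
  "0 \<le> real (Suc N) + 2 * (\<Sum>k=1..N. (real (Suc N) - real k) * cos (real k * t))"
proof -
  define A where "A n = (\<Sum>k\<le>n. cos (real k * t))" for n
  define B where "B n = (\<Sum>k\<le>n. sin (real k * t))" for n
  \<comment> \<open>\<open>A n\<close> and \<open>B n\<close> are the real and imaginary part of the
    geometric sum. This is the real part of the next exponential times the conjugate sum: cosines of
    differences, listed in reverse order.\<close>
  have step: "cos (real (Suc n) * t) * A n + sin (real (Suc n) * t) * B n = (\<Sum>k=1..Suc n. cos (real k * t))" for n
  proof -
    have "cos (real (Suc n) * t) * A n + sin (real (Suc n) * t) * B n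
        = (\<Sum>k\<le>n. cos (real (Suc n) * t) * cos (real k * t) + sin (real (Suc n) * t) * sin (real k * t))"
      by (simp only: A_def B_def sum_distrib_left sum.distrib)
    also have "\<dots> = (\<Sum>k\<le>n. cos (real (Suc n - k) * t))"
    proof (intro sum.cong refl)
      fix k assume "k \<in> {..n}"
      then have "real (Suc n - k) * t = real (Suc n) * t - real k * t"
        by (simp only: of_nat_diff left_diff_distrib atMost_iff le_SucI)
      then show "cos (real (Suc n) * t) * cos (real k * t) + sin (real (Suc n) * t) * sin (real k * t) = cos (real (Suc n - k) * t)"
        by (simp only: cos_diff)
    qed
    also have "\<dots> = (\<Sum>k=1..Suc n. cos (real k * t))"
      by (rule sum.reindex_bij_witness[of _ "\<lambda>k. Suc n - k" "\<lambda>k. Suc n - k"]) auto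
    finally show ?thesis .
  qed
  have "(A N)\<^sup>2 + (B N)\<^sup>2 = real (Suc N) + 2 * (\<Sum>k=1..N. (real (Suc N) - real k) * cos (real k * t))"
  proof (induction N)
    case 0
    then show ?case by (simp add: A_def B_def)
  next
    case (Suc n)
    have a: "A (Suc n) = A n + cos (real (Suc n) * t)" "B (Suc n) = B n + sin (real (Suc n) * t)"
      by (simp_all add: A_def B_def)
    have "(A (Suc n))\<^sup>2 + (B (Suc n))\<^sup>2 = ((A n)\<^sup>2 + (B n)\<^sup>2)
       + 2 * (cos (real (Suc n) * t) * A n + sin (real (Suc n) * t) * B n) + ((sin (real (Suc n) * t))\<^sup>2 + (cos (real (Suc n) * t))\<^sup>2)"
      unfolding a by (simp add: power2_sum algebra_simps)
    also have "\<dots> = real (Suc n) + 2 * (\<Sum>k=1..n. (real (Suc n) - real k) * cos (real k * t))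
        + 2 * (\<Sum>k=1..Suc n. cos (real k * t)) + 1"
      unfolding step Suc sin_cos_squared_add by simp
    also have "(\<Sum>k=1..n. (real (Suc n) - real k) * cos (real k * t)) = (\<Sum>k=1..Suc n. (real (Suc n) - real k) * cos (real k * t))"
      by simp
    also have "real (Suc n) + 2 * (\<Sum>k=1..Suc n. (real (Suc n) - real k) * cos (real k * t))
        + 2 * (\<Sum>k=1..Suc n. cos (real k * t)) + 1
       = real (Suc (Suc n)) + 2 * (\<Sum>k=1..Suc n. (real (Suc n) - real k) * cos (real k * t) + cos (real k * t))"
      unfolding sum.distrib by simp
    also have "\<dots> = real (Suc (Suc n)) + 2 * (\<Sum>k=1..Suc n. (real (Suc (Suc n)) - real k) * cos (real k * t))"
      by (simp add: algebra_simps)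
    finally show ?case .
  qed
  then show ?thesis by (metis sum_power2_ge_zero)
qed

text \<open>The expansion runs over cosines with k \<ge> 0, so the modes k and -k are merged: hence
  1/(2L) for k > 0 against 1/(4L) for k = 0. The normalisation gives mass 1 over a period of length
  4L.\<close>

definition Fejer_weight :: "real \<Rightarrow> nat \<Rightarrow> nat \<Rightarrow> real" where
  "Fejer_weight L N k = (if k = 0 then 1 / (4*L) else (1 - real k / real (Suc N)) / (2*L))"

definition Fejer :: "real \<Rightarrow> nat \<Rightarrow> real \<Rightarrow> real" where
  "Fejer L N t = (\<Sum>k\<le>N. Fejer_weight L N k * cos (pi / (2*L) * real k * t))"

lemma Fejer_weight_bound: "L > 0 \<Longrightarrow> k \<le> N \<Longrightarrow> \<bar>Fejer_weight L N k\<bar> \<le> 1 / (2*L)"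
proof -
  assume L: "L > 0" and k: "k \<le> N"
  have "0 \<le> 1 - real k / real (Suc N)" "1 - real k / real (Suc N) \<le> 1" using k by (auto simp: divide_le_eq)
  then have "\<bar>(1 - real k / real (Suc N)) / (2*L)\<bar> \<le> 1 / (2*L)"
    using L by (simp only: abs_divide abs_of_nonneg abs_of_pos) (intro divide_right_mono, auto)
  then show ?thesis using L by (auto simp: Fejer_weight_def field_simps)
qed

lemma Fejer_nonneg:
  assumes L: "L > 0"
  shows "0 \<le> Fejer L N t"
proof -
  define u where "u = pi / (2*L) * t"
  \<comment> \<open>Over the common denominator 4L(N + 1) the kernel becomes the sum of
    \<open>Fejer_sum_nonneg\<close>.\<close>
  define a where "a = 4 * L * real (Suc N)"
  have a: "a > 0" using L by (simp add: a_def)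
  have "Fejer L N t = 1 / (4*L) + (\<Sum>k=1..N. Fejer_weight L N k * cos (real k * u))"
    unfolding Fejer_def
    by (subst sum.atMost_shift) (auto simp: Fejer_weight_def u_def mult_ac sum.atLeast1_atMost_eq lessThan_Suc_atMost)
  also have "(\<Sum>k=1..N. Fejer_weight L N k * cos (real k * u)) = (\<Sum>k=1..N. 2 * ((real (Suc N) - real k) * cos (real k * u)) / a)"
  proof (intro sum.cong refl)
    fix k assume "k \<in> {1..N}"
    define M where "M = real (Suc N)"
    have M: "M > 0" by (simp add: M_def)
    have "(1 - real k / M) / (2*L) * c = 2 * ((M - real k) * c) / (4 * L * M)" for c
      using L M by (simp add: field_simps)
    then show "Fejer_weight L N k * cos (real k * u) = 2 * ((real (Suc N) - real k) * cos (real k * u)) / a"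
      using \<open>k \<in> {1..N}\<close> by (simp add: Fejer_weight_def a_def M_def)
  qed
  also have "\<dots> = 2 * (\<Sum>k=1..N. (real (Suc N) - real k) * cos (real k * u)) / a"
    by (simp only: sum_divide_distrib[symmetric] sum_distrib_left)
  also have "1 / (4*L) = real (Suc N) / a" using L by (simp add: a_def)
  also have "real (Suc N) / a + 2 * (\<Sum>k=1..N. (real (Suc N) - real k) * cos (real k * u)) / a
     = (real (Suc N) + 2 * (\<Sum>k=1..N. (real (Suc N) - real k) * cos (real k * u))) / a"
    by (simp add: add_divide_distrib)
  finally show ?thesis using Fejer_sum_nonneg[of N u] a by simp
qed

lemma continuous_on_Fejer: "continuous_on A (\<lambda>t. Fejer L N (x - t))"
  unfolding Fejer_def by (intro continuous_intros)

text \<open>Orthogonality leaves at most one term. The cases l = 0 and l = 1 are the moments that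
  drive convergence: mass 1, and a first cosine moment tending to 1.\<close>

lemma integral_Fejer_mult_cos:
  assumes L: "L > 0"
  shows "integral {-2*L..2*L} (\<lambda>t. Fejer L N (x - t) * cos (pi / (2*L) * real l * (x - t)))
     = (if l > N then 0 else if l = 0 then 1 else 1 - real l / real (Suc N))"
proof -
  let ?\<omega> = "pi / (2*L)"
  have "integral {-2*L..2*L} (\<lambda>t. Fejer L N (x - t) * cos (?\<omega> * real l * (x - t)))
     = integral {-2*L..2*L} (\<lambda>t. \<Sum>k\<le>N. Fejer_weight L N k * (cos (?\<omega> * real k * (x - t) + 0) * cos (?\<omega> * real l * (x - t) + 0)))"
    by (simp add: Fejer_def sum_distrib_right mult.assoc)
  also have "\<dots> = (\<Sum>k\<le>N. Fejer_weight L N k * integral {-2*L..2*L} (\<lambda>t. cos (?\<omega> * real k * (x - t) + 0) * cos (?\<omega> * real l * (x - t) + 0)))"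
    by (subst integral_sum) (use L in \<open>auto intro!: integrable_continuous_interval continuous_intros\<close>)
  also have "\<dots> = (\<Sum>k\<le>N. if k = l then Fejer_weight L N l * (if l = 0 then 4 * L else 2 * L) else 0)"
  proof (intro sum.cong refl)
    fix k
    show "Fejer_weight L N k * integral {-2*L..2*L} (\<lambda>t. cos (?\<omega> * real k * (x - t) + 0) * cos (?\<omega> * real l * (x - t) + 0))
      = (if k = l then Fejer_weight L N l * (if l = 0 then 4 * L else 2 * L) else 0)"
    proof (cases "k = l")
      case True
      show ?thesis
      proof (cases "l = 0")
        case True
        then show ?thesis using \<open>k = l\<close> L by simp
      next
        case False
        then show ?thesis using \<open>k = l\<close> integral_cos_mult_cos(2)[OF L, of l x 0] by simp
      qed
    next
      case False
      then show ?thesis using integral_cos_mult_cos(1)[OF L, of k l x 0] by simp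
    qed
  qed
  also have "\<dots> = (if l > N then 0 else if l = 0 then 1 else 1 - real l / real (Suc N))"
    using L by (auto simp: Fejer_weight_def)
  finally show ?thesis .
qed

section \<open>Wave coefficients of weak derivatives\<close>

lemma jet_vanish:
  assumes E: "smooth_jet E" and z: "\<And>t. t \<notin> {-a..a} \<Longrightarrow> E 0 t = 0" and t: "t \<notin> {-a..a}"
  shows "E n t = 0"
  using t
proof (induction n arbitrary: t)
  case 0
  then show ?case using z by simp
next
  case (Suc n)
  have "((\<lambda>t. 0) has_real_derivative 0) (at t)" by simp
  then have "(E n has_real_derivative 0) (at t)"
    by (rule has_field_derivative_transform_within_open[where S="- {-a..a}"]) (use Suc in auto)
  then show ?case using smooth_jetD[OF E, of n t] DERIV_unique by blast
qed

text \<open>An identity on an open interval may be differentiated; uniqueness of derivatives carries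
  it from order 0 to every order.\<close>

lemma jet_periodization:
  assumes E: "smooth_jet E" and D: "smooth_jet D"
    and base: "\<And>t. \<bar>t\<bar> < r \<Longrightarrow> (\<Sum>j\<in>{-1,0,1::int}. E 0 (t + c * of_int j)) = D 0 t" and t: "\<bar>t\<bar> < r"
  shows "(\<Sum>j\<in>{-1,0,1::int}. E n (t + c * of_int j)) = D n t"
  using t
proof (induction n arbitrary: t)
  case 0
  then show ?case by (rule base)
next
  case (Suc n)
  have "((\<lambda>t. E n (t + c * of_int j)) has_real_derivative E (Suc n) (t + c * of_int j) * 1) (at t)" for j :: int
    by (rule DERIV_chain2[OF smooth_jetD[OF E]]) (auto intro!: derivative_eq_intros)
  then have "((\<lambda>t. \<Sum>j\<in>{-1,0,1::int}. E n (t + c * of_int j)) has_real_derivative (\<Sum>j\<in>{-1,0,1::int}. E (Suc n) (t + c * of_int j))) (at t)"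
    by (intro DERIV_sum) simp
  then have "(D n has_real_derivative (\<Sum>j\<in>{-1,0,1::int}. E (Suc n) (t + c * of_int j))) (at t)"
    by (rule has_field_derivative_transform_within_open[where S="{-r<..<r}"]) (use Suc.prems in \<open>auto intro!: Suc.IH simp del: sum.insert\<close>)
  then show ?case using smooth_jetD[OF D, of n t] DERIV_unique by blast
qed

text \<open>With \<open>R\<close> an antiderivative of a bump supported in \<open>[-L, L]\<close>, the translates by \<open>4 L\<close> of
  \<open>R (t + 2 L) - R (t - 2 L)\<close> telescope.\<close>

lemma periodic_partition_of_unity:
  assumes L: "L > 0"
  obtains pu where "smooth_jet pu" "\<And>t. t \<notin> {-(3*L)..3*L} \<Longrightarrow> pu 0 t = 0"
    "\<And>t. \<bar>t\<bar> < 2*L \<Longrightarrow> (\<Sum>j\<in>{-1,0,1::int}. pu 0 (t + 4 * L * of_int j)) = 1"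
proof -
  define \<rho> where "\<rho> = jet_mult (jet_affine 1 L step_jet) (jet_affine (-1) L step_jet)"
  have \<rho>: "smooth_jet \<rho>" unfolding \<rho>_def by (intro smooth_jet_mult smooth_jet_affine smooth_step_jet)
  have \<rho>0: "\<rho> 0 t = step_jet 0 (t + L) * step_jet 0 (L - t)" for t
    by (simp add: \<rho>_def jet_mult_0 jet_affine_def)
  have \<rho>z: "\<rho> 0 t = 0" if "t \<notin> {-L<..<L}" for t
    using that step_jet_nonpos[of "t + L"] step_jet_nonpos[of "L - t"] by (auto simp: \<rho>0 not_less)
  have \<rho>p: "\<rho> 0 t > 0" if "t \<in> {-L<..<L}" for t
    using that by (simp add: \<rho>0 step_jet_pos)
  \<comment> \<open>The antiderivative exists on the whole line and is constant on either side of
    the bump; its total increase \<open>c\<close> will serve as the normalisation.\<close>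
  have "\<exists>R. \<forall>x :: real. (-\<infinity>) < ereal x \<longrightarrow> ereal x < \<infinity> \<longrightarrow> (R has_vector_derivative \<rho> 0 x) (at x)"
    by (rule einterval_antiderivative) (auto intro: DERIV_isCont[OF smooth_jetD[OF \<rho>]])
  then obtain R where R: "\<And>x. (R has_real_derivative \<rho> 0 x) (at x)"
    by (auto simp: has_real_derivative_iff_has_vector_derivative)
  have Rc: "continuous_on A R" for A
    by (meson DERIV_continuous_on R has_field_derivative_at_within)
  have const: "R b = R a" if "a \<le> b" "\<And>t. a < t \<Longrightarrow> t < b \<Longrightarrow> t \<notin> {-L<..<L}" for a b
  proof (cases "a = b")
    case False
    show ?thesis
    proof (rule DERIV_isconst_end[where f=R and a=a and b=b])
      show "a < b" using False that by simp
      show "DERIV R x :> 0" if "a < x" "x < b" for x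
        using R[of x] \<rho>z[of x] \<open>\<And>t. a < t \<Longrightarrow> t < b \<Longrightarrow> t \<notin> {-L<..<L}\<close>[OF that] by simp
    qed (rule Rc)
  qed simp
  have hi: "R t = R L" if "t \<ge> L" for t by (rule const) (use that in auto)
  have lo: "R t = R (-L)" if "t \<le> - L" for t by (rule const[symmetric]) (use that in auto)
  define c where "c = R L - R (-L)"
  have "R (-L) < R L"
  proof (rule DERIV_pos_imp_increasing_open[where f=R and a="-L" and b=L])
    show "- L < L" using L by simp
    show "\<exists>y. DERIV R x :> y \<and> y > 0" if "- L < x" "x < L" for x using R[of x] \<rho>p[of x] that by auto
  qed (rule Rc)
  then have c: "c > 0" by (simp add: c_def)
  \<comment> \<open>Order 0 involves the antiderivative \<open>R\<close>, all higher orders the jet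
    of the bump itself.\<close>
  define pu where "pu n t = (case n of 0 \<Rightarrow> (R (t + 2*L) - R (t - 2*L)) / c
      | Suc m \<Rightarrow> (\<rho> m (t + 2*L) - \<rho> m (t - 2*L)) / c)" for n t
  have "smooth_jet pu"
    unfolding smooth_jet_def
  proof (intro allI)
    fix n t
    have sh: "((\<lambda>t. (G (t + 2*L) - G (t - 2*L)) / c) has_real_derivative (G' (t + 2*L) - G' (t - 2*L)) / c) (at t)"
      if G: "\<And>x. (G has_real_derivative G' x) (at x)" for G G'
    proof -
      have "((\<lambda>t. G (t + b)) has_real_derivative G' (t + b) * 1) (at t)" for b
        by (rule DERIV_chain2[OF G]) (auto intro!: derivative_eq_intros)
      from DERIV_cdivide[OF DERIV_diff[OF this[of "2*L"] this[of "- (2*L)"]], of c] show ?thesis by simp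
    qed
    show "(pu n has_real_derivative pu (Suc n) t) (at t)"
      unfolding pu_def using sh[OF R] sh[OF smooth_jetD[OF \<rho>]] by (cases n) simp_all
  qed
  moreover have "pu 0 t = 0" if "t \<notin> {-(3*L)..3*L}" for t
  proof -
    \<comment> \<open>Beyond 3L in absolute value both arguments lie on the same side of [-L, L],
      where \<open>R\<close> is constant. As 3L < 4L, this leaves room for a compact support inside
      the large cube.\<close>
    have "t > 3*L \<or> t < -(3*L)" using that by auto
    then have "R (t + 2*L) = R (t - 2*L)"
      using hi[of "t + 2*L"] hi[of "t - 2*L"] lo[of "t + 2*L"] lo[of "t - 2*L"] L by auto
    then show ?thesis by (simp add: pu_def)
  qed
  moreover have "(\<Sum>j\<in>{-1,0,1::int}. pu 0 (t + 4 * L * of_int j)) = 1" if t: "\<bar>t\<bar> < 2*L" for t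
  proof -
    have "(\<Sum>j\<in>{-1,0,1::int}. pu 0 (t + 4 * L * of_int j)) = (R (t + 6*L) - R (t - 6*L)) / c"
      using c by (simp add: pu_def field_simps)
    also have "\<dots> = (R L - R (-L)) / c" using hi[of "t + 6*L"] lo[of "t - 6*L"] t L by simp
    finally show ?thesis using c by (simp add: c_def)
  qed
  ultimately show ?thesis using that by blast
qed

text \<open>Each derivative advances the cosine by a quarter period, so derivatives of a wave are
  multiples of waves, and s derivatives undo an initial phase of -s pi/2.\<close>

definition cos_jet :: "real \<Rightarrow> real \<Rightarrow> real \<Rightarrow> nat \<Rightarrow> real \<Rightarrow> real" where
  "cos_jet \<beta> x \<theta> n t = (- \<beta>) ^ n * cos (\<beta> * (x - t) + \<theta> + real n * pi / 2)"

lemma smooth_cos_jet: "smooth_jet (cos_jet \<beta> x \<theta>)"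
  unfolding smooth_jet_def cos_jet_def
proof (intro allI)
  fix n t
  have e: "cos (\<beta> * (x - t) + \<theta> + real (Suc n) * pi / 2) = - sin (\<beta> * (x - t) + \<theta> + real n * pi / 2)"
  proof -
    have "\<beta> * (x - t) + \<theta> + real (Suc n) * pi / 2 = (\<beta> * (x - t) + \<theta> + real n * pi / 2) + pi / 2"
      by (simp add: field_simps)
    moreover have "cos (y + pi / 2) = - sin y" for y :: real by (simp add: cos_add)
    ultimately show ?thesis by (simp only:)
  qed
  show "((\<lambda>t. (- \<beta>) ^ n * cos (\<beta> * (x - t) + \<theta> + real n * pi / 2)) has_real_derivative
      (- \<beta>) ^ Suc n * cos (\<beta> * (x - t) + \<theta> + real (Suc n) * pi / 2)) (at t)"
    unfolding e by (auto intro!: derivative_eq_intros)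
qed

text \<open>Unfolding: the large cube is cut into tiles, each is translated to the period cell, and
  the translates of \<open>e\<close> are collected. The sum over tiles factorises into
  one-dimensional periodisations.\<close>

lemma per_ext_tensor_integral:
  fixes h :: "real^'d::finite \<Rightarrow> real"
  assumes L: "L > 0" and h: "h \<in> l2 (lebesgue_on (ocube (2 * L)))"
    and e: "\<And>i. continuous_on UNIV (e i)" and z: "\<And>i t. t \<notin> {-(3*L)..3*L} \<Longrightarrow> e i t = 0"
  shows "(\<integral>x. per_ext L h x * tensor e x \<partial>lebesgue_on (ocube (4 * L)))
       = (\<integral>x. h x * tensor (\<lambda>i t. \<Sum>j\<in>{-1,0,1::int}. e i (t + 4 * L * of_int j)) x \<partial>lebesgue_on (ocube (2 * L)))"
proof -
  define T where "T j = tensor (\<lambda>i t. e i (t + 4 * L * of_int (j i)))" for j :: "'d \<Rightarrow> int"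
  have T: "tensor e x = T j (x - lattice_shift L j)" for x j
    by (simp add: T_def tensor_def lattice_shift_def)
  have Tl: "T j \<in> l2 (lebesgue_on (ocube (2 * L)))" for j
    unfolding T_def by (intro tensor_l2 continuous_on_compose2[OF e] continuous_intros) auto
  have Gi: "integrable (lebesgue_on (ocube (2 * L))) (\<lambda>x. h x * T j x)" for j
    by (rule l2_product_integrable[OF h Tl])
  have Gm: "(\<lambda>x. h x * T j x) \<in> borel_measurable (lebesgue_on (ocube (2 * L)))" for j using Gi by auto
  have F: "per_ext L h x * tensor e x = h (x - lattice_shift L j) * T j (x - lattice_shift L j)"
    if "x \<in> space (lebesgue_on (tile L j))" for x j
    using that T[of x j] by (simp add: per_ext_tile[OF L] space_restrict_space)
  have Fi: "integrable (lebesgue_on (tile L j)) (\<lambda>x. per_ext L h x * tensor e x)" for j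
    using tile_shift_integral(2)[OF Gm, of j] Gi
    by (subst Bochner_Integration.integrable_cong[OF refl F]) auto
  have FI: "(\<integral>x. per_ext L h x * tensor e x \<partial>lebesgue_on (tile L j)) = (\<integral>x. h x * T j x \<partial>lebesgue_on (ocube (2 * L)))" for j
    using tile_shift_integral(3)[OF Gm, of j]
    by (subst Bochner_Integration.integral_cong[OF refl F]) auto
  have "(\<integral>x. per_ext L h x * tensor e x \<partial>lebesgue_on (ocube (4 * L)))
      = (\<Sum>j\<in>neighbours. \<integral>x. h x * T j x \<partial>lebesgue_on (ocube (2 * L)))"
  proof (subst tile_integral(2)[OF L Fi])
    \<comment> \<open>Support in [-3L, 3L] makes the integrand vanish outside the large cube, so the
      overhanging tiles contribute nothing extra and equality holds.\<close>
    fix x :: "real^'d" assume "x \<notin> ocube (4 * L)"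
    then obtain i where "\<bar>x $ i\<bar> \<ge> 4 * L" by (auto simp: ocube_def not_less)
    then have "e i (x $ i) = 0" using L by (intro z) auto
    then show "per_ext L h x * tensor e x = 0" by (auto simp: tensor_def)
  qed (simp add: FI)
  also have "\<dots> = (\<integral>x. (\<Sum>j\<in>neighbours. h x * T j x) \<partial>lebesgue_on (ocube (2 * L)))"
    by (rule Bochner_Integration.integral_sum[symmetric]) (rule Gi)
  also have "(\<lambda>x. \<Sum>j\<in>neighbours. h x * T j x)
      = (\<lambda>x. h x * tensor (\<lambda>i t. \<Sum>j\<in>{-1,0,1::int}. e i (t + 4 * L * of_int j)) x)"
  proof
    fix x :: "real^'d"
    have "(\<Prod>i\<in>UNIV. \<Sum>j\<in>{-1,0,1::int}. e i (x $ i + 4 * L * of_int j))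
        = (\<Sum>j\<in>neighbours. \<Prod>i\<in>UNIV. e i (x $ i + 4 * L * of_int (j i)))"
      unfolding neighbours_def by (rule prod_sum_PiE) auto
    then show "(\<Sum>j\<in>neighbours. h x * T j x) = h x * tensor (\<lambda>i t. \<Sum>j\<in>{-1,0,1::int}. e i (t + 4 * L * of_int j)) x"
      by (simp only: sum_distrib_left[symmetric] T_def tensor_def)
  qed
  finally show ?thesis .
qed

text \<open>Waves are centred at x, where the value without phases is 1. A product kernel even about
  x in every coordinate expands in such cosines alone, so sines can be avoided when the value at x
  is sought.\<close>

definition wave :: "real \<Rightarrow> real^'d::finite \<Rightarrow> ('d \<Rightarrow> real) \<Rightarrow> ('d \<Rightarrow> nat) \<Rightarrow> real^'d \<Rightarrow> real" where
  "wave L x \<theta> k = tensor (\<lambda>i t. cos (pi / (2*L) * real (k i) * (x $ i - t) + \<theta> i))"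

lemma wave_l2: "wave L x \<theta> k \<in> l2 (lebesgue_on (ocube r))"
  unfolding wave_def by (intro tensor_l2 continuous_on_cos_affine)

lemma wave_orthogonal:
  assumes L: "L > 0" and kl: "k \<noteq> l"
  shows "(\<integral>y. wave L x \<theta> k y * wave L x \<theta> l y \<partial>lebesgue_on (ocube (2*L))) = 0"
proof -
  obtain i where i: "k i \<noteq> l i" using kl by auto
  have "(\<integral>y. wave L x \<theta> k y * wave L x \<theta> l y \<partial>lebesgue_on (ocube (2*L))) =
     (\<Prod>i\<in>UNIV. integral {-(2*L)..2*L} (\<lambda>t. cos (pi / (2*L) * real (k i) * (x $ i - t) + \<theta> i) * cos (pi / (2*L) * real (l i) * (x $ i - t) + \<theta> i)))"
    unfolding wave_def tensor_mult by (rule integral_tensor) (intro continuous_intros)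
  moreover have "integral {-(2*L)..2*L} (\<lambda>t. cos (pi / (2*L) * real (k i) * (x $ i - t) + \<theta> i) * cos (pi / (2*L) * real (l i) * (x $ i - t) + \<theta> i)) = 0"
    using integral_cos_mult_cos(1)[OF L i, of "x $ i" "\<theta> i"] by simp
  ultimately show ?thesis by (auto intro!: prod_zero)
qed

lemma wave_norm:
  fixes x :: "real^'d::finite"
  assumes L: "L > 0"
  shows "(\<integral>y. wave L x \<theta> k y * wave L x \<theta> k y \<partial>lebesgue_on (ocube (2*L))) \<le> (4 * L) ^ CARD('d)"
proof -
  have "(\<integral>y. wave L x \<theta> k y * wave L x \<theta> k y \<partial>lebesgue_on (ocube (2*L))) =
     (\<Prod>i\<in>UNIV. integral {-(2*L)..2*L} (\<lambda>t. cos (pi / (2*L) * real (k i) * (x $ i - t) + \<theta> i) * cos (pi / (2*L) * real (k i) * (x $ i - t) + \<theta> i)))"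
    unfolding wave_def tensor_mult by (rule integral_tensor) (intro continuous_intros)
  also have "\<dots> \<le> (\<Prod>i\<in>(UNIV::'d set). 4 * L)"
  proof (intro prod_mono conjI)
    fix i
    have "-(2*L) = -2*L" by simp
    then show "0 \<le> integral {-(2*L)..2*L} (\<lambda>t. cos (pi / (2*L) * real (k i) * (x $ i - t) + \<theta> i) * cos (pi / (2*L) * real (k i) * (x $ i - t) + \<theta> i))"
      "integral {-(2*L)..2*L} (\<lambda>t. cos (pi / (2*L) * real (k i) * (x $ i - t) + \<theta> i) * cos (pi / (2*L) * real (k i) * (x $ i - t) + \<theta> i)) \<le> 4 * L"
      using integral_cos_square_bounds[OF L, of "pi / (2*L) * real (k i)" "x $ i" "\<theta> i"] by (simp_all only:)
  qed
  finally show ?thesis by simp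
qed

definition pure_index :: "nat \<Rightarrow> 'd \<Rightarrow> 'd::finite \<Rightarrow> nat" where
  "pure_index s i = (\<lambda>j. if j = i then s else 0)"

lemma mi_order_pure_index: "mi_order (pure_index s i) = s"
  by (simp add: mi_order_def pure_index_def)

text \<open>The test function is a wave multiplied by the partition of unity; the phase is chosen so that
  \<open>s\<close> differentiations in direction \<open>i\<close> cancel it.\<close>

lemma wave_coefficient_deriv:
  fixes f :: "real^'d::finite \<Rightarrow> real"
  assumes L: "L > 0" and f: "f \<in> Hper L s"
  shows "(pi / (2*L) * real (k i)) ^ s * (\<integral>y. f y * wave L x (\<lambda>_. 0) k y \<partial>lebesgue_on (ocube (2*L)))
     = (\<integral>y. wderiv L (pure_index s i) f y * wave L x (\<lambda>j. if j = i then - (real s * pi / 2) else 0) k y \<partial>lebesgue_on (ocube (2*L)))"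
proof -
  let ?\<alpha> = "pure_index s i"
  let ?g = "wderiv L ?\<alpha> f"
  define \<beta> where "\<beta> j = pi / (2*L) * real (k j)" for j
  define \<theta> where "\<theta> j = (if j = i then - (real s * pi / 2) else 0)" for j
  define D where "D j = cos_jet (\<beta> j) (x $ j) (\<theta> j)" for j
  obtain pu where pu: "smooth_jet pu" and puz: "\<And>t. t \<notin> {-(3*L)..3*L} \<Longrightarrow> pu 0 t = 0"
    and pu1: "\<And>t. \<bar>t\<bar> < 2*L \<Longrightarrow> (\<Sum>j\<in>{-1,0,1::int}. pu 0 (t + 4 * L * of_int j)) = 1"
    using periodic_partition_of_unity[OF L] by blast
  define E where "E j = jet_mult pu (D j)" for j
  have Ds: "smooth_jet (D j)" for j unfolding D_def by (rule smooth_cos_jet)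
  have Es: "smooth_jet (E j)" for j unfolding E_def by (intro smooth_jet_mult pu Ds)
  have E0: "E j 0 t = 0" if "t \<notin> {-(3*L)..3*L}" for j t
    using puz[OF that] by (simp add: E_def jet_mult_0)
  have Ez: "E j n t = 0" if "t \<notin> {-(3*L)..3*L}" for j n t
    using jet_vanish[OF Es, of "3*L"] E0 that by blast
  \<comment> \<open>Frequencies are integer multiples of pi/(2L), so a translation by a multiple of
    4L changes the argument by a multiple of 2 pi.\<close>
  have Dper: "D j 0 (t + 4 * L * of_int m) = D j 0 t" for j t m
  proof -
    have "\<beta> j * (x $ j - (t + 4 * L * of_int m)) + \<theta> j = (\<beta> j * (x $ j - t) + \<theta> j) + 2 * pi * of_int (- (int (k j) * m))"
      using L by (simp add: \<beta>_def field_simps)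
    then have "cos (\<beta> j * (x $ j - (t + 4 * L * of_int m)) + \<theta> j) = cos (\<beta> j * (x $ j - t) + \<theta> j)"
      by (simp only: cos_plus_2pi_int)
    then show ?thesis unfolding D_def cos_jet_def by simp
  qed
  \<comment> \<open>The periodic wave factors out of the sum of translates and leaves the partition
    of unity; the identity then passes to all derivatives.\<close>
  have per: "(\<Sum>m\<in>{-1,0,1::int}. E j n (t + 4 * L * of_int m)) = D j n t" if "\<bar>t\<bar> < 2*L" for j n t
  proof (rule jet_periodization[OF Es Ds _ that])
    fix t assume "\<bar>t\<bar> < 2*L"
    have "(\<Sum>m\<in>{-1,0,1::int}. E j 0 (t + 4 * L * of_int m)) = (\<Sum>m\<in>{-1,0,1::int}. pu 0 (t + 4 * L * of_int m)) * D j 0 t"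
      unfolding E_def jet_mult_0 Dper by (rule sum_distrib_right[symmetric])
    then show "(\<Sum>m\<in>{-1,0,1::int}. E j 0 (t + 4 * L * of_int m)) = D j 0 t" using pu1[OF \<open>\<bar>t\<bar> < 2*L\<close>] by simp
  qed
  have unfold: "(\<integral>y. per_ext L h y * tensor (\<lambda>j. E j (n j)) y \<partial>lebesgue_on (ocube (4*L)))
     = (\<integral>y. h y * tensor (\<lambda>j. D j (n j)) y \<partial>lebesgue_on (ocube (2*L)))"
    if h: "h \<in> l2 (lebesgue_on (ocube (2*L)))" for h :: "real^'d \<Rightarrow> real" and n
  proof -
    have "(\<integral>y. per_ext L h y * tensor (\<lambda>j. E j (n j)) y \<partial>lebesgue_on (ocube (4*L)))
      = (\<integral>y. h y * tensor (\<lambda>j t. \<Sum>m\<in>{-1,0,1::int}. E j (n j) (t + 4 * L * of_int m)) y \<partial>lebesgue_on (ocube (2*L)))"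
      by (rule per_ext_tensor_integral[OF L h smooth_jet_continuous[OF Es] Ez])
    also have "\<dots> = (\<integral>y. h y * tensor (\<lambda>j. D j (n j)) y \<partial>lebesgue_on (ocube (2*L)))"
    proof (rule Bochner_Integration.integral_cong[OF refl])
      fix y :: "real^'d" assume "y \<in> space (lebesgue_on (ocube (2*L)))"
      then have "\<bar>y $ j\<bar> < 2*L" for j by (simp add: space_restrict_space ocube_def)
      then show "h y * tensor (\<lambda>j t. \<Sum>m\<in>{-1,0,1::int}. E j (n j) (t + 4 * L * of_int m)) y = h y * tensor (\<lambda>j. D j (n j)) y"
        unfolding tensor_def by (simp only: per)
    qed
    finally show ?thesis .
  qed
  have fl: "f \<in> l2 (lebesgue_on (ocube (2*L)))" by (rule Hper_l2[OF f])
  have g: "?g \<in> l2 (lebesgue_on (ocube (2*L)))" "is_weak_deriv (ocube (2*L)) ?\<alpha> f ?g"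
    using wderiv_Hper[OF L f, of ?\<alpha>] by (simp_all add: mi_order_pure_index)
  have w: "is_weak_deriv (ocube (4*L)) ?\<alpha> (per_ext L f) (per_ext L ?g)"
    using is_weak_deriv_per_ext[OF L f _ g] by (simp add: mi_order_pure_index)
  have "test_fun (ocube (4*L)) (tensor (\<lambda>j. E j 0))"
  proof (rule test_fun_tensor[where a="\<chi> j. -(3*L)" and b="\<chi> j. 3*L", OF Es])
    show "cbox (\<chi> j. - (3 * L)) (\<chi> j. 3 * L) \<subseteq> ocube (4 * L)"
      using L unfolding ocube_eq_box by (auto simp: mem_box_cart) (smt (verit))+
  qed (use E0 in auto)
  moreover have "realises (replicate s i) ?\<alpha>" by (simp add: realises_def pure_index_def)
  ultimately have "(\<integral>y. per_ext L f y * dpartials (replicate s i) (tensor (\<lambda>j. E j 0)) y \<partial>lebesgue_on (ocube (4*L)))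
      = (- 1) ^ s * (\<integral>y. per_ext L ?g y * tensor (\<lambda>j. E j 0) y \<partial>lebesgue_on (ocube (4*L)))"
    using w unfolding is_weak_deriv_def mi_order_pure_index by blast
  also have "dpartials (replicate s i) (tensor (\<lambda>j. E j 0)) = tensor (\<lambda>j. E j (?\<alpha> j))"
    unfolding dpartials_tensor[OF Es] by (simp add: pure_index_def eq_commute)
  finally have main: "(\<integral>y. f y * tensor (\<lambda>j. D j (?\<alpha> j)) y \<partial>lebesgue_on (ocube (2*L)))
      = (- 1) ^ s * (\<integral>y. ?g y * tensor (\<lambda>j. D j 0) y \<partial>lebesgue_on (ocube (2*L)))"
    unfolding unfold[OF fl] unfold[OF g(1)] .
  have t0: "tensor (\<lambda>j. D j 0) = wave L x \<theta> k"
    by (rule ext) (simp add: wave_def tensor_def D_def cos_jet_def \<beta>_def)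
  have t1: "tensor (\<lambda>j. D j (?\<alpha> j)) y = (- \<beta> i) ^ s * wave L x (\<lambda>_. 0) k y" for y
  proof -
    have "D j (?\<alpha> j) t = (if j = i then (- \<beta> i) ^ s else 1) * cos (\<beta> j * (x $ j - t))" for j t
      by (simp add: D_def cos_jet_def \<theta>_def pure_index_def)
    then show ?thesis
      unfolding tensor_def wave_def by (simp add: prod.distrib \<beta>_def)
  qed
  have "(- \<beta> i) ^ s * (\<integral>y. f y * wave L x (\<lambda>_. 0) k y \<partial>lebesgue_on (ocube (2*L)))
     = (- 1) ^ s * (\<integral>y. ?g y * wave L x \<theta> k y \<partial>lebesgue_on (ocube (2*L)))"
    using main unfolding t0 t1 mult.left_commute[of "f _"] integral_mult_right_zero .
  \<comment> \<open>The sign from s integrations by parts cancels against the sign of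
    differentiating a function of x - t.\<close>
  then have "(- 1) ^ s * ((\<beta> i) ^ s * (\<integral>y. f y * wave L x (\<lambda>_. 0) k y \<partial>lebesgue_on (ocube (2*L))))
     = (- 1) ^ s * (\<integral>y. ?g y * wave L x \<theta> k y \<partial>lebesgue_on (ocube (2*L)))"
    by (simp add: power_minus[of "\<beta> i"])
  then show ?thesis unfolding \<beta>_def \<theta>_def[abs_def] by simp
qed

section \<open>Sobolev embedding\<close>

lemma Fejer_product_expansion:
  fixes x :: "real^'d::finite"
  shows "tensor (\<lambda>i t. Fejer L N (x $ i - t)) y
    = (\<Sum>k\<in>PiE UNIV (\<lambda>_. {..N}). (\<Prod>i\<in>UNIV. Fejer_weight L N (k i)) * wave L x (\<lambda>_. 0) k y)"
proof -
  have "tensor (\<lambda>i t. Fejer L N (x $ i - t)) y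
    = (\<Sum>k\<in>PiE UNIV (\<lambda>_. {..N}). \<Prod>i\<in>UNIV. Fejer_weight L N (k i) * cos (pi / (2*L) * real (k i) * (x $ i - y $ i)))"
    unfolding tensor_def Fejer_def by (rule prod_sum_PiE) auto
  then show ?thesis by (simp add: prod.distrib wave_def tensor_def)
qed

lemma Fejer_product_l2: "tensor (\<lambda>i t. Fejer L N (x $ i - t)) \<in> l2 (lebesgue_on (ocube r))"
  by (intro tensor_l2 continuous_on_Fejer)

lemma integral_Fejer_product_mult_wave:
  fixes x :: "real^'d::finite"
  assumes L: "L > 0"
  shows "(\<integral>y. tensor (\<lambda>i t. Fejer L N (x $ i - t)) y * wave L x (\<lambda>_. 0) l y \<partial>lebesgue_on (ocube (2*L)))
     = (\<Prod>i\<in>UNIV. if l i > N then 0 else if l i = 0 then 1 else 1 - real (l i) / real (Suc N))"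
proof -
  have "(\<integral>y. tensor (\<lambda>i t. Fejer L N (x $ i - t)) y * wave L x (\<lambda>_. 0) l y \<partial>lebesgue_on (ocube (2*L)))
     = (\<Prod>i\<in>UNIV. integral {-(2*L)..2*L} (\<lambda>t. Fejer L N (x $ i - t) * cos (pi / (2*L) * real (l i) * (x $ i - t) + 0)))"
    unfolding wave_def tensor_mult
    by (rule integral_tensor) (intro continuous_on_mult continuous_on_Fejer continuous_on_cos_affine)
  also have "\<dots> = (\<Prod>i\<in>UNIV. if l i > N then 0 else if l i = 0 then 1 else 1 - real (l i) / real (Suc N))"
  proof (rule prod.cong[OF refl])
    fix i
    have "-(2*L) = -2*L" by simp
    then show "integral {-(2*L)..2*L} (\<lambda>t. Fejer L N (x $ i - t) * cos (pi / (2*L) * real (l i) * (x $ i - t) + 0))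
       = (if l i > N then 0 else if l i = 0 then 1 else 1 - real (l i) / real (Suc N))"
      using integral_Fejer_mult_cos[OF L, of N "x $ i" "l i"] by (simp only: add_0_right)
  qed
  finally show ?thesis .
qed

lemma wave_pure_index:
  fixes x :: "real^'d::finite"
  shows "wave L x (\<lambda>_. 0) (pure_index 1 i) y = cos (pi / (2*L) * (x $ i - y $ i))"
proof -
  have "wave L x (\<lambda>_. 0) (pure_index 1 i) y = (\<Prod>j\<in>UNIV. if j = i then cos (pi / (2*L) * (x $ i - y $ i)) else 1)"
    unfolding wave_def tensor_def pure_index_def by (intro prod.cong) auto
  then show ?thesis by simp
qed

lemma wave_zero: "wave L x (\<lambda>_. 0) (\<lambda>_. 0) y = 1"
  by (simp add: wave_def tensor_def)

text \<open>On the closed cube the sum of the terms 1 - cos vanishes only at y = x. This uses that x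
  is interior: then |x_i - y_i| < 4L excludes a full period, whereas for x on a face a point of the
  opposite face would be a further zero. Compactness bounds the sum from below off a ball around
  x.\<close>

lemma Korovkin_bound:
  fixes f :: "real^'d::finite \<Rightarrow> real"
  assumes L: "L > 0" and f: "continuous_on (ccube (2*L)) f" and x: "x \<in> ocube (2*L)" and e: "e > 0"
  obtains M where "M \<ge> 0"
    "\<And>y. y \<in> ccube (2*L) \<Longrightarrow> \<bar>f y - f x\<bar> \<le> e + M * (\<Sum>i\<in>UNIV. 1 - cos (pi / (2*L) * (x $ i - y $ i)))"
proof -
  define Q where "Q y = (\<Sum>i\<in>UNIV. 1 - cos (pi / (2*L) * (x $ i - y $ i)))" for y :: "real^'d"
  have Q0: "Q y \<ge> 0" for y unfolding Q_def by (intro sum_nonneg) simp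
  have xc: "x \<in> ccube (2*L)" using x by (auto simp: ocube_def ccube_def less_imp_le)
  have pos: "Q y > 0" if y: "y \<in> ccube (2*L)" and ne: "y \<noteq> x" for y
  proof -
    obtain i where i: "y $ i \<noteq> x $ i" using ne by (auto simp: vec_eq_iff)
    have "\<bar>x $ i\<bar> < 2*L" "\<bar>y $ i\<bar> \<le> 2*L" using x y by (auto simp: ocube_def ccube_def)
    then have d: "\<bar>x $ i - y $ i\<bar> < 4*L" by linarith
    have "cos (pi / (2*L) * (x $ i - y $ i)) \<noteq> 1"
    proof
      assume "cos (pi / (2*L) * (x $ i - y $ i)) = 1"
      then obtain n :: int where "pi / (2*L) * (x $ i - y $ i) = of_int n * 2 * pi"
        by (auto simp: cos_one_2pi_int)
      then have "pi * (x $ i - y $ i) = pi * (4 * L * of_int n)" using L by (simp add: field_simps)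
      then have n: "x $ i - y $ i = 4 * L * of_int n" by (simp only: mult_cancel_left) simp
      then have "4 * L * \<bar>of_int n\<bar> < 4 * L * (1::real)" using d L by (simp add: abs_mult)
      then have "\<bar>of_int n :: real\<bar> < 1" using L by (simp only: mult_less_cancel_left_pos)
      then have "n = 0" by linarith
      then show False using n i by simp
    qed
    then have "0 < 1 - cos (pi / (2*L) * (x $ i - y $ i))"
      using cos_le_one[of "pi / (2*L) * (x $ i - y $ i)"] by linarith
    then show ?thesis unfolding Q_def by (intro sum_pos2[of UNIV i]) auto
  qed
  obtain \<delta> where \<delta>: "\<delta> > 0" and near: "\<And>y. y \<in> ccube (2*L) \<Longrightarrow> dist y x < \<delta> \<Longrightarrow> \<bar>f y - f x\<bar> < e"
    using f xc e unfolding continuous_on_iff dist_real_def by metis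
  define K where "K = ccube (2*L) \<inter> - ball x \<delta>"
  have K: "compact K" unfolding K_def ccube_eq_cbox by (intro compact_Int_closed) auto
  have Qc: "continuous_on K Q" unfolding Q_def by (intro continuous_intros) (use L in auto)
  have cc: "compact (ccube (2*L) :: (real^'d) set)" by (simp add: ccube_eq_cbox)
  obtain B where B: "\<And>y. y \<in> ccube (2*L) \<Longrightarrow> \<bar>f y\<bar> \<le> B"
    using compact_imp_bounded[OF compact_continuous_image[OF f cc]] by (auto simp: bounded_iff)
  have B0: "B \<ge> 0" using B[OF xc] by linarith
  have "\<exists>m>0. \<forall>y\<in>K. m \<le> Q y"
  proof (cases "K = {}")
    case False
    then obtain y0 where y0: "y0 \<in> K" "\<forall>y\<in>K. Q y0 \<le> Q y" using continuous_attains_inf[OF K False Qc] by blast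
    then have "Q y0 > 0" using \<delta> by (intro pos) (auto simp: K_def)
    then show ?thesis using y0 by blast
  qed (auto intro: exI[of _ 1])
  then obtain m where m: "m > 0" "\<And>y. y \<in> K \<Longrightarrow> m \<le> Q y" by blast
  show ?thesis
  proof
    \<comment> \<open>Off the ball |f y - f x| is at most 2 B and the sum is at least m; their ratio
      is the constant.\<close>
    show "2 * B / m \<ge> 0" using B0 m by simp
    fix y :: "real^'d" assume y: "y \<in> ccube (2*L)"
    show "\<bar>f y - f x\<bar> \<le> e + 2 * B / m * (\<Sum>i\<in>UNIV. 1 - cos (pi / (2*L) * (x $ i - y $ i)))"
      unfolding Q_def[symmetric]
    proof (cases "dist y x < \<delta>")
      case True
      have "0 \<le> 2 * B / m * Q y" using B0 m Q0 by simp
      then show "\<bar>f y - f x\<bar> \<le> e + 2 * B / m * Q y" using near[OF y True] by linarith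
    next
      case False
      then have "y \<in> K" using y by (auto simp: K_def dist_commute)
      then have "2 * B / m * m \<le> 2 * B / m * Q y" using m B0 by (intro mult_left_mono) auto
      then have "2 * B \<le> 2 * B / m * Q y" using m by simp
      moreover have "\<bar>f y - f x\<bar> \<le> 2 * B" using B[OF y] B[OF xc] by linarith
      ultimately show "\<bar>f y - f x\<bar> \<le> e + 2 * B / m * Q y" using e by linarith
    qed
  qed
qed

text \<open>Korovkin's argument: for nonnegative kernels of mass 1 the error is controlled by the
  integrals of 1 - cos in each coordinate, which are of size 1/(N + 1).\<close>

lemma Fejer_approximation:
  fixes f :: "real^'d::finite \<Rightarrow> real"
  assumes L: "L > 0" and f: "continuous_on (ccube (2*L)) f" and fl: "f \<in> l2 (lebesgue_on (ocube (2*L)))"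
    and x: "x \<in> ocube (2*L)"
  shows "(\<lambda>N. \<integral>y. f y * tensor (\<lambda>i t. Fejer L N (x $ i - t)) y \<partial>lebesgue_on (ocube (2*L))) \<longlonglongrightarrow> f x"
proof -
  let ?M = "lebesgue_on (ocube (2*L)) :: (real^'d) measure"
  define P where "P N = tensor (\<lambda>i t. Fejer L N (x $ i - t))" for N
  define W where "W i = wave L x (\<lambda>_. 0) (pure_index 1 i)" for i
  interpret semi_inner "l2 ?M" "\<lambda>f g. \<integral>y. f y * g y \<partial>?M" by (rule semi_inner_l2)
  have Pl: "P N \<in> l2 ?M" for N unfolding P_def by (rule Fejer_product_l2)
  have P0: "P N y \<ge> 0" for N y unfolding P_def tensor_def by (intro prod_nonneg Fejer_nonneg L ballI)
  have one: "(\<lambda>y. 1) \<in> l2 ?M" using wave_l2[of L x "\<lambda>_. 0" "\<lambda>_. 0" "2*L"] by (simp add: wave_zero[abs_def])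
  have Wl: "W i \<in> l2 ?M" for i unfolding W_def by (rule wave_l2)
  have mass: "(\<integral>y. 1 * P N y \<partial>?M) = 1" for N
    using integral_Fejer_product_mult_wave[OF L, of N x "\<lambda>_. 0"] by (simp add: wave_zero P_def)
  have WP: "(\<integral>y. W i y * P N y \<partial>?M) = 1 - 1 / real (Suc N)" if "N \<ge> 1" for i N
  proof -
    have "(\<integral>y. W i y * P N y \<partial>?M) = (\<integral>y. P N y * W i y \<partial>?M)" by (simp only: mult.commute)
    also have "\<dots> = (\<Prod>j\<in>UNIV. if pure_index 1 i j > N then 0 else if pure_index 1 i j = 0 then 1
        else 1 - real (pure_index 1 i j) / real (Suc N))"
      unfolding W_def P_def by (rule integral_Fejer_product_mult_wave[OF L])
    also have "\<dots> = (\<Prod>j\<in>UNIV. if j = i then 1 - 1 / real (Suc N) else 1)"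
      using that by (intro prod.cong refl) (simp add: pure_index_def)
    finally show ?thesis by simp
  qed
  have est: "\<exists>M\<ge>0. \<forall>N\<ge>1. \<bar>(\<integral>y. f y * P N y \<partial>?M) - f x\<bar> \<le> e + M / real (Suc N)" if e: "e > 0" for e
  proof -
    obtain M where M: "M \<ge> 0"
      "\<And>y. y \<in> ccube (2*L) \<Longrightarrow> \<bar>f y - f x\<bar> \<le> e + M * (\<Sum>i\<in>UNIV. 1 - cos (pi / (2*L) * (x $ i - y $ i)))"
      using Korovkin_bound[OF L f x e] by blast
    have "\<bar>(\<integral>y. f y * P N y \<partial>?M) - f x\<bar> \<le> e + (M * CARD('d)) / real (Suc N)" if N: "N \<ge> 1" for N
    proof -
      define G where "G = (\<lambda>y. (e + M * CARD('d)) * 1 + (- M) * (\<Sum>i\<in>UNIV. 1 * W i y))"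
      have sW: "(\<lambda>y. \<Sum>i\<in>UNIV. 1 * W i y) \<in> l2 ?M" by (intro sum_mem Wl) simp
      have Gl: "G \<in> l2 ?M" unfolding G_def by (intro lin_mem one sW)
      have GI: "(\<integral>y. G y * P N y \<partial>?M) = e + (M * CARD('d)) / real (Suc N)"
      proof -
        have "(\<integral>y. G y * P N y \<partial>?M) = (e + M * CARD('d)) * (\<integral>y. 1 * P N y \<partial>?M) + (- M) * (\<integral>y. (\<Sum>i\<in>UNIV. 1 * W i y) * P N y \<partial>?M)"
          unfolding G_def by (rule lin[OF one sW Pl])
        also have "(\<integral>y. (\<Sum>i\<in>UNIV. 1 * W i y) * P N y \<partial>?M) = (\<Sum>i\<in>UNIV. 1 * (\<integral>y. W i y * P N y \<partial>?M))"
          by (rule sum_left) (auto intro: Wl Pl)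
        also have "\<dots> = CARD('d) * (1 - 1 / real (Suc N))" by (simp only: WP[OF N]) simp
        finally show ?thesis unfolding mass by (simp add: algebra_simps)
      qed
      have dl: "(\<lambda>y. 1 * f y + (- f x) * 1) \<in> l2 ?M" by (intro lin_mem fl one)
      have di: "integrable ?M (\<lambda>y. (1 * f y + (- f x) * 1) * P N y)" by (rule l2_product_integrable[OF dl Pl])
      have "(\<integral>y. f y * P N y \<partial>?M) - f x = (\<integral>y. (1 * f y + (- f x) * 1) * P N y \<partial>?M)"
        using lin[OF fl one Pl, of 1 "- f x" N] mass[of N] by simp
      also have "\<bar>\<dots>\<bar> \<le> (\<integral>y. \<bar>(1 * f y + (- f x) * 1) * P N y\<bar> \<partial>?M)" by (rule integral_abs_bound)
      also have "\<dots> \<le> (\<integral>y. G y * P N y \<partial>?M)"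
      proof (rule integral_mono)
        show "integrable ?M (\<lambda>y. \<bar>(1 * f y + (- f x) * 1) * P N y\<bar>)" using di by simp
        show "integrable ?M (\<lambda>y. G y * P N y)" by (rule l2_product_integrable[OF Gl Pl])
        fix y assume "y \<in> space ?M"
        then have "y \<in> ccube (2*L)" by (auto simp: space_restrict_space ocube_def ccube_def less_imp_le)
        then have "\<bar>f y - f x\<bar> \<le> G y"
          using M(2)[of y] unfolding G_def W_def wave_pure_index by (simp add: sum_subtractf algebra_simps)
        then show "\<bar>(1 * f y + (- f x) * 1) * P N y\<bar> \<le> G y * P N y"
          using P0[of N y] by (simp add: abs_mult mult_right_mono)
      qed
      finally show ?thesis using GI by simp
    qed
    then show ?thesis using M(1) by (intro exI[of _ "M * CARD('d)"]) auto
  qed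
  show ?thesis unfolding P_def[symmetric]
  proof (rule LIMSEQ_I)
    fix r :: real assume r: "r > 0"
    obtain M where M: "M \<ge> 0" "\<And>N. N \<ge> 1 \<Longrightarrow> \<bar>(\<integral>y. f y * P N y \<partial>?M) - f x\<bar> \<le> r/2 + M / real (Suc N)"
      using est[of "r/2"] r by auto
    obtain n where n: "M / real (Suc n) < r/2"
    proof -
      obtain n :: nat where "2 * M / r < real n" using reals_Archimedean2 by blast
      then have "M / real (Suc n) < r/2" using r M by (simp add: field_simps)
      then show ?thesis by (rule that)
    qed
    have "norm ((\<integral>y. f y * P N y \<partial>?M) - f x) < r" if N: "N \<ge> max 1 n" for N
    proof -
      have "M / real (Suc N) \<le> M / real (Suc n)" using N M(1) by (intro divide_left_mono) auto
      moreover have "N \<ge> 1" using N by simp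
      ultimately show ?thesis using M(2)[of N] n unfolding real_norm_def by linarith
    qed
    then show "\<exists>no. \<forall>N\<ge>no. norm ((\<integral>y. f y * P N y \<partial>?M) - f x) < r" by blast
  qed
qed

section \<open>Bessel's inequality, the lattice sum and the pointwise bound\<close>

lemma wave_Bessel:
  fixes f :: "real^'d::finite \<Rightarrow> real"
  assumes L: "L > 0" and f: "f \<in> l2 (lebesgue_on (ocube (2*L)))" and K: "finite K"
  shows "(\<Sum>k\<in>K. (\<integral>y. f y * wave L x \<theta> k y \<partial>lebesgue_on (ocube (2*L)))\<^sup>2)
     \<le> (4*L) ^ CARD('d) * (\<integral>y. (f y)\<^sup>2 \<partial>lebesgue_on (ocube (2*L)))"
proof -
  interpret semi_inner "l2 (lebesgue_on (ocube (2*L)))" "\<lambda>f g. \<integral>y. f y * g y \<partial>lebesgue_on (ocube (2*L)) :: real"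
    by (rule semi_inner_l2)
  have "(\<Sum>k\<in>K. (\<integral>y. f y * wave L x \<theta> k y \<partial>lebesgue_on (ocube (2*L)))\<^sup>2)
     \<le> (4*L) ^ CARD('d) * (\<integral>y. f y * f y \<partial>lebesgue_on (ocube (2*L)))"
    by (rule Bessel_orthogonal[OF K wave_l2 f]) (use L wave_orthogonal[OF L] wave_norm[OF L] in auto)
  then show ?thesis by (simp add: power2_eq_square)
qed

text \<open>Every factor \<open>max 1 (\<omega> * k i) ^ (2 * s)\<close> is at most the denominator, hence so is their
  geometric mean; the resulting product bound sums coordinatewise because \<open>2 s / d > 1\<close>.\<close>

lemma lattice_sum_bounded:
  assumes s: "real s > real CARD('d::finite) / 2" and \<omega>: "\<omega> > 0"
  obtains Z where "Z \<ge> 0"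
    "\<And>N. (\<Sum>k\<in>PiE (UNIV :: 'd set) (\<lambda>_. {..N}). 1 / (1 + (\<Sum>i\<in>UNIV. (\<omega> * real (k i)) ^ (2 * s)))) \<le> Z"
proof -
  define d where "d = real CARD('d)"
  have d: "d > 0" by (simp add: d_def)
  \<comment> \<open>The maximum with 1 handles a zero coordinate: \<open>0 powr (- 1 / d)\<close> is
    0 in HOL, which would break the product bound. The exponent -1/d shares the denominator evenly
    among the coordinates.\<close>
  define q where "q n = ((max 1 (\<omega> * real n)) ^ (2 * s)) powr (- 1 / d)" for n :: nat
  have q0: "q n \<ge> 0" for n by (simp add: q_def)
  have "summable q"
  proof (rule summable_comparison_test')
    show "summable (\<lambda>n. \<omega> powr (- (2 * real s / d)) * real n powr (- (2 * real s / d)))"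
      using s d by (intro summable_mult) (simp add: summable_real_powr_iff d_def field_simps)
    fix n :: nat assume n: "n \<ge> 1"
    have "q n \<le> ((\<omega> * real n) ^ (2 * s)) powr (- 1 / d)"
      unfolding q_def using n \<omega> d by (intro powr_mono2' power_mono) auto
    also have "\<dots> = (\<omega> * real n) powr (- (2 * real s / d))"
      using n \<omega> by (simp add: powr_realpow[symmetric] powr_powr)
    also have "\<dots> = \<omega> powr (- (2 * real s / d)) * real n powr (- (2 * real s / d))"
      using n \<omega> by (simp add: powr_mult)
    finally show "norm (q n) \<le> \<omega> powr (- (2 * real s / d)) * real n powr (- (2 * real s / d))" using q0 by simp
  qed
  have key: "1 / (1 + (\<Sum>i\<in>UNIV. (\<omega> * real (k i)) ^ (2 * s))) \<le> (\<Prod>i\<in>UNIV. q (k i))" for k :: "'d \<Rightarrow> nat"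
  proof -
    define m where "m = 1 + (\<Sum>i\<in>UNIV. (\<omega> * real (k i)) ^ (2 * s))"
    have nn: "0 \<le> (\<omega> * real (k i)) ^ (2 * s)" for i using \<omega> by simp
    have m1: "m \<ge> 1" unfolding m_def using nn by (simp add: sum_nonneg)
    define b where "b i = max 1 (\<omega> * real (k i)) ^ (2 * s)" for i
    have b1: "b i \<ge> 1" for i unfolding b_def by (rule one_le_power) simp
    have bm: "b i \<le> m" for i
    proof -
      have "(\<omega> * real (k i)) ^ (2 * s) \<le> (\<Sum>i\<in>UNIV. (\<omega> * real (k i)) ^ (2 * s))"
        by (rule member_le_sum) (use nn in auto)
      then show ?thesis using m1 unfolding b_def m_def by (simp add: max_def)
    qed
    have "m powr (- 1) = (m powr (- 1 / d)) ^ CARD('d)"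
      using m1 d by (simp add: powr_realpow[symmetric] powr_powr d_def)
    also have "\<dots> = (\<Prod>i\<in>(UNIV :: 'd set). m powr (- 1 / d))" by simp
    also have "\<dots> \<le> (\<Prod>i\<in>UNIV. b i powr (- 1 / d))"
    proof (intro prod_mono conjI)
      fix i
      show "m powr (- 1 / d) \<le> b i powr (- 1 / d)"
        using b1[of i] bm[of i] d by (intro powr_mono2') auto
    qed simp
    also have "\<dots> = (\<Prod>i\<in>UNIV. q (k i))" by (simp add: b_def q_def)
    finally show ?thesis using m1 unfolding m_def[symmetric] by (simp add: powr_minus powr_one inverse_eq_divide)
  qed
  show ?thesis
  proof
    show "(suminf q) ^ CARD('d) \<ge> 0" using suminf_nonneg[OF \<open>summable q\<close> q0] by simp
    fix N
    have "(\<Sum>k\<in>PiE (UNIV :: 'd set) (\<lambda>_. {..N}). 1 / (1 + (\<Sum>i\<in>UNIV. (\<omega> * real (k i)) ^ (2 * s))))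
       \<le> (\<Sum>k\<in>PiE (UNIV :: 'd set) (\<lambda>_. {..N}). \<Prod>i\<in>UNIV. q (k i))" by (intro sum_mono key)
    also have "\<dots> = (\<Prod>i\<in>(UNIV :: 'd set). \<Sum>n\<le>N. q n)" by (rule prod_sum_PiE[symmetric]) auto
    also have "\<dots> = (\<Sum>n\<le>N. q n) ^ CARD('d)" by simp
    also have "\<dots> \<le> (suminf q) ^ CARD('d)"
      by (intro power_mono sum_le_suminf \<open>summable q\<close> sum_nonneg) (auto simp: q0)
    finally show "(\<Sum>k\<in>PiE (UNIV :: 'd set) (\<lambda>_. {..N}). 1 / (1 + (\<Sum>i\<in>UNIV. (\<omega> * real (k i)) ^ (2 * s)))) \<le> (suminf q) ^ CARD('d)" .
  qed
qed

text \<open>Working with Fejer means avoids any question of pointwise convergence of the Fourier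
  series: Cauchy-Schwarz with the weights \<open>m k\<close> bounds the means uniformly in N, and
  the bound passes to their limit \<open>f x\<close>.\<close>

lemma Sobolev_embedding_interior:
  assumes L: "L > 0" and s: "real s > real CARD('d::finite) / 2"
  obtains C where "C \<ge> 0"
    "\<And>(f :: real^'d \<Rightarrow> real) x. f \<in> Hper L s \<Longrightarrow> x \<in> ocube (2*L) \<Longrightarrow>
       (f x)\<^sup>2 \<le> C * ((\<integral>y. (f y)\<^sup>2 \<partial>lebesgue_on (ocube (2*L)))
                  + (\<Sum>i\<in>UNIV. \<integral>y. (wderiv L (pure_index s i) f y)\<^sup>2 \<partial>lebesgue_on (ocube (2*L))))"
proof -
  define \<omega> where "\<omega> = pi / (2*L)"
  have \<omega>: "\<omega> > 0" using L by (simp add: \<omega>_def)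
  obtain Z where Z: "Z \<ge> 0"
    "\<And>N. (\<Sum>k\<in>PiE (UNIV :: 'd set) (\<lambda>_. {..N}). 1 / (1 + (\<Sum>i\<in>UNIV. (\<omega> * real (k i)) ^ (2 * s)))) \<le> Z"
    using lattice_sum_bounded[OF s \<omega>] by blast
  \<comment> \<open>\<open>A\<close> bounds the squared norm of a wave and \<open>w\<close>, defined
    next, a product of Fejer weights; together with the lattice sum \<open>Z\<close> they form the
    constant.\<close>
  define A where "A = (4*L) ^ CARD('d)"
  define w where "w = (1 / (2*L)) ^ CARD('d)"
  have A: "A \<ge> 0" and w: "w \<ge> 0" using L by (auto simp: A_def w_def)
  show ?thesis
  proof
    show "w\<^sup>2 * Z * A \<ge> 0" using A Z by simp
    fix f :: "real^'d \<Rightarrow> real" and x :: "real^'d"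
    assume f: "f \<in> Hper L s" and x: "x \<in> ocube (2*L)"
    let ?M = "lebesgue_on (ocube (2*L)) :: (real^'d) measure"
    interpret semi_inner "l2 ?M" "\<lambda>f g. \<integral>y. f y * g y \<partial>?M" by (rule semi_inner_l2)
    define S where "S = (\<integral>y. (f y)\<^sup>2 \<partial>?M) + (\<Sum>i\<in>UNIV. \<integral>y. (wderiv L (pure_index s i) f y)\<^sup>2 \<partial>?M)"
    have fl: "f \<in> l2 ?M" by (rule Hper_l2[OF f])
    have fc: "continuous_on (ccube (2*L)) f" using f by (simp add: Hper_def)
    define c where "c k = (\<integral>y. f y * wave L x (\<lambda>_. 0) k y \<partial>?M)" for k
    define m where "m k = 1 + (\<Sum>i\<in>UNIV. (\<omega> * real (k i)) ^ (2 * s))" for k :: "'d \<Rightarrow> nat"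
    have m1: "m k \<ge> 1" for k unfolding m_def using \<omega> by (simp add: sum_nonneg)
    have bound: "(\<integral>y. f y * tensor (\<lambda>i t. Fejer L N (x $ i - t)) y \<partial>?M)\<^sup>2 \<le> w\<^sup>2 * Z * A * S" for N
    proof -
      let ?K = "PiE (UNIV :: 'd set) (\<lambda>_. {..N})"
      have K: "finite ?K" by (intro finite_PiE) auto
      define u where "u k = (\<Prod>i\<in>UNIV. Fejer_weight L N (k i))" for k :: "'d \<Rightarrow> nat"
      have u: "\<bar>u k\<bar> \<le> w" if "k \<in> ?K" for k
      proof -
        have "\<bar>u k\<bar> = (\<Prod>i\<in>UNIV. \<bar>Fejer_weight L N (k i)\<bar>)" unfolding u_def by (rule abs_prod)
        also have "\<dots> \<le> (\<Prod>i\<in>(UNIV :: 'd set). 1 / (2*L))"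
          using that by (intro prod_mono conjI Fejer_weight_bound L) auto
        finally show ?thesis by (simp add: w_def)
      qed
      have "(\<integral>y. f y * tensor (\<lambda>i t. Fejer L N (x $ i - t)) y \<partial>?M) = (\<Sum>k\<in>?K. u k * c k)"
        unfolding Fejer_product_expansion u_def[symmetric] c_def by (rule sum_right[OF K wave_l2 fl])
      also have "(\<Sum>k\<in>?K. u k * c k)\<^sup>2 = (\<Sum>k\<in>?K. (u k / sqrt (m k)) * (sqrt (m k) * c k))\<^sup>2"
        using m1 by (intro arg_cong[where f="\<lambda>r. r\<^sup>2"] sum.cong refl) (smt (verit) nonzero_mult_div_cancel_left real_sqrt_gt_zero times_divide_eq_left mult.assoc mult.commute)
      also have "\<dots> \<le> (\<Sum>k\<in>?K. (u k / sqrt (m k))\<^sup>2) * (\<Sum>k\<in>?K. (sqrt (m k) * c k)\<^sup>2)"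
        by (rule Cauchy_Schwarz_ineq_sum)
      also have "\<dots> \<le> (w\<^sup>2 * Z) * (A * S)"
      proof (rule mult_mono)
        have "(\<Sum>k\<in>?K. (u k / sqrt (m k))\<^sup>2) \<le> (\<Sum>k\<in>?K. w\<^sup>2 * (1 / m k))"
        proof (rule sum_mono)
          fix k assume "k \<in> ?K"
          then have "(u k)\<^sup>2 \<le> w\<^sup>2" using u[of k] w by (simp add: abs_le_square_iff[symmetric])
          then have "(u k)\<^sup>2 / m k \<le> w\<^sup>2 / m k" using m1[of k] by (intro divide_right_mono) auto
          then show "(u k / sqrt (m k))\<^sup>2 \<le> w\<^sup>2 * (1 / m k)" using m1[of k] by (simp add: power_divide)
        qed
        also have "\<dots> = w\<^sup>2 * (\<Sum>k\<in>?K. 1 / m k)" by (rule sum_distrib_left[symmetric])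
        also have "\<dots> \<le> w\<^sup>2 * Z" using Z(2)[of N] unfolding m_def by (intro mult_left_mono) auto
        finally show "(\<Sum>k\<in>?K. (u k / sqrt (m k))\<^sup>2) \<le> w\<^sup>2 * Z" .
        have "(\<Sum>k\<in>?K. (sqrt (m k) * c k)\<^sup>2) = (\<Sum>k\<in>?K. (c k)\<^sup>2 + (\<Sum>i\<in>UNIV. ((\<omega> * real (k i)) ^ s * c k)\<^sup>2))"
        proof (rule sum.cong[OF refl])
          fix k
          have "(sqrt (m k) * c k)\<^sup>2 = m k * (c k)\<^sup>2" using m1[of k] by (simp add: power_mult_distrib)
          also have "\<dots> = (c k)\<^sup>2 + (\<Sum>i\<in>UNIV. (\<omega> * real (k i)) ^ (2 * s) * (c k)\<^sup>2)"
            by (simp add: m_def distrib_right sum_distrib_right)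
          also have "(\<Sum>i\<in>UNIV. (\<omega> * real (k i)) ^ (2 * s) * (c k)\<^sup>2) = (\<Sum>i\<in>UNIV. ((\<omega> * real (k i)) ^ s * c k)\<^sup>2)"
            by (simp add: power_mult_distrib power_even_eq power_mult[symmetric] mult.commute)
          finally show "(sqrt (m k) * c k)\<^sup>2 = (c k)\<^sup>2 + (\<Sum>i\<in>UNIV. ((\<omega> * real (k i)) ^ s * c k)\<^sup>2)" .
        qed
        also have "\<dots> = (\<Sum>k\<in>?K. (c k)\<^sup>2) + (\<Sum>i\<in>UNIV. \<Sum>k\<in>?K. ((\<omega> * real (k i)) ^ s * c k)\<^sup>2)"
          unfolding sum.distrib by (subst sum.swap) simp
        also have "\<dots> \<le> A * (\<integral>y. (f y)\<^sup>2 \<partial>?M) + (\<Sum>i\<in>UNIV. A * (\<integral>y. (wderiv L (pure_index s i) f y)\<^sup>2 \<partial>?M))"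
        proof (intro add_mono sum_mono)
          show "(\<Sum>k\<in>?K. (c k)\<^sup>2) \<le> A * (\<integral>y. (f y)\<^sup>2 \<partial>?M)"
            unfolding c_def A_def by (rule wave_Bessel[OF L fl K])
          fix i
          have gl: "wderiv L (pure_index s i) f \<in> l2 ?M" by (rule wderiv_Hper[OF L f]) (simp add: mi_order_pure_index)
          \<comment> \<open>The factor (\<omega> k_i)^s turns coefficients of f into coefficients of
            its pure derivative, against waves with a shifted phase; these are orthogonal as
            well.\<close>
          show "(\<Sum>k\<in>?K. ((\<omega> * real (k i)) ^ s * c k)\<^sup>2) \<le> A * (\<integral>y. (wderiv L (pure_index s i) f y)\<^sup>2 \<partial>?M)"
            unfolding c_def \<omega>_def wave_coefficient_deriv[OF L f] A_def by (rule wave_Bessel[OF L gl K])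
        qed
        also have "\<dots> = A * S" by (simp add: S_def distrib_left sum_distrib_left)
        finally show "(\<Sum>k\<in>?K. (sqrt (m k) * c k)\<^sup>2) \<le> A * S" .
      qed (use Z w in \<open>auto intro!: sum_nonneg\<close>)
      finally show ?thesis by (simp add: mult.assoc)
    qed
    have "(\<lambda>N. (\<integral>y. f y * tensor (\<lambda>i t. Fejer L N (x $ i - t)) y \<partial>?M)\<^sup>2) \<longlonglongrightarrow> (f x)\<^sup>2"
      by (intro tendsto_power Fejer_approximation L fc fl x)
    then have "(f x)\<^sup>2 \<le> w\<^sup>2 * Z * A * S"
      by (rule LIMSEQ_le_const2) (use bound in blast)
    then show "(f x)\<^sup>2 \<le> w\<^sup>2 * Z * A * ((\<integral>y. (f y)\<^sup>2 \<partial>?M) + (\<Sum>i\<in>UNIV. \<integral>y. (wderiv L (pure_index s i) f y)\<^sup>2 \<partial>?M))"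
      by (simp only: S_def)
  qed
qed

section \<open>The periodic Sobolev space is complete\<close>

text \<open>Linearity of \<open>T\<close> is asked for almost everywhere, which is what choices such
  as \<open>wderiv\<close> satisfy; the integral does not see the difference.\<close>

lemma semi_inner_pullback:
  assumes zero: "(\<lambda>x. 0) \<in> V" and Vlin: "\<And>f g c d. f \<in> V \<Longrightarrow> g \<in> V \<Longrightarrow> (\<lambda>x. c * f x + d * g x) \<in> V"
    and T: "\<And>f. f \<in> V \<Longrightarrow> T f \<in> l2 M"
    and Tlin: "\<And>f g c d. f \<in> V \<Longrightarrow> g \<in> V \<Longrightarrow> AE x in M. T (\<lambda>x. c * f x + d * g x) x = c * T f x + d * T g x"
  shows "semi_inner V (\<lambda>f g. \<integral>x. T f x * T g x \<partial>M)"
proof -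
  interpret semi_inner "l2 M" "\<lambda>f g. \<integral>x. f x * g x \<partial>M" by (rule semi_inner_l2)
  show ?thesis
  proof
    fix f g h c d assume f: "f \<in> V" and g: "g \<in> V" and h: "h \<in> V"
    have "(\<integral>x. T (\<lambda>x. c * f x + d * g x) x * T h x \<partial>M) = (\<integral>x. (c * T f x + d * T g x) * T h x \<partial>M)"
      by (rule integral_cong_AE)
         (use Tlin[OF f g, of c d] T[OF Vlin[OF f g, of c d]] T[OF f] T[OF g] T[OF h] in \<open>auto simp: l2_def\<close>)
    also have "\<dots> = c * (\<integral>x. T f x * T h x \<partial>M) + d * (\<integral>x. T g x * T h x \<partial>M)"
      by (intro lin T f g h)
    finally show "(\<integral>x. T (\<lambda>x. c * f x + d * g x) x * T h x \<partial>M) = c * (\<integral>x. T f x * T h x \<partial>M) + d * (\<integral>x. T g x * T h x \<partial>M)" .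
  qed (auto intro: zero Vlin simp: mult.commute)
qed

lemma semi_inner_combine:
  assumes 1: "semi_inner V B1" and 2: "semi_inner V B2" and a: "a \<ge> 0" and b: "b \<ge> 0"
  shows "semi_inner V (\<lambda>f g. a * B1 f g + b * B2 f g)"
proof -
  interpret A: semi_inner V B1 by fact
  interpret B: semi_inner V B2 by fact
  show ?thesis
  proof
    fix f g h c d assume "f \<in> V" "g \<in> V" "h \<in> V"
    then show "a * B1 (\<lambda>x. c * f x + d * g x) h + b * B2 (\<lambda>x. c * f x + d * g x) h
        = c * (a * B1 f h + b * B2 f h) + d * (a * B1 g h + b * B2 g h)"
      by (simp add: A.lin B.lin algebra_simps)
  next
    fix f g assume "f \<in> V" "g \<in> V"
    then show "a * B1 f g + b * B2 f g = a * B1 g f + b * B2 g f" using A.sym[of f g] B.sym[of f g] by simp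
  qed (use a b in \<open>auto intro: A.zero_mem A.lin_mem simp: A.nonneg B.nonneg\<close>)
qed

lemma semi_inner_sum:
  assumes "finite I" "I \<noteq> {}" "\<And>i. i \<in> I \<Longrightarrow> semi_inner V (B i)"
  shows "semi_inner V (\<lambda>f g. \<Sum>i\<in>I. B i f g)"
  using assms
proof (induction I rule: finite_ne_induct)
  case (singleton i)
  then show ?case by simp
next
  case (insert i I)
  have "semi_inner V (\<lambda>f g. 1 * B i f g + 1 * (\<Sum>i\<in>I. B i f g))"
    by (intro semi_inner_combine insert) (use insert in auto)
  then show ?case using insert by simp
qed

lemma is_weak_deriv_tendsto:
  assumes U: "U \<in> sets lebesgue" "bounded U"
    and F: "\<And>n. F n \<in> l2 (lebesgue_on U)" "f \<in> l2 (lebesgue_on U)"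
      "(\<lambda>n. \<integral>x. (F n x - f x)\<^sup>2 \<partial>lebesgue_on U) \<longlonglongrightarrow> 0"
    and G: "\<And>n. G n \<in> l2 (lebesgue_on U)" "g \<in> l2 (lebesgue_on U)"
      "(\<lambda>n. \<integral>x. (G n x - g x)\<^sup>2 \<partial>lebesgue_on U) \<longlonglongrightarrow> 0"
    and w: "\<And>n. is_weak_deriv U \<alpha> (F n) (G n)"
  shows "is_weak_deriv U \<alpha> f g"
  unfolding is_weak_deriv_def
proof (intro allI impI)
  fix \<phi> js assume \<phi>: "test_fun U \<phi>" and r: "realises js \<alpha>"
  interpret semi_inner "l2 (lebesgue_on U)" "\<lambda>f g. \<integral>x. f x * g x \<partial>lebesgue_on U" by (rule semi_inner_l2)
  have l: "dpartials js \<phi> \<in> l2 (lebesgue_on U)" for js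
    by (rule smooth_dpartials_l2[OF test_fun_smooth[OF \<phi>] U])
  have l0: "\<phi> \<in> l2 (lebesgue_on U)" using l[of "[]"] by simp
  have "(\<lambda>n. \<integral>x. F n x * dpartials js \<phi> x \<partial>lebesgue_on U) \<longlonglongrightarrow> (\<integral>x. f x * dpartials js \<phi> x \<partial>lebesgue_on U)"
    using F by (intro tendsto_left l) (auto simp: power2_eq_square)
  moreover have "(\<lambda>n. (- 1) ^ mi_order \<alpha> * (\<integral>x. G n x * \<phi> x \<partial>lebesgue_on U)) \<longlonglongrightarrow> (- 1) ^ mi_order \<alpha> * (\<integral>x. g x * \<phi> x \<partial>lebesgue_on U)"
    using G by (intro tendsto_mult_left tendsto_left l0) (auto simp: power2_eq_square)
  moreover have "(\<integral>x. F n x * dpartials js \<phi> x \<partial>lebesgue_on U) = (- 1) ^ mi_order \<alpha> * (\<integral>x. G n x * \<phi> x \<partial>lebesgue_on U)" for n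
    using w[of n] \<phi> r by (simp add: is_weak_deriv_def)
  ultimately show "(\<integral>x. f x * dpartials js \<phi> x \<partial>lebesgue_on U) = (- 1) ^ mi_order \<alpha> * (\<integral>x. g x * \<phi> x \<partial>lebesgue_on U)"
    using LIMSEQ_unique by (auto simp only:)
qed

lemma finite_mi_order: "finite {\<alpha> :: 'd::finite \<Rightarrow> nat. mi_order \<alpha> \<le> s}"
proof (rule finite_subset)
  show "{\<alpha> :: 'd \<Rightarrow> nat. mi_order \<alpha> \<le> s} \<subseteq> PiE UNIV (\<lambda>_. {..s})"
  proof
    fix \<alpha> :: "'d \<Rightarrow> nat" assume "\<alpha> \<in> {\<alpha>. mi_order \<alpha> \<le> s}"
    then have "\<alpha> i \<le> s" for i
      using member_le_sum[of i UNIV \<alpha>] by (simp add: mi_order_def)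
    then show "\<alpha> \<in> PiE UNIV (\<lambda>_. {..s})" by auto
  qed
  show "finite (PiE (UNIV :: 'd set) (\<lambda>_. {..s}))" by (intro finite_PiE) auto
qed

lemma zero_mi_order: "(\<lambda>_. 0) \<in> {\<alpha> :: 'd::finite \<Rightarrow> nat. mi_order \<alpha> \<le> s}"
  by (simp add: mi_order_def)

text \<open>Only the empty list realises the zero multi-index. This identifies the derivative of
  order 0 with f almost everywhere, so that \<open>Hper_norm2\<close> dominates the mean-square
  norm.\<close>

lemma is_weak_deriv_0: "is_weak_deriv U (\<lambda>_. 0) f f"
proof -
  have "js = []" if "realises js (\<lambda>_. 0)" for js :: "'a list"
  proof (rule ccontr)
    assume "js \<noteq> []"
    then have "count (mset js) (hd js) \<noteq> 0" by (simp add: count_eq_zero_iff)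
    then show False using that by (simp add: realises_def)
  qed
  then have "dpartials js \<phi> = \<phi>" if "realises js (\<lambda>_. 0)" for js :: "'a list" and \<phi>
    using that by fastforce
  then show ?thesis by (simp add: is_weak_deriv_def mi_order_def)
qed

section \<open>Linear structure and inner product of the periodic Sobolev space\<close>

lemma per_ext_lin: "per_ext L (\<lambda>x. c * f x + d * g x) = (\<lambda>x. c * per_ext L f x + d * per_ext L g x)"
  by (simp add: per_ext_def fun_eq_iff)

lemma per_ext_diff: "per_ext L (\<lambda>x. f x - g x) x = per_ext L f x - per_ext L g x"
  by (simp add: per_ext_def)

lemma Hper_zero: "(\<lambda>x. 0) \<in> Hper L s"
proof -
  have "L2_on U (\<lambda>x. 0)" for U :: "(real^'a) set" by (simp add: L2_on_def)
  moreover have "per_ext L (\<lambda>x :: real^'a. 0) = (\<lambda>x. 0)" by (simp add: per_ext_def fun_eq_iff)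
  moreover have "is_weak_deriv U \<alpha> (\<lambda>x. 0) (\<lambda>x. 0)" for U :: "(real^'a) set" and \<alpha> by (simp add: is_weak_deriv_def)
  ultimately show ?thesis unfolding Hper_def sobolev_def by (auto intro: exI[of _ "\<lambda>x. 0"])
qed

lemma Hper_lin:
  assumes f: "f \<in> Hper L s" and g: "g \<in> Hper L s"
  shows "(\<lambda>x. c * f x + d * g x) \<in> Hper L s"
proof -
  have "continuous_on (ccube (2 * L)) (\<lambda>x. c * f x + d * g x)"
    using f g by (intro continuous_intros) (auto simp: Hper_def)
  moreover have "L2_on (ccube (2 * L)) (\<lambda>x. c * f x + d * g x)"
    unfolding L2_on_l2 by (intro l2_lin Hper_l2(2)[OF f] Hper_l2(2)[OF g])
  moreover have "sobolev (ocube (4 * L)) s (per_ext L (\<lambda>x. c * f x + d * g x))"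
    unfolding sobolev_def L2_on_l2 per_ext_lin
  proof (intro conjI allI impI)
    have pf: "per_ext L f \<in> l2 (lebesgue_on (ocube (4 * L)))" and pg: "per_ext L g \<in> l2 (lebesgue_on (ocube (4 * L)))"
      using f g by (auto simp: Hper_def sobolev_def L2_on_l2)
    show "(\<lambda>x. c * per_ext L f x + d * per_ext L g x) \<in> l2 (lebesgue_on (ocube (4 * L)))" by (intro l2_lin pf pg)
    fix \<alpha> :: "'a \<Rightarrow> nat" assume \<alpha>: "mi_order \<alpha> \<le> s"
    obtain F G where F: "F \<in> l2 (lebesgue_on (ocube (4 * L)))" "is_weak_deriv (ocube (4 * L)) \<alpha> (per_ext L f) F"
      and G: "G \<in> l2 (lebesgue_on (ocube (4 * L)))" "is_weak_deriv (ocube (4 * L)) \<alpha> (per_ext L g) G"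
      using f g \<alpha> unfolding Hper_def sobolev_def L2_on_l2 by blast
    show "\<exists>h. h \<in> l2 (lebesgue_on (ocube (4 * L))) \<and> is_weak_deriv (ocube (4 * L)) \<alpha> (\<lambda>x. c * per_ext L f x + d * per_ext L g x) h"
      by (rule exI[of _ "\<lambda>x. c * F x + d * G x"], rule conjI[OF l2_lin[OF F(1) G(1)] is_weak_deriv_lin[OF _ _ pf pg F(1) G(1) F(2) G(2)]]) auto
  qed
  ultimately show ?thesis by (simp add: Hper_def)
qed

lemma Hper_diff: "f \<in> Hper L s \<Longrightarrow> g \<in> Hper L s \<Longrightarrow> (\<lambda>x. f x - g x) \<in> Hper L s"
  using Hper_lin[of f L s g 1 "-1"] by simp

lemma wderiv_unique:
  assumes L: "L > 0" and f: "f \<in> Hper L s" and \<alpha>: "mi_order \<alpha> \<le> s"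
    and g: "g \<in> l2 (lebesgue_on (ocube (2 * L)))" "is_weak_deriv (ocube (2 * L)) \<alpha> f g"
  shows "AE x in lebesgue_on (ocube (2 * L)). wderiv L \<alpha> f x = g x"
  using is_weak_deriv_unique[of "wderiv L \<alpha> f" _ _ g \<alpha> f] wderiv_Hper[OF L f \<alpha>] g unfolding ocube_eq_box by blast

lemma wderiv_lin:
  assumes L: "L > 0" and f: "f \<in> Hper L s" and g: "g \<in> Hper L s" and \<alpha>: "mi_order \<alpha> \<le> s"
  shows "AE x in lebesgue_on (ocube (2 * L)). wderiv L \<alpha> (\<lambda>x. c * f x + d * g x) x = c * wderiv L \<alpha> f x + d * wderiv L \<alpha> g x"
  by (rule wderiv_unique[OF L Hper_lin[OF f g] \<alpha>])
     (intro l2_lin is_weak_deriv_lin wderiv_Hper[OF L _ \<alpha>] Hper_l2(1)[OF f] Hper_l2(1)[OF g] f g; simp)+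

lemma wderiv_0:
  assumes L: "L > 0" and f: "f \<in> Hper L s"
  shows "AE x in lebesgue_on (ocube (2 * L)). wderiv L (\<lambda>_. 0) f x = f x"
  by (rule wderiv_unique[OF L f _ Hper_l2(1)[OF f] is_weak_deriv_0]) (simp add: mi_order_def)

definition Hinner :: "real \<Rightarrow> nat \<Rightarrow> (real^'d::finite \<Rightarrow> real) \<Rightarrow> (real^'d \<Rightarrow> real) \<Rightarrow> real" where
  "Hinner L s u v = (\<Sum>\<alpha>\<in>{\<alpha>. mi_order \<alpha> \<le> s}. \<integral>x. wderiv L \<alpha> u x * wderiv L \<alpha> v x \<partial>lebesgue_on (ocube (2*L)))"

lemma Hinner_norm2: "Hinner L s f f = Hper_norm2 L s f"
  by (simp add: Hinner_def Hper_norm2_def power2_eq_square)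

lemma semi_inner_Hinner:
  assumes L: "L > 0"
  shows "semi_inner (Hper L s) (Hinner L s :: (real^'d::finite \<Rightarrow> real) \<Rightarrow> _)"
  unfolding Hinner_def[abs_def]
proof (rule semi_inner_sum)
  show "{\<alpha> :: 'd \<Rightarrow> nat. mi_order \<alpha> \<le> s} \<noteq> {}" using zero_mi_order by blast
  fix \<alpha> :: "'d \<Rightarrow> nat" assume "\<alpha> \<in> {\<alpha>. mi_order \<alpha> \<le> s}"
  then have \<alpha>: "mi_order \<alpha> \<le> s" by simp
  show "semi_inner (Hper L s) (\<lambda>f g. \<integral>x. wderiv L \<alpha> f x * wderiv L \<alpha> g x \<partial>lebesgue_on (ocube (2*L)))"
    by (rule semi_inner_pullback) (intro Hper_zero Hper_lin wderiv_Hper[OF L _ \<alpha>] wderiv_lin[OF L _ _ \<alpha>]; assumption?)+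
qed (rule finite_mi_order)

lemma Hper_norm2_ge:
  fixes f :: "real^'d::finite \<Rightarrow> real"
  assumes "mi_order \<alpha> \<le> s"
  shows "(\<integral>x. (wderiv L \<alpha> f x)\<^sup>2 \<partial>lebesgue_on (ocube (2*L))) \<le> Hper_norm2 L s f"
  unfolding Hper_norm2_def by (rule member_le_sum[OF _ _ finite_mi_order]) (use assms in auto)

lemma Hper_norm2_ge_l2:
  fixes f :: "real^'d::finite \<Rightarrow> real"
  assumes L: "L > 0" and f: "f \<in> Hper L s"
  shows "(\<integral>x. (f x)\<^sup>2 \<partial>lebesgue_on (ocube (2*L))) \<le> Hper_norm2 L s f"
proof -
  have "(\<integral>x. (wderiv L (\<lambda>_. 0) f x)\<^sup>2 \<partial>lebesgue_on (ocube (2*L))) = (\<integral>x. (f x)\<^sup>2 \<partial>lebesgue_on (ocube (2*L)))"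
    by (rule integral_cong_AE)
       (use wderiv_0[OF L f] Hper_l2(1)[OF f] wderiv_Hper(1)[OF L f, of "\<lambda>_. 0"] zero_mi_order in \<open>auto simp: l2_def\<close>)
  then show ?thesis using Hper_norm2_ge[of "\<lambda>_. 0" s L f] zero_mi_order by auto
qed

lemma closure_ocube: "L > 0 \<Longrightarrow> closure (ocube L) = (ccube L :: (real^'d::finite) set)"
proof -
  assume "L > 0"
  then have "(0 :: real^'d) \<in> ocube L" by (simp add: ocube_def)
  then show ?thesis unfolding ocube_eq_box ccube_eq_cbox by (intro closure_box) auto
qed

text \<open>The interior bound reaches the faces by continuity of f, as the open cube is dense in
  the closed one. The factor 1 + d counts f and its d pure derivatives, each bounded by the full
  norm.\<close>

lemma Sobolev_embedding:
  assumes L: "L > 0" and s: "real s > real CARD('d::finite) / 2"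
  obtains C where "C \<ge> 0"
    "\<And>(f :: real^'d \<Rightarrow> real) x. f \<in> Hper L s \<Longrightarrow> x \<in> ccube (2*L) \<Longrightarrow> (f x)\<^sup>2 \<le> C * Hper_norm2 L s f"
proof -
  obtain C where C: "C \<ge> 0" and bd: "\<And>(f :: real^'d \<Rightarrow> real) x. f \<in> Hper L s \<Longrightarrow> x \<in> ocube (2*L) \<Longrightarrow>
       (f x)\<^sup>2 \<le> C * ((\<integral>y. (f y)\<^sup>2 \<partial>lebesgue_on (ocube (2*L)))
                  + (\<Sum>i\<in>UNIV. \<integral>y. (wderiv L (pure_index s i) f y)\<^sup>2 \<partial>lebesgue_on (ocube (2*L))))"
    using Sobolev_embedding_interior[OF L s] by blast
  show ?thesis
  proof
    show "C * (1 + CARD('d)) \<ge> 0" using C by simp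
    fix f :: "real^'d \<Rightarrow> real" and x :: "real^'d" assume f: "f \<in> Hper L s" and x: "x \<in> ccube (2*L)"
    have "(f y)\<^sup>2 \<le> C * (1 + CARD('d)) * Hper_norm2 L s f" if "y \<in> ocube (2*L)" for y
    proof -
      have "(\<Sum>i\<in>(UNIV::'d set). \<integral>y. (wderiv L (pure_index s i) f y)\<^sup>2 \<partial>lebesgue_on (ocube (2*L))) \<le> (\<Sum>i\<in>(UNIV::'d set). Hper_norm2 L s f)"
        by (intro sum_mono Hper_norm2_ge) (simp add: mi_order_pure_index)
      then have "(\<integral>y. (f y)\<^sup>2 \<partial>lebesgue_on (ocube (2*L))) + (\<Sum>i\<in>UNIV. \<integral>y. (wderiv L (pure_index s i) f y)\<^sup>2 \<partial>lebesgue_on (ocube (2*L)))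
         \<le> (1 + CARD('d)) * Hper_norm2 L s f"
        using Hper_norm2_ge_l2[OF L f] by (simp add: distrib_right)
      from mult_left_mono[OF this C] bd[OF f that] show ?thesis by (simp add: mult.assoc)
    qed
    moreover have cl: "closure (ocube (2*L)) = (ccube (2*L) :: (real^'d) set)" using L by (intro closure_ocube) simp
    moreover have "continuous_on (ccube (2*L)) (\<lambda>x. (f x)\<^sup>2)"
      using f by (intro continuous_intros) (simp add: Hper_def)
    ultimately show "(f x)\<^sup>2 \<le> C * (1 + CARD('d)) * Hper_norm2 L s f"
      using x by - (rule continuous_le_on_closure[of "ocube (2*L)" "\<lambda>x. (f x)\<^sup>2"], simp_all)
  qed
qed

text \<open>The Sobolev embedding makes a Cauchy sequence converge uniformly, which provides the continuous
  representative of the limit.\<close>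

lemma semi_hilbert_Hinner:
  assumes L: "L > 0" and s: "real s > real CARD('d::finite) / 2"
  shows "semi_hilbert (Hper L s) (Hinner L s :: (real^'d \<Rightarrow> real) \<Rightarrow> _)"
proof -
  interpret H: semi_inner "Hper L s" "Hinner L s :: (real^'d \<Rightarrow> real) \<Rightarrow> _" by (rule semi_inner_Hinner[OF L])
  let ?U2 = "ocube (2 * L) :: (real^'d) set"
  let ?U4 = "ocube (4 * L) :: (real^'d) set"
  let ?M = "lebesgue_on ?U2"
  interpret l: semi_hilbert "l2 ?M" "\<lambda>f g. \<integral>x. f x * g x \<partial>?M" by (rule semi_hilbert_l2) simp
  show ?thesis
  proof
    fix F :: "nat \<Rightarrow> real^'d \<Rightarrow> real"
    assume F: "\<And>k. F k \<in> Hper L s"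
      and C: "\<And>e. e > 0 \<Longrightarrow> \<exists>N. \<forall>j\<ge>N. \<forall>k\<ge>N. Hinner L s (\<lambda>x. F j x - F k x) (\<lambda>x. F j x - F k x) < e"
    have Fd: "(\<lambda>x. F j x - F k x) \<in> Hper L s" for j k by (rule Hper_diff[OF F F])
    have wF: "wderiv L \<alpha> (F k) \<in> l2 ?M" if "mi_order \<alpha> \<le> s" for \<alpha> k by (rule wderiv_Hper(1)[OF L F that])
    have wdiff: "(\<integral>x. (wderiv L \<alpha> u x - wderiv L \<alpha> v x) * (wderiv L \<alpha> u x - wderiv L \<alpha> v x) \<partial>?M)
        = (\<integral>x. (wderiv L \<alpha> (\<lambda>x. u x - v x) x)\<^sup>2 \<partial>?M)"
      if \<alpha>: "mi_order \<alpha> \<le> s" and u: "u \<in> Hper L s" and v: "v \<in> Hper L s" for \<alpha> and u v :: "real^'d \<Rightarrow> real"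
    proof (rule integral_cong_AE)
      show "AE x in ?M. (wderiv L \<alpha> u x - wderiv L \<alpha> v x) * (wderiv L \<alpha> u x - wderiv L \<alpha> v x) = (wderiv L \<alpha> (\<lambda>x. u x - v x) x)\<^sup>2"
        using wderiv_lin[OF L u v \<alpha>, of 1 "-1"] by (auto simp: power2_eq_square)
    qed (use wderiv_Hper(1)[OF L u \<alpha>] wderiv_Hper(1)[OF L v \<alpha>] wderiv_Hper(1)[OF L Hper_diff[OF u v] \<alpha>] in \<open>auto simp: l2_def\<close>)
    \<comment> \<open>Each sequence of weak derivatives has its own mean-square limit; that these
      limits are the derivatives of one function f is shown below.\<close>
    have "\<exists>g\<in>l2 ?M. (\<lambda>k. \<integral>x. (wderiv L \<alpha> (F k) x - g x) * (wderiv L \<alpha> (F k) x - g x) \<partial>?M) \<longlonglongrightarrow> 0"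
      if \<alpha>: "mi_order \<alpha> \<le> s" for \<alpha>
    proof (rule l.complete[OF wF[OF \<alpha>]])
      fix e :: real assume "e > 0"
      then obtain N where N: "\<forall>j\<ge>N. \<forall>k\<ge>N. Hinner L s (\<lambda>x. F j x - F k x) (\<lambda>x. F j x - F k x) < e" using C by blast
      have "(\<integral>x. (wderiv L \<alpha> (F j) x - wderiv L \<alpha> (F k) x) * (wderiv L \<alpha> (F j) x - wderiv L \<alpha> (F k) x) \<partial>?M) < e"
        if "j \<ge> N" "k \<ge> N" for j k
      proof -
        have "Hper_norm2 L s (\<lambda>x. F j x - F k x) < e" using N that by (simp add: Hinner_norm2)
        with Hper_norm2_ge[OF \<alpha>, of L "\<lambda>x. F j x - F k x"] show ?thesis
          unfolding wdiff[OF \<alpha> F F] by (rule le_less_trans)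
      qed
      then show "\<exists>N. \<forall>j\<ge>N. \<forall>k\<ge>N. (\<integral>x. (wderiv L \<alpha> (F j) x - wderiv L \<alpha> (F k) x) * (wderiv L \<alpha> (F j) x - wderiv L \<alpha> (F k) x) \<partial>?M) < e" by blast
    qed
    then have "\<forall>\<alpha>\<in>{\<alpha>. mi_order \<alpha> \<le> s}. \<exists>g. g \<in> l2 ?M \<and> (\<lambda>k. \<integral>x. (wderiv L \<alpha> (F k) x - g x)\<^sup>2 \<partial>?M) \<longlonglongrightarrow> 0"
      unfolding power2_eq_square by blast
    from bchoice[OF this] obtain g where gl: "\<And>\<alpha>. mi_order \<alpha> \<le> s \<Longrightarrow> g \<alpha> \<in> l2 ?M"
      and glim: "\<And>\<alpha>. mi_order \<alpha> \<le> s \<Longrightarrow> (\<lambda>k. \<integral>x. (wderiv L \<alpha> (F k) x - g \<alpha> x)\<^sup>2 \<partial>?M) \<longlonglongrightarrow> 0"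
      by auto
    obtain K where K: "K \<ge> 0"
      and emb: "\<And>(f :: real^'d \<Rightarrow> real) x. f \<in> Hper L s \<Longrightarrow> x \<in> ccube (2*L) \<Longrightarrow> (f x)\<^sup>2 \<le> K * Hper_norm2 L s f"
      using Sobolev_embedding[OF L s] by blast
    have "uniformly_Cauchy_on (ccube (2*L)) F"
      unfolding uniformly_Cauchy_on_def
    proof (intro allI impI)
      fix e :: real assume e: "e > 0"
      \<comment> \<open>The shift to K + 1 keeps the quotient meaningful for K = 0; the square
        matches the squared norm.\<close>
      obtain N where N: "\<forall>j\<ge>N. \<forall>k\<ge>N. Hinner L s (\<lambda>x. F j x - F k x) (\<lambda>x. F j x - F k x) < e\<^sup>2 / (K + 1)"
        using C[of "e\<^sup>2 / (K + 1)"] e K by auto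
      have "dist (F j x) (F k x) < e" if x: "x \<in> ccube (2*L)" and "j \<ge> N" "k \<ge> N" for x j k
      proof -
        have h: "Hper_norm2 L s (\<lambda>x. F j x - F k x) < e\<^sup>2 / (K + 1)"
          using N that by (simp add: Hinner_norm2)
        have h0: "Hper_norm2 L s (\<lambda>x. F j x - F k x) \<ge> 0" using H.nonneg[OF Fd, of j k] by (simp add: Hinner_norm2)
        have "(F j x - F k x)\<^sup>2 \<le> K * Hper_norm2 L s (\<lambda>x. F j x - F k x)" by (rule emb[OF Fd x])
        also have "\<dots> \<le> (K + 1) * Hper_norm2 L s (\<lambda>x. F j x - F k x)" using h0 by (intro mult_right_mono) auto
        also have "\<dots> < (K + 1) * (e\<^sup>2 / (K + 1))" using h K by (intro mult_strict_left_mono) auto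
        also have "\<dots> = e\<^sup>2" using K by simp
        finally have "\<bar>F j x - F k x\<bar>\<^sup>2 < e\<^sup>2" by simp
        then have "\<bar>F j x - F k x\<bar> < e" by (rule power2_less_imp_less) (use e in simp)
        then show ?thesis by (simp add: dist_real_def)
      qed
      then show "\<exists>M. \<forall>x\<in>ccube (2*L). \<forall>m\<ge>M. \<forall>n\<ge>M. dist (F m x) (F n x) < e" by blast
    qed
    then obtain f where f: "uniform_limit (ccube (2*L)) F f sequentially"
      using Cauchy_uniformly_convergent unfolding uniformly_convergent_on_def by blast
    have fc: "continuous_on (ccube (2*L)) f"
      by (rule uniform_limit_theorem[OF _ f]) (use F in \<open>auto simp: Hper_def\<close>)
    have fl': "f \<in> l2 (lebesgue_on (ccube (2*L)))"
    proof -
      have "compact (f ` ccube (2*L))" by (rule compact_continuous_image[OF fc]) (simp add: ccube_eq_cbox)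
      then obtain B where "\<And>x. x \<in> ccube (2*L) \<Longrightarrow> \<bar>f x\<bar> \<le> B"
        by (metis bounded_iff compact_imp_bounded image_eqI real_norm_def)
      then show ?thesis
        by (intro l2_bounded[where C=B]) (auto intro: continuous_imp_measurable_on_sets_lebesgue[OF fc] simp: space_restrict_space)
    qed
    have sub: "?U2 \<subseteq> ccube (2*L)" by (auto simp: ocube_def ccube_def less_imp_le)
    have fl: "f \<in> l2 ?M" by (rule l2_subset[OF _ _ sub fl']) auto
    have Fl: "F k \<in> l2 ?M" for k by (rule Hper_l2[OF F])
    have Fdl: "(\<lambda>x. F k x - f x) \<in> l2 ?M" for k by (rule l.diff_mem[OF Fl fl])
    have Flim: "(\<lambda>k. \<integral>x. (F k x - f x)\<^sup>2 \<partial>?M) \<longlonglongrightarrow> 0"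
    proof (rule LIMSEQ_I)
      fix r :: real assume r: "r > 0"
      define V where "V = measure ?M (space ?M)"
      have V: "V \<ge> 0" by (simp add: V_def)
      define e where "e = sqrt (r / (V + 1))"
      have e: "e > 0" "e\<^sup>2 = r / (V + 1)" using r V by (auto simp: e_def)
      have "\<forall>\<^sub>F k in sequentially. \<forall>x\<in>ccube (2*L). dist (F k x) (f x) < e"
        using f e(1) unfolding uniform_limit_iff by blast
      then obtain N where N: "\<And>k x. k \<ge> N \<Longrightarrow> x \<in> ccube (2*L) \<Longrightarrow> \<bar>F k x - f x\<bar> < e"
        unfolding eventually_sequentially dist_real_def by blast
      have "norm ((\<integral>x. (F k x - f x)\<^sup>2 \<partial>?M) - 0) < r" if "k \<ge> N" for k
      proof -
        interpret finite_measure ?M by simp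
        have "(\<integral>x. (F k x - f x)\<^sup>2 \<partial>?M) \<le> (\<integral>x. e\<^sup>2 \<partial>?M)"
        proof (rule integral_mono)
          show "integrable ?M (\<lambda>x. (F k x - f x)\<^sup>2)" using Fdl[of k] by (simp add: l2_def)
          fix x assume "x \<in> space ?M"
          then have "\<bar>F k x - f x\<bar> \<le> \<bar>e\<bar>" using N[OF that, of x] sub e(1) by (force simp: space_restrict_space)
          then show "(F k x - f x)\<^sup>2 \<le> e\<^sup>2" by (simp add: abs_le_square_iff)
        qed simp
        also have "\<dots> = V * e\<^sup>2" by (simp add: V_def)
        also have "\<dots> < (V + 1) * e\<^sup>2" using e(1) by simp
        also have "\<dots> = r" unfolding e(2) using V by simp
        finally show ?thesis by simp
      qed
      then show "\<exists>no. \<forall>k\<ge>no. norm ((\<integral>x. (F k x - f x)\<^sup>2 \<partial>?M) - 0) < r" by blast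
    qed
    \<comment> \<open>Extension to the large cube multiplies a squared error by at most the number
      of tiles, so functions and derivatives converge there too.\<close>
    have perlim: "(\<lambda>k. \<integral>x. (per_ext L (G k) x - per_ext L h x)\<^sup>2 \<partial>lebesgue_on ?U4) \<longlonglongrightarrow> 0"
      if Gl: "\<And>k. G k \<in> l2 ?M" and hl: "h \<in> l2 ?M" and lim: "(\<lambda>k. \<integral>x. (G k x - h x)\<^sup>2 \<partial>?M) \<longlonglongrightarrow> 0" for G h
    proof (rule tendsto_sandwich[OF _ _ tendsto_const])
      show "(\<lambda>k. card (neighbours :: ('d \<Rightarrow> int) set) * (\<integral>x. (G k x - h x)\<^sup>2 \<partial>?M)) \<longlonglongrightarrow> 0"
        using tendsto_mult_left[OF lim] by simp
      show "\<forall>\<^sub>F k in sequentially. (\<integral>x. (per_ext L (G k) x - per_ext L h x)\<^sup>2 \<partial>lebesgue_on ?U4)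
          \<le> card (neighbours :: ('d \<Rightarrow> int) set) * (\<integral>x. (G k x - h x)\<^sup>2 \<partial>?M)"
        using per_ext_l2(2)[OF L l.diff_mem[OF Gl hl]] by (simp add: per_ext_diff)
    qed simp
    \<comment> \<open>Weak derivatives survive mean-square limits. The statement is needed on the
      large cube, where membership in \<open>Hper\<close> is decided.\<close>
    have w4: "is_weak_deriv ?U4 \<alpha> (per_ext L f) (per_ext L (g \<alpha>))" if \<alpha>: "mi_order \<alpha> \<le> s" for \<alpha>
    proof (rule is_weak_deriv_tendsto[where F="\<lambda>k. per_ext L (F k)" and G="\<lambda>k. per_ext L (wderiv L \<alpha> (F k))"])
      show "is_weak_deriv ?U4 \<alpha> (per_ext L (F n)) (per_ext L (wderiv L \<alpha> (F n)))" for n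
        by (rule is_weak_deriv_per_ext[OF L F \<alpha> wderiv_Hper[OF L F \<alpha>]])
    qed (rule sets_lebesgue_cube bounded_cube per_ext_l2(1)[OF L Fl] per_ext_l2(1)[OF L fl] per_ext_l2(1)[OF L wF[OF \<alpha>]]
        per_ext_l2(1)[OF L gl[OF \<alpha>]] perlim[OF Fl fl Flim] perlim[OF wF[OF \<alpha>] gl[OF \<alpha>] glim[OF \<alpha>]])+
    have fH: "f \<in> Hper L s"
      unfolding Hper_def sobolev_def L2_on_l2
      using fc fl' per_ext_l2(1)[OF L fl] per_ext_l2(1)[OF L gl] w4 by blast
    \<comment> \<open>\<open>wderiv L \<alpha> f\<close> is a fresh choice; uniqueness identifies it
      with the limit \<open>g \<alpha>\<close>.\<close>
    have gf: "AE x in ?M. wderiv L \<alpha> f x = g \<alpha> x" if \<alpha>: "mi_order \<alpha> \<le> s" for \<alpha>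
    proof (rule wderiv_unique[OF L fH \<alpha> gl[OF \<alpha>]])
      have sub24: "?U2 \<subseteq> ?U4" using L by (fastforce simp: ocube_def intro: less_trans)
      have "is_weak_deriv ?U2 \<alpha> (per_ext L f) (per_ext L (g \<alpha>))"
        by (rule is_weak_deriv_subset[OF _ _ sub24 w4[OF \<alpha>]]) auto
      then show "is_weak_deriv ?U2 \<alpha> f (g \<alpha>)"
        by (subst is_weak_deriv_cong[where ?f2.0="per_ext L f" and ?g2.0="per_ext L (g \<alpha>)"]) (auto simp: per_ext_ocube[OF L])
    qed
    have "(\<lambda>k. Hinner L s (\<lambda>x. F k x - f x) (\<lambda>x. F k x - f x)) \<longlonglongrightarrow> (\<Sum>\<alpha>\<in>{\<alpha> :: 'd \<Rightarrow> nat. mi_order \<alpha> \<le> s}. 0)"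
      unfolding Hinner_norm2 Hper_norm2_def
    proof (rule tendsto_sum)
      fix \<alpha> :: "'d \<Rightarrow> nat" assume "\<alpha> \<in> {\<alpha>. mi_order \<alpha> \<le> s}"
      then have \<alpha>: "mi_order \<alpha> \<le> s" by simp
      have "(\<integral>x. (wderiv L \<alpha> (\<lambda>x. F k x - f x) x)\<^sup>2 \<partial>?M) = (\<integral>x. (wderiv L \<alpha> (F k) x - g \<alpha> x)\<^sup>2 \<partial>?M)" for k
        unfolding wdiff[OF \<alpha> F fH, symmetric]
        by (rule integral_cong_AE)
           (use gf[OF \<alpha>] wF[OF \<alpha>, of k] gl[OF \<alpha>] wderiv_Hper(1)[OF L fH \<alpha>] in \<open>auto simp: l2_def power2_eq_square\<close>)
      then show "(\<lambda>k. \<integral>x. (wderiv L \<alpha> (\<lambda>x. F k x - f x) x)\<^sup>2 \<partial>?M) \<longlonglongrightarrow> 0"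
        using glim[OF \<alpha>] by simp
    qed
    then show "\<exists>f\<in>Hper L s. (\<lambda>k. Hinner L s (\<lambda>x. F k x - f x) (\<lambda>x. F k x - f x)) \<longlonglongrightarrow> 0"
      using fH by auto
  qed
qed

section \<open>The bilinear form\<close>

lemma semi_hilbert_equivalent:
  assumes 1: "semi_hilbert V B1" and 2: "semi_inner V B2"
    and le: "\<And>f. f \<in> V \<Longrightarrow> c * B1 f f \<le> B2 f f" and c: "c > 0"
    and ge: "\<And>f. f \<in> V \<Longrightarrow> B2 f f \<le> d * B1 f f"
  shows "semi_hilbert V B2"
proof -
  interpret A: semi_hilbert V B1 by fact
  interpret B: semi_inner V B2 by fact
  show ?thesis
  proof
    fix F assume F: "\<And>k::nat. F k \<in> V"
      and C: "\<And>e. e > 0 \<Longrightarrow> \<exists>N. \<forall>j\<ge>N. \<forall>k\<ge>N. B2 (\<lambda>x. F j x - F k x) (\<lambda>x. F j x - F k x) < e"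
    have "\<exists>f\<in>V. (\<lambda>k. B1 (\<lambda>x. F k x - f x) (\<lambda>x. F k x - f x)) \<longlonglongrightarrow> 0"
    proof (rule A.complete[OF F])
      fix e :: real assume "e > 0"
      then obtain N where N: "\<forall>j\<ge>N. \<forall>k\<ge>N. B2 (\<lambda>x. F j x - F k x) (\<lambda>x. F j x - F k x) < c * e" using C[of "c * e"] c by auto
      have "B1 (\<lambda>x. F j x - F k x) (\<lambda>x. F j x - F k x) < e" if "j \<ge> N" "k \<ge> N" for j k
      proof -
        have "c * B1 (\<lambda>x. F j x - F k x) (\<lambda>x. F j x - F k x) < c * e"
          by (rule le_less_trans[OF le[OF A.diff_mem[OF F F]]]) (use N that in blast)
        then show ?thesis using c by simp
      qed
      then show "\<exists>N. \<forall>j\<ge>N. \<forall>k\<ge>N. B1 (\<lambda>x. F j x - F k x) (\<lambda>x. F j x - F k x) < e" by blast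
    qed
    then obtain f where f: "f \<in> V" and lim: "(\<lambda>k. B1 (\<lambda>x. F k x - f x) (\<lambda>x. F k x - f x)) \<longlonglongrightarrow> 0" by blast
    have "(\<lambda>k. B2 (\<lambda>x. F k x - f x) (\<lambda>x. F k x - f x)) \<longlonglongrightarrow> 0"
    proof (rule tendsto_sandwich[OF _ _ tendsto_const])
      show "(\<lambda>k. d * B1 (\<lambda>x. F k x - f x) (\<lambda>x. F k x - f x)) \<longlonglongrightarrow> 0" using tendsto_mult_left[OF lim, of d] by simp
      show "\<forall>\<^sub>F k in sequentially. 0 \<le> B2 (\<lambda>x. F k x - f x) (\<lambda>x. F k x - f x)"
        using B.nonneg[OF A.diff_mem[OF F f]] by simp
      show "\<forall>\<^sub>F k in sequentially. B2 (\<lambda>x. F k x - f x) (\<lambda>x. F k x - f x) \<le> d * B1 (\<lambda>x. F k x - f x) (\<lambda>x. F k x - f x)"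
        using ge[OF A.diff_mem[OF F f]] by simp
    qed
    then show "\<exists>f\<in>V. (\<lambda>k. B2 (\<lambda>x. F k x - f x) (\<lambda>x. F k x - f x)) \<longlonglongrightarrow> 0" using f by blast
  qed
qed

section \<open>Boundedness of the differential operator\<close>

lemma l2_mult_bounded:
  assumes p: "p \<in> borel_measurable M" "AE x in M. \<bar>p x\<bar> \<le> K" and g: "g \<in> l2 M"
  shows "(\<lambda>x. p x * g x) \<in> l2 M" "(\<integral>x. (p x * g x)\<^sup>2 \<partial>M) \<le> K\<^sup>2 * (\<integral>x. (g x)\<^sup>2 \<partial>M)"
proof -
  have gi: "integrable M (\<lambda>x. K\<^sup>2 * (g x)\<^sup>2)" using g by (auto simp: l2_def)
  have m: "(\<lambda>x. p x * g x) \<in> borel_measurable M" using p g by (auto simp: l2_def)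
  have b: "AE x in M. (p x * g x)\<^sup>2 \<le> K\<^sup>2 * (g x)\<^sup>2"
    using p(2)
  proof eventually_elim
    case (elim x)
    have "\<bar>p x\<bar>\<^sup>2 \<le> K\<^sup>2" by (rule power_mono[OF elim]) simp
    then show ?case by (simp add: power_mult_distrib mult_right_mono)
  qed
  have i: "integrable M (\<lambda>x. (p x * g x)\<^sup>2)"
    by (rule Bochner_Integration.integrable_bound[OF gi]) (use m b in auto)
  then show "(\<lambda>x. p x * g x) \<in> l2 M" using m by (simp add: l2_def)
  have "(\<integral>x. (p x * g x)\<^sup>2 \<partial>M) \<le> (\<integral>x. K\<^sup>2 * (g x)\<^sup>2 \<partial>M)" by (rule integral_mono_AE[OF i gi b])
  then show "(\<integral>x. (p x * g x)\<^sup>2 \<partial>M) \<le> K\<^sup>2 * (\<integral>x. (g x)\<^sup>2 \<partial>M)" by simp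
qed

lemma integral_lebesgue_on_subset_mono:
  fixes h :: "'a::euclidean_space \<Rightarrow> real"
  assumes "U \<in> sets lebesgue" "V \<in> sets lebesgue" "V \<subseteq> U" "integrable (lebesgue_on U) h" "\<And>x. h x \<ge> 0"
  shows "(\<integral>x. h x \<partial>lebesgue_on V) \<le> (\<integral>x. h x \<partial>lebesgue_on U)"
proof -
  have i: "integrable lebesgue (\<lambda>x. indicator U x * h x)" "integrable lebesgue (\<lambda>x. indicator V x * h x)"
    using assms integrable_lebesgue_on_subset[OF assms(1-4)] by (simp_all add: integrable_restrict_space)
  have "(\<integral>x. indicator V x * h x \<partial>lebesgue) \<le> (\<integral>x. indicator U x * h x \<partial>lebesgue)"
    by (rule integral_mono[OF i(2) i(1)]) (use assms in \<open>auto split: split_indicator\<close>)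
  then show ?thesis using assms by (simp add: integral_restrict_space)
qed

context
  fixes L :: real and s :: nat and \<Omega> :: "(real^'d::finite) set" and p :: "('d \<Rightarrow> nat) \<Rightarrow> real^'d \<Rightarrow> real" and K :: real
  assumes L: "L > 0"
    and \<Omega>: "\<Omega> \<in> sets lebesgue" "\<Omega> \<subseteq> ccube L"
    and p_meas: "\<And>\<alpha>. mi_order \<alpha> \<le> s \<Longrightarrow> p \<alpha> \<in> borel_measurable (lebesgue_on \<Omega>)"
    and p_bdd: "\<And>\<alpha>. mi_order \<alpha> \<le> s \<Longrightarrow> AE x in lebesgue_on \<Omega>. \<bar>p \<alpha> x\<bar> \<le> K"
begin

lemma domain_subset_ocube: "\<Omega> \<subseteq> ocube (2*L)"
proof
  fix x assume "x \<in> \<Omega>"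
  then have "\<bar>x $ i\<bar> \<le> L" for i using \<Omega> by (auto simp: ccube_def)
  then have "\<bar>x $ i\<bar> < 2*L" for i using L le_less_trans[of "\<bar>x $ i\<bar>" L "2*L"] by simp
  then show "x \<in> ocube (2*L)" by (simp add: ocube_def)
qed

lemma Dop_summand_l2:
  assumes "f \<in> Hper L s" "mi_order \<alpha> \<le> s"
  shows "(\<lambda>x. p \<alpha> x * wderiv L \<alpha> f x) \<in> l2 (lebesgue_on \<Omega>)"
    "(\<integral>x. (p \<alpha> x * wderiv L \<alpha> f x)\<^sup>2 \<partial>lebesgue_on \<Omega>) \<le> K\<^sup>2 * (\<integral>x. (wderiv L \<alpha> f x)\<^sup>2 \<partial>lebesgue_on (ocube (2*L)))"
proof -
  have w2: "wderiv L \<alpha> f \<in> l2 (lebesgue_on (ocube (2*L)))" by (rule wderiv_Hper(1)[OF L assms])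
  have w: "wderiv L \<alpha> f \<in> l2 (lebesgue_on \<Omega>)"
    by (rule l2_subset[OF _ \<Omega>(1) domain_subset_ocube w2]) simp
  show "(\<lambda>x. p \<alpha> x * wderiv L \<alpha> f x) \<in> l2 (lebesgue_on \<Omega>)"
    by (rule l2_mult_bounded(1)[OF p_meas[OF assms(2)] p_bdd[OF assms(2)] w])
  have "(\<integral>x. (p \<alpha> x * wderiv L \<alpha> f x)\<^sup>2 \<partial>lebesgue_on \<Omega>) \<le> K\<^sup>2 * (\<integral>x. (wderiv L \<alpha> f x)\<^sup>2 \<partial>lebesgue_on \<Omega>)"
    by (rule l2_mult_bounded(2)[OF p_meas[OF assms(2)] p_bdd[OF assms(2)] w])
  also have "\<dots> \<le> K\<^sup>2 * (\<integral>x. (wderiv L \<alpha> f x)\<^sup>2 \<partial>lebesgue_on (ocube (2*L)))"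
    by (intro mult_left_mono integral_lebesgue_on_subset_mono \<Omega> domain_subset_ocube) (use w2 in \<open>auto simp: l2_def\<close>)
  finally show "(\<integral>x. (p \<alpha> x * wderiv L \<alpha> f x)\<^sup>2 \<partial>lebesgue_on \<Omega>) \<le> K\<^sup>2 * (\<integral>x. (wderiv L \<alpha> f x)\<^sup>2 \<partial>lebesgue_on (ocube (2*L)))" .
qed

lemma Dop_l2:
  assumes f: "f \<in> Hper L s"
  shows "Dop L s p f \<in> l2 (lebesgue_on \<Omega>)"
proof -
  interpret semi_inner "l2 (lebesgue_on \<Omega>)" "\<lambda>f g. \<integral>x. f x * g x \<partial>lebesgue_on \<Omega>" by (rule semi_inner_l2)
  have "(\<lambda>x. \<Sum>\<alpha>\<in>{\<alpha>. mi_order \<alpha> \<le> s}. 1 * (p \<alpha> x * wderiv L \<alpha> f x)) \<in> l2 (lebesgue_on \<Omega>)"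
    by (rule sum_mem[OF finite_mi_order]) (use Dop_summand_l2[OF f] in auto)
  then show ?thesis by (simp add: Dop_def[abs_def])
qed

text \<open>Cauchy-Schwarz over the finitely many multi-indices, applied pointwise, produces the
  cardinality; each coefficient function contributes the square of \<open>K\<close>.\<close>

lemma Dop_bound:
  assumes f: "f \<in> Hper L s"
  shows "(\<integral>x. (Dop L s p f x)\<^sup>2 \<partial>lebesgue_on \<Omega>) \<le> card {\<alpha> :: 'd \<Rightarrow> nat. mi_order \<alpha> \<le> s} * K\<^sup>2 * Hper_norm2 L s f"
proof -
  let ?A = "{\<alpha> :: 'd \<Rightarrow> nat. mi_order \<alpha> \<le> s}"
  have i: "integrable (lebesgue_on \<Omega>) (\<lambda>x. (p \<alpha> x * wderiv L \<alpha> f x)\<^sup>2)" if "\<alpha> \<in> ?A" for \<alpha>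
    using Dop_summand_l2(1)[OF f] that by (auto simp: l2_def)
  have "(\<integral>x. (Dop L s p f x)\<^sup>2 \<partial>lebesgue_on \<Omega>) \<le> (\<integral>x. (\<Sum>\<alpha>\<in>?A. (p \<alpha> x * wderiv L \<alpha> f x)\<^sup>2) * card ?A \<partial>lebesgue_on \<Omega>)"
  proof (rule integral_mono)
    show "integrable (lebesgue_on \<Omega>) (\<lambda>x. (Dop L s p f x)\<^sup>2)" using Dop_l2[OF f] by (simp add: l2_def)
    show "integrable (lebesgue_on \<Omega>) (\<lambda>x. (\<Sum>\<alpha>\<in>?A. (p \<alpha> x * wderiv L \<alpha> f x)\<^sup>2) * card ?A)"
      by (intro integrable_mult_left Bochner_Integration.integrable_sum i)
    show "(Dop L s p f x)\<^sup>2 \<le> (\<Sum>\<alpha>\<in>?A. (p \<alpha> x * wderiv L \<alpha> f x)\<^sup>2) * card ?A" for x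
      unfolding Dop_def by (rule sum_squared_le_sum_of_squares)
  qed
  also have "\<dots> = (\<Sum>\<alpha>\<in>?A. \<integral>x. (p \<alpha> x * wderiv L \<alpha> f x)\<^sup>2 \<partial>lebesgue_on \<Omega>) * card ?A"
    using Bochner_Integration.integral_sum[of ?A "lebesgue_on \<Omega>" "\<lambda>\<alpha> x. (p \<alpha> x * wderiv L \<alpha> f x)\<^sup>2", OF i]
    by (simp only: integral_mult_left_zero)
  also have "\<dots> \<le> (\<Sum>\<alpha>\<in>?A. K\<^sup>2 * (\<integral>x. (wderiv L \<alpha> f x)\<^sup>2 \<partial>lebesgue_on (ocube (2*L)))) * card ?A"
    by (intro mult_right_mono sum_mono Dop_summand_l2(2)[OF f]) auto
  also have "\<dots> = card ?A * K\<^sup>2 * Hper_norm2 L s f"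
    by (simp add: Hper_norm2_def sum_distrib_left[symmetric] mult_ac)
  finally show ?thesis .
qed

lemma semi_inner_Dop: "semi_inner (Hper L s) (\<lambda>u v. \<integral>x. Dop L s p u x * Dop L s p v x \<partial>lebesgue_on \<Omega>)"
proof (rule semi_inner_pullback[OF Hper_zero Hper_lin Dop_l2])
  fix f g :: "real^'d \<Rightarrow> real" and c d assume f: "f \<in> Hper L s" and g: "g \<in> Hper L s"
  have "AE x in lebesgue_on \<Omega>. \<forall>\<alpha>\<in>{\<alpha>. mi_order \<alpha> \<le> s}. wderiv L \<alpha> (\<lambda>x. c * f x + d * g x) x = c * wderiv L \<alpha> f x + d * wderiv L \<alpha> g x"
  proof (rule AE_finite_allI[OF finite_mi_order])
    fix \<alpha> :: "'d \<Rightarrow> nat" assume "\<alpha> \<in> {\<alpha>. mi_order \<alpha> \<le> s}"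
    then have "AE x in lebesgue_on (ocube (2*L)). wderiv L \<alpha> (\<lambda>x. c * f x + d * g x) x = c * wderiv L \<alpha> f x + d * wderiv L \<alpha> g x"
      by (intro wderiv_lin[OF L f g]) simp
    then have "AE x in lebesgue. x \<in> ocube (2*L) \<longrightarrow> wderiv L \<alpha> (\<lambda>x. c * f x + d * g x) x = c * wderiv L \<alpha> f x + d * wderiv L \<alpha> g x"
      by (simp add: AE_restrict_space_iff)
    then have "AE x in lebesgue. x \<in> \<Omega> \<longrightarrow> wderiv L \<alpha> (\<lambda>x. c * f x + d * g x) x = c * wderiv L \<alpha> f x + d * wderiv L \<alpha> g x"
      by eventually_elim (use domain_subset_ocube in blast)
    then show "AE x in lebesgue_on \<Omega>. wderiv L \<alpha> (\<lambda>x. c * f x + d * g x) x = c * wderiv L \<alpha> f x + d * wderiv L \<alpha> g x"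
      using \<Omega> by (simp add: AE_restrict_space_iff)
  qed
  then show "AE x in lebesgue_on \<Omega>. Dop L s p (\<lambda>x. c * f x + d * g x) x = c * Dop L s p f x + d * Dop L s p g x"
  proof eventually_elim
    case (elim x)
    then show ?case
      by (simp add: Dop_def sum_distrib_left sum.distrib[symmetric] algebra_simps)
  qed
qed

text \<open>The \<open>lam\<close> term makes the form coercive, and \<open>mu \<ge> 0\<close> keeps
  the second term from spoiling this. Bounded coefficients give the reverse estimate, so
  completeness is inherited from the H^s form.\<close>

lemma semi_hilbert_Bform:
  assumes s: "real s > real CARD('d) / 2" and lam: "lam > 0" and mu: "mu \<ge> 0"
  shows "semi_hilbert (Hper L s) (Bform L s lam mu \<Omega> p)"
proof (rule semi_hilbert_equivalent[OF semi_hilbert_Hinner[OF L s]])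
  have e: "Bform L s lam mu \<Omega> p = (\<lambda>u v. lam * Hinner L s u v + mu * (\<integral>x. Dop L s p u x * Dop L s p v x \<partial>lebesgue_on \<Omega>))"
    by (simp add: Bform_def Hinner_def fun_eq_iff)
  show "semi_inner (Hper L s) (Bform L s lam mu \<Omega> p)"
    unfolding e using lam mu by (intro semi_inner_combine semi_inner_Hinner[OF L] semi_inner_Dop) auto
  fix f :: "real^'d \<Rightarrow> real" assume f: "f \<in> Hper L s"
  show "lam * Hinner L s f f \<le> Bform L s lam mu \<Omega> p f f" unfolding e using mu by simp
  have "mu * (\<integral>x. Dop L s p f x * Dop L s p f x \<partial>lebesgue_on \<Omega>) \<le> mu * (card {\<alpha> :: 'd \<Rightarrow> nat. mi_order \<alpha> \<le> s} * K\<^sup>2 * Hinner L s f f)"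
    using mult_left_mono[OF Dop_bound[OF f] mu] by (simp add: Hinner_norm2 power2_eq_square)
  then show "Bform L s lam mu \<Omega> p f f \<le> (lam + mu * card {\<alpha> :: 'd \<Rightarrow> nat. mi_order \<alpha> \<le> s} * K\<^sup>2) * Hinner L s f f"
    unfolding e by (simp add: algebra_simps)
qed (rule lam)

end

text \<open>The predicates behind the two \<open>SOME\<close> terms coincide, so the choices are
  literally the same function, not merely equal almost everywhere.\<close>

lemma wderiv_cong:
  assumes "\<And>x. x \<in> ocube (2*L) \<Longrightarrow> f x = g x"
  shows "wderiv L \<alpha> f = wderiv L \<alpha> g"
  unfolding wderiv_def using is_weak_deriv_cong[of "ocube (2*L)" f g h h \<alpha> for h] assms by simp

lemma Bform_cong:
  assumes "\<And>x. x \<in> ccube (2*L) \<Longrightarrow> f x = f' x" "\<And>x. x \<in> ccube (2*L) \<Longrightarrow> g x = g' x"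
  shows "Bform L s lam mu \<Omega> p f g = Bform L s lam mu \<Omega> p f' g'"
proof -
  have "x \<in> ccube (2*L)" if "x \<in> ocube (2*L)" for x :: "real^'d"
    using that by (auto simp: ocube_def ccube_def less_imp_le)
  then have "wderiv L \<alpha> f = wderiv L \<alpha> f'" "wderiv L \<alpha> g = wderiv L \<alpha> g'" for \<alpha>
    using assms by (auto intro!: wderiv_cong)
  then show ?thesis by (simp add: Bform_def Dop_def)
qed

text \<open>Reduction modulo 4L lands in the closed cube, so the extension reads no other values.
  The eigenvalue equation and the kernel identity are available on that cube only, which makes this
  transfer necessary.\<close>

lemma Hper_cong:
  assumes L: "L > 0" and f: "f \<in> Hper L s" and fg: "\<And>x. x \<in> ccube (2*L) \<Longrightarrow> f x = g x"
  shows "g \<in> Hper L s"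
proof -
  have "per_ext L f x = per_ext L g x" for x
    unfolding per_ext_def
  proof (rule fg)
    have "\<bar>x $ i - 4 * L * of_int \<lfloor>(x $ i + 2*L) / (4*L)\<rfloor>\<bar> \<le> 2*L" for i
    proof -
      define n where "n = \<lfloor>(x $ i + 2*L) / (4*L)\<rfloor>"
      have "of_int n \<le> (x $ i + 2*L) / (4*L)" "(x $ i + 2*L) / (4*L) < of_int n + 1"
        unfolding n_def by linarith+
      then show ?thesis unfolding n_def[symmetric] using L by (auto simp: field_simps abs_le_iff)
    qed
    then show "(\<chi> i. x $ i - 4 * L * of_int \<lfloor>(x $ i + 2*L) / (4*L)\<rfloor>) \<in> ccube (2*L)" by (simp add: ccube_def)
  qed
  then have "per_ext L f = per_ext L g" by blast
  moreover have "continuous_on (ccube (2*L)) f \<longleftrightarrow> continuous_on (ccube (2*L)) g"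
    by (rule continuous_on_cong[OF refl fg])
  moreover have "f \<in> l2 (lebesgue_on (ccube (2*L))) \<longleftrightarrow> g \<in> l2 (lebesgue_on (ccube (2*L)))"
    by (rule l2_cong) (simp add: fg space_restrict_space)
  ultimately show ?thesis using f by (simp add: Hper_def L2_on_l2)
qed

text \<open>The faces are negligible. This reconciles L2 inner products, taken over the closed cube,
  with weak derivatives, which live on the open one.\<close>

lemma integral_ccube_eq_ocube:
  fixes h :: "real^'d::finite \<Rightarrow> real"
  assumes h: "h \<in> borel_measurable (lebesgue_on (ccube r))"
  shows "(\<integral>x. h x \<partial>lebesgue_on (ccube r)) = (\<integral>x. h x \<partial>lebesgue_on (ocube r))"
proof -
  have sub: "ocube r \<subseteq> (ccube r :: (real^'d) set)" by (auto simp: ocube_def ccube_def less_imp_le)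
  have m: "(\<lambda>x. indicator (ccube r) x * h x) \<in> borel_measurable lebesgue"
    using h by (simp add: borel_measurable_restrict_space_iff)
  have "h \<in> borel_measurable (lebesgue_on (ocube r))" using h sub by (rule measurable_restrict_mono)
  then have m': "(\<lambda>x. indicator (ocube r) x * h x) \<in> borel_measurable lebesgue"
    by (simp add: borel_measurable_restrict_space_iff)
  have "negligible (ccube r - ocube r :: (real^'d) set)"
    unfolding ocube_eq_box ccube_eq_cbox by (rule negligible_frontier_interval)
  then have "AE x in lebesgue. x \<notin> (ccube r - ocube r :: (real^'d) set)"
    by (intro AE_not_in) (simp add: negligible_iff_null_sets)
  then have "AE x in lebesgue. indicator (ccube r) x * h x = indicator (ocube r) x * h x"
    by eventually_elim (use sub in \<open>auto split: split_indicator\<close>)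
  from integral_cong_AE[OF m m' this] show ?thesis by (simp add: integral_restrict_space)
qed

lemma Hper_l2_norm_le:
  fixes f :: "real^'d::finite \<Rightarrow> real"
  assumes L: "L > 0" and f: "f \<in> Hper L s"
  shows "l2_inner (ccube (2*L)) f f \<le> Hper_norm2 L s f"
proof -
  have "l2_inner (ccube (2*L)) f f = (\<integral>x. (f x)\<^sup>2 \<partial>lebesgue_on (ocube (2*L)))"
    unfolding l2_inner_def power2_eq_square
    by (rule integral_ccube_eq_ocube) (use Hper_l2(2)[OF f] in \<open>auto simp: l2_def\<close>)
  then show ?thesis using Hper_norm2_ge_l2[OF L f] by simp
qed

text \<open>A function that is 0 almost everywhere has 0 as a weak derivative of every order.
  Combined with the embedding, this upgrades vanishing almost everywhere to vanishing at every
  point.\<close>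

lemma Hper_norm2_AE_zero:
  fixes f :: "real^'d::finite \<Rightarrow> real"
  assumes L: "L > 0" and f: "f \<in> Hper L s" and z: "AE x in lebesgue_on (ccube (2*L)). f x = 0"
  shows "Hper_norm2 L s f = 0"
proof -
  have sub: "ocube (2*L) \<subseteq> (ccube (2*L) :: (real^'d) set)" by (auto simp: ocube_def ccube_def less_imp_le)
  have "AE x in lebesgue. x \<in> ccube (2*L) \<longrightarrow> f x = 0" using z by (simp add: AE_restrict_space_iff)
  then have "AE x in lebesgue. x \<in> ocube (2*L) \<longrightarrow> f x = 0" by eventually_elim (use sub in blast)
  then have z': "AE x in lebesgue_on (ocube (2*L)). 0 = f x" by (simp add: AE_restrict_space_iff)
  have "(\<integral>x. (wderiv L \<alpha> f x)\<^sup>2 \<partial>lebesgue_on (ocube (2*L))) = 0" if \<alpha>: "mi_order \<alpha> \<le> s" for \<alpha>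
  proof -
    have "is_weak_deriv (ocube (2*L)) \<alpha> (\<lambda>x. 0) (\<lambda>x. 0)" by (simp add: is_weak_deriv_def)
    then have w: "is_weak_deriv (ocube (2*L)) \<alpha> f (\<lambda>x. 0)"
      using z' Hper_l2(1)[OF f] by - (rule is_weak_deriv_cong_AE[where ?f1.0="\<lambda>x. 0" and ?g1.0="\<lambda>x. 0"], auto simp: l2_def)
    have "AE x in lebesgue_on (ocube (2*L)). wderiv L \<alpha> f x = 0"
      by (rule wderiv_unique[OF L f \<alpha> _ w]) (simp add: l2_def)
    then have "AE x in lebesgue_on (ocube (2*L)). (wderiv L \<alpha> f x)\<^sup>2 = 0" by simp
    then show ?thesis by (rule integral_eq_zero_AE)
  qed
  then show ?thesis by (simp add: Hper_norm2_def)
qed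

section \<open>Reproducing kernel\<close>

theorem mainTheorem2:
  fixes L lam mu :: real and s :: nat and \<Omega> :: "(real^'d::finite) set"
    and p :: "('d \<Rightarrow> nat) \<Rightarrow> real^'d \<Rightarrow> real"
    and a :: "nat \<Rightarrow> real" and v :: "nat \<Rightarrow> real^'d \<Rightarrow> real"
  assumes L_pos: "L > 0"
    and s_pos: "s > 0"
    and s_gt: "real s > real CARD('d) / 2"
    and lam_pos: "lam > 0" and mu_nonneg: "mu \<ge> 0"
    and Omega_sub: "\<Omega> \<subseteq> ccube L"
    and Omega_bdd: "bounded \<Omega>"
    and Omega_lip: "lipschitz_domain \<Omega>"
    and p_meas: "\<And>\<alpha>. mi_order \<alpha> \<le> s \<Longrightarrow> p \<alpha> \<in> borel_measurable (lebesgue_on \<Omega>)"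
    and p_bdd: "\<exists>M. \<forall>\<alpha>. mi_order \<alpha> \<le> s \<longrightarrow> (AE x in lebesgue_on \<Omega>. \<bar>p \<alpha> x\<bar> \<le> M)"
    and a_pos: "\<And>m. a m > 0"
    and v_L2: "\<And>m. L2_on (ccube (2*L)) (v m)"
    and v_orth: "\<And>m k. l2_inner (ccube (2*L)) (v m) (v k) = (if m = k then 1 else 0)"
    and v_complete: "\<And>f. L2_on (ccube (2*L)) f \<Longrightarrow> (\<forall>m. l2_inner (ccube (2*L)) (v m) f = 0)
                        \<Longrightarrow> AE x in lebesgue_on (ccube (2*L)). f x = 0"
    and v_eigen: "\<And>m x. x \<in> ccube (2*L) \<Longrightarrow> Oop L s lam mu \<Omega> p (v m) x = a m * v m x"
  shows
    \<comment> \<open>the RKHS inner product is definite and the space is complete\<close>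
    "(\<forall>f\<in>Hper L s. rkhs_inner L a v f f = 0 \<longrightarrow> (\<forall>x\<in>ccube (2*L). f x = 0))
     \<and> (\<forall>F. (\<forall>k. F k \<in> Hper L s) \<longrightarrow>
          (\<forall>e>0. \<exists>N. \<forall>j\<ge>N. \<forall>k\<ge>N. rkhs_inner L a v (\<lambda>x. F j x - F k x) (\<lambda>x. F j x - F k x) < e) \<longrightarrow>
          (\<exists>f\<in>Hper L s. (\<lambda>k. rkhs_inner L a v (\<lambda>x. F k x - f x) (\<lambda>x. F k x - f x)) \<longlonglongrightarrow> 0))
     \<comment> \<open>(i) the kernel series converges\<close>
     \<and> (\<forall>x\<in>ccube (2*L). \<forall>y\<in>ccube (2*L). summable (\<lambda>m. a m * v m x * v m y))
     \<comment> \<open>(ii)\<close>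
     \<and> (\<forall>x\<in>ccube (2*L). (\<lambda>y. kernel a v x y) \<in> Hper L s)
     \<comment> \<open>(iii)\<close>
     \<and> (\<forall>f\<in>Hper L s. \<forall>x\<in>ccube (2*L). f x = rkhs_inner L a v f (\<lambda>y. kernel a v x y))
     \<comment> \<open>(iv)\<close>
     \<and> (\<forall>f\<in>Hper L s. rkhs_inner L a v f f =
          lam * Hper_norm2 L s f + mu * (\<integral>x. (Dop L s p f x)^2 \<partial>lebesgue_on \<Omega>))"
proof -
  let ?C = "ccube (2*L) :: (real^'d) set"
  let ?H = "Hper L s :: (real^'d \<Rightarrow> real) set"
  let ?B = "Bform L s lam mu \<Omega> p"
  let ?ip = "l2_inner ?C"
  obtain M where M: "\<And>\<alpha>. mi_order \<alpha> \<le> s \<Longrightarrow> AE x in lebesgue_on \<Omega>. \<bar>p \<alpha> x\<bar> \<le> M"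
    using p_bdd by blast
  have \<Omega>: "\<Omega> \<in> sets lebesgue" using Omega_lip by (simp add: lipschitz_domain_def)
  interpret H: semi_hilbert ?H ?B
    by (rule semi_hilbert_Bform[OF L_pos \<Omega> Omega_sub p_meas M s_gt lam_pos mu_nonneg])
  interpret l: semi_hilbert "l2 (lebesgue_on ?C)" ?ip
    unfolding l2_inner_def[abs_def] by (rule semi_hilbert_l2) simp
  have B_eq: "?B f f = lam * Hper_norm2 L s f + mu * (\<integral>x. (Dop L s p f x)\<^sup>2 \<partial>lebesgue_on \<Omega>)" for f
    by (simp add: Bform_def Hper_norm2_def power2_eq_square)
  have B_ge: "lam * Hper_norm2 L s f \<le> ?B f f" for f
    unfolding B_eq using mu_nonneg by simp
  obtain C where C: "C \<ge> 0"
    and emb: "\<And>(f :: real^'d \<Rightarrow> real) x. f \<in> ?H \<Longrightarrow> x \<in> ?C \<Longrightarrow> (f x)\<^sup>2 \<le> C * Hper_norm2 L s f"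
    using Sobolev_embedding[OF L_pos s_gt] by blast
  have emb': "(f x)\<^sup>2 \<le> C / lam * ?B f f" if "f \<in> ?H" "x \<in> ?C" for f x
  proof -
    have "(f x)\<^sup>2 \<le> C / lam * (lam * Hper_norm2 L s f)" using emb[OF that] lam_pos by simp
    also have "\<dots> \<le> C / lam * ?B f f" using B_ge[of f] C lam_pos by (intro mult_left_mono) auto
    finally show ?thesis .
  qed
  have definite: "f x = 0" if "f \<in> ?H" "?B f f = 0" "x \<in> ?C" for f x
    using emb'[OF that(1,3)] that(2) by simp
  have Hl: "f \<in> l2 (lebesgue_on ?C)" if "f \<in> ?H" for f using Hper_l2(2)[OF that] .

  have vl: "v m \<in> l2 (lebesgue_on ?C)" for m using v_L2[of m] by (simp add: L2_on_l2)
  \<comment> \<open>\<open>Oop\<close> is a \<open>SOME\<close>, so Riesz must first supply a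
    solution for the right-hand side \<open>v m\<close>. The functional has constant 1/lam because
    \<open>v m\<close> has unit norm and the H^s norm dominates the mean-square norm.\<close>
  have Oop: "Oop L s lam mu \<Omega> p (v m) \<in> ?H \<and> (\<forall>\<phi>\<in>?H. ?B (Oop L s lam mu \<Omega> p (v m)) \<phi> = ?ip \<phi> (v m))" for m
  proof -
    have "\<exists>w\<in>?H. \<forall>\<phi>\<in>?H. ?B w \<phi> = ?ip \<phi> (v m)"
    proof (rule H.Riesz_representation)
      fix \<phi> assume \<phi>: "\<phi> \<in> ?H"
      have "(?ip \<phi> (v m))\<^sup>2 \<le> ?ip \<phi> \<phi> * ?ip (v m) (v m)" by (rule l.Cauchy_Schwarz[OF Hl[OF \<phi>] vl])
      also have "\<dots> \<le> Hper_norm2 L s \<phi>" using Hper_l2_norm_le[OF L_pos \<phi>] v_orth[of m m] by simp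
      also have "\<dots> \<le> 1 / lam * ?B \<phi> \<phi>" using B_ge[of \<phi>] lam_pos by (simp add: field_simps)
      finally show "(?ip \<phi> (v m))\<^sup>2 \<le> 1 / lam * ?B \<phi> \<phi>" .
    qed (intro l.lin Hl vl)
    then have "\<exists>w. w \<in> ?H \<and> (\<forall>\<phi>\<in>?H. ?B w \<phi> = ?ip \<phi> (v m))" by blast
    from someI_ex[OF this] show ?thesis unfolding Oop_def .
  qed
  \<comment> \<open>The eigenvalue equation holds on the cube only, hence the detour through a
    scaled \<open>Oop\<close> and \<open>Hper_cong\<close>; dividing by \<open>a m\<close> uses its
    positivity.\<close>
  have vH: "v m \<in> ?H" for m
  proof (rule Hper_cong[OF L_pos])
    show "(\<lambda>x. (1 / a m) * Oop L s lam mu \<Omega> p (v m) x) \<in> ?H" using Oop[of m] by (intro H.scale_mem) blast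
    show "(1 / a m) * Oop L s lam mu \<Omega> p (v m) x = v m x" if "x \<in> ?C" for x
      using v_eigen[OF that, of m] a_pos[of m] by simp
  qed
  have Bv: "?B (v m) \<phi> = ?ip (v m) \<phi> / a m" if \<phi>: "\<phi> \<in> ?H" for m \<phi>
  proof -
    have "?B (\<lambda>x. a m * v m x) \<phi> = ?B (Oop L s lam mu \<Omega> p (v m)) \<phi>"
      by (rule Bform_cong) (simp_all add: v_eigen)
    also have "\<dots> = ?ip (v m) \<phi>" using Oop[of m] \<phi> l.sym[OF vl Hl[OF \<phi>]] by simp
    finally show ?thesis using H.scale_left[OF vH \<phi>, of "a m" m] a_pos[of m] by (simp add: field_simps)
  qed

  \<comment> \<open>As \<open>B\<close> takes the value 1 / a m at the pair (v m, v m), the factor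
    sqrt (a m) normalises.\<close>
  define e where "e m = (\<lambda>x. sqrt (a m) * v m x)" for m
  have eH: "e m \<in> ?H" for m unfolding e_def by (rule H.scale_mem[OF vH])
  \<comment> \<open>These are the coefficients in the definition of \<open>Oinvsqrt\<close>. They
    are also the coefficients of f in the \<open>B\<close>-orthonormal system \<open>e\<close>,
    because a^(-1/2) = sqrt a / a.\<close>
  define c where "c f m = a m powr (-1/2) * ?ip (v m) f" for f m
  have a_sqrt: "a m powr (-1/2) = sqrt (a m) / a m" for m
    using a_pos[of m] by (simp add: powr_minus powr_half_sqrt field_simps)
  have Be: "?B (e m) f = c f m" if "f \<in> ?H" for f m
    unfolding e_def H.scale_left[OF vH that] Bv[OF that] c_def a_sqrt by simp
  have e_orth: "?B (e m) (e k) = (if m = k then 1 else 0)" for m k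
  proof -
    have "?B (e m) (e k) = c (e k) m" by (rule Be[OF eH])
    also have "\<dots> = sqrt (a k) * (a m powr (-1/2) * ?ip (v m) (v k))"
      unfolding c_def e_def l.scale_right[OF vl vl] by simp
    finally show ?thesis using a_pos[of m] unfolding v_orth a_sqrt by auto
  qed
  have c_summable: "summable (\<lambda>m. (c f m)\<^sup>2)" if f: "f \<in> ?H" for f
  proof (rule bounded_imp_summable)
    fix n
    have "(\<Sum>m\<in>{..n}. (?B f (e m))\<^sup>2) \<le> 1 * ?B f f"
      by (rule H.Bessel_orthogonal) (auto simp: eH f e_orth)
    then show "(\<Sum>m\<le>n. (c f m)\<^sup>2) \<le> ?B f f" using H.sym[OF f eH] by (simp add: Be[OF f])
  qed simp
  \<comment> \<open>The \<open>B\<close>-product with \<open>e m\<close> is a nonzero multiple of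
    the L2 coefficient, so orthogonality passes to L2, where \<open>v_complete\<close>
    applies.\<close>
  have complete_e: "\<forall>x\<in>?C. f x = 0" if f: "f \<in> ?H" and z: "\<And>m. ?B (e m) f = 0" for f
  proof -
    have "?ip (v m) f = 0" for m using z[of m] a_pos[of m] unfolding Be[OF f] c_def by simp
    then have "AE x in lebesgue_on ?C. f x = 0" using Hl[OF f] by (intro v_complete) (auto simp: L2_on_l2)
    then have "Hper_norm2 L s f = 0" by (rule Hper_norm2_AE_zero[OF L_pos f])
    then show ?thesis using emb[OF f] by auto
  qed
  define S where "S f N = (\<lambda>x. \<Sum>m<N. c f m * e m x)" for f and N :: nat
  have SH: "S f N \<in> ?H" for f N unfolding S_def by (intro H.sum_mem eH) simp
  have S_lim: "(\<lambda>N. ?B (\<lambda>x. S f N x - f x) (\<lambda>x. S f N x - f x)) \<longlonglongrightarrow> 0" if f: "f \<in> ?H" for f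
  proof -
    obtain h where h: "h \<in> ?H" and lim: "(\<lambda>N. ?B (\<lambda>x. S f N x - h x) (\<lambda>x. S f N x - h x)) \<longlonglongrightarrow> 0"
      using H.orthonormal_series[OF eH e_orth c_summable[OF f]] unfolding S_def by blast
    \<comment> \<open>The limit \<open>h\<close> has the same coefficients as f; completeness then
      identifies the two on the cube, though perhaps not outside it.\<close>
    have "?B (e k) (\<lambda>x. f x - h x) = 0" for k
    proof -
      have "(\<lambda>N. ?B (S f N) (e k)) \<longlonglongrightarrow> ?B h (e k)" by (rule H.tendsto_left[OF SH h eH lim])
      moreover have "\<forall>\<^sub>F N in sequentially. ?B (S f N) (e k) = c f k"
        using eventually_gt_at_top[of k]
      proof eventually_elim
        case (elim N)
        have "?B (S f N) (e k) = (\<Sum>m<N. c f m * ?B (e m) (e k))" unfolding S_def by (intro H.sum_left eH) simp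
        also have "\<dots> = (\<Sum>m<N. if m = k then c f k else 0)" by (intro sum.cong) (auto simp: e_orth)
        finally show ?case using elim by simp
      qed
      ultimately have "(\<lambda>N. c f k) \<longlonglongrightarrow> ?B h (e k)" by (rule Lim_transform_eventually)
      then have "?B h (e k) = c f k" using LIMSEQ_unique[OF _ tendsto_const] by blast
      then show ?thesis using H.diff_right[OF f h eH] Be[OF f] H.sym[OF h eH] by simp
    qed
    from complete_e[OF Hper_diff[OF f h] this] have "f x = h x" if "x \<in> ?C" for x using that by simp
    then have "?B (\<lambda>x. S f N x - f x) (\<lambda>x. S f N x - f x) = ?B (\<lambda>x. S f N x - h x) (\<lambda>x. S f N x - h x)" for N
      by (intro Bform_cong) auto
    then show ?thesis using lim by simp
  qed
  have Parseval: "(\<lambda>m. c f m * c g m) sums ?B f g" if f: "f \<in> ?H" and g: "g \<in> ?H" for f g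
  proof -
    have "(\<lambda>N. ?B (S f N) g) \<longlonglongrightarrow> ?B f g" by (rule H.tendsto_left[OF SH f g S_lim[OF f]])
    moreover have "?B (S f N) g = (\<Sum>m<N. c f m * c g m)" for N
      unfolding S_def Be[OF g, symmetric] by (intro H.sum_left eH g) simp
    ultimately show ?thesis by (simp add: sums_def)
  qed

  define T where "T f N = (\<lambda>x. \<Sum>m<N. c f m * v m x)" for f and N :: nat
  have Tl: "T f N \<in> l2 (lebesgue_on ?C)" for f N unfolding T_def by (intro l.sum_mem vl) simp
  \<comment> \<open>Bessel for \<open>B\<close> makes the coefficients square-summable, so the same
    series with \<open>v m\<close> in place of \<open>e m\<close> converges in L2. Its limit is the
    witness for the \<open>SOME\<close>.\<close>
  have Oinv: "Oinvsqrt L a v f \<in> l2 (lebesgue_on ?C)"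
    "(\<lambda>N. ?ip (\<lambda>x. T f N x - Oinvsqrt L a v f x) (\<lambda>x. T f N x - Oinvsqrt L a v f x)) \<longlonglongrightarrow> 0"
    if f: "f \<in> ?H" for f
  proof -
    obtain h where "h \<in> l2 (lebesgue_on ?C)" "(\<lambda>N. ?ip (\<lambda>x. (\<Sum>m<N. c f m * v m x) - h x) (\<lambda>x. (\<Sum>m<N. c f m * v m x) - h x)) \<longlonglongrightarrow> 0"
      using l.orthonormal_series[OF vl v_orth c_summable[OF f]] by blast
    then have "\<exists>h. L2_on ?C h \<and> (\<lambda>N. \<integral>x. ((\<Sum>m<N. a m powr (-1/2) * ?ip (v m) f * v m x) - h x)\<^sup>2 \<partial>lebesgue_on ?C) \<longlonglongrightarrow> 0"
      by (auto simp: L2_on_l2 l2_inner_def c_def power2_eq_square)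
    from someI_ex[OF this]
    show "Oinvsqrt L a v f \<in> l2 (lebesgue_on ?C)"
      "(\<lambda>N. ?ip (\<lambda>x. T f N x - Oinvsqrt L a v f x) (\<lambda>x. T f N x - Oinvsqrt L a v f x)) \<longlonglongrightarrow> 0"
      unfolding Oinvsqrt_def[symmetric] by (auto simp: L2_on_l2 l2_inner_def c_def T_def power2_eq_square)
  qed
  \<comment> \<open>Both sides are the sum of the products \<open>c f m * c g m\<close>: the left by
    L2-convergence of the series for \<open>Oinvsqrt\<close>, the right by Parseval for
    \<open>B\<close>.\<close>
  have rkhs: "rkhs_inner L a v f g = ?B f g" if f: "f \<in> ?H" and g: "g \<in> ?H" for f g
  proof -
    have coeff: "?ip (v k) (Oinvsqrt L a v g) = c g k" for k
    proof -
      have "(\<lambda>N. ?ip (T g N) (v k)) \<longlonglongrightarrow> ?ip (Oinvsqrt L a v g) (v k)"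
        by (rule l.tendsto_left[OF Tl Oinv(1)[OF g] vl Oinv(2)[OF g]])
      moreover have "\<forall>\<^sub>F N in sequentially. ?ip (T g N) (v k) = c g k"
        using eventually_gt_at_top[of k]
      proof eventually_elim
        case (elim N)
        have "?ip (T g N) (v k) = (\<Sum>m<N. c g m * ?ip (v m) (v k))" unfolding T_def by (intro l.sum_left vl) simp
        also have "\<dots> = (\<Sum>m<N. if m = k then c g k else 0)" by (intro sum.cong) (auto simp: v_orth)
        finally show ?case using elim by simp
      qed
      ultimately have "(\<lambda>N. c g k) \<longlonglongrightarrow> ?ip (Oinvsqrt L a v g) (v k)" by (rule Lim_transform_eventually)
      then have "?ip (Oinvsqrt L a v g) (v k) = c g k" using LIMSEQ_unique[OF _ tendsto_const] by blast
      then show ?thesis using l.sym[OF vl Oinv(1)[OF g]] by simp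
    qed
    have "(\<lambda>N. ?ip (T f N) (Oinvsqrt L a v g)) \<longlonglongrightarrow> ?ip (Oinvsqrt L a v f) (Oinvsqrt L a v g)"
      by (rule l.tendsto_left[OF Tl Oinv(1)[OF f] Oinv(1)[OF g] Oinv(2)[OF f]])
    moreover have "?ip (T f N) (Oinvsqrt L a v g) = (\<Sum>m<N. c f m * c g m)" for N
      unfolding T_def coeff[symmetric] by (intro l.sum_left vl Oinv(1)[OF g]) simp
    ultimately have "(\<lambda>m. c f m * c g m) sums rkhs_inner L a v f g" by (simp add: sums_def rkhs_inner_def)
    then show ?thesis using Parseval[OF f g] by (rule sums_unique2)
  qed

  \<comment> \<open>The embedding makes point evaluation a bounded functional. Its representer is
    obtained before any series and compared with the kernel series afterwards.\<close>
  have "\<exists>k\<in>?H. \<forall>f\<in>?H. ?B k f = f x" if x: "x \<in> ?C" for x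
    by (rule H.Riesz_representation[where l="\<lambda>f. f x", OF refl emb'[OF _ x]])
  then obtain k where kH: "\<And>x. x \<in> ?C \<Longrightarrow> k x \<in> ?H" and k: "\<And>x f. x \<in> ?C \<Longrightarrow> f \<in> ?H \<Longrightarrow> ?B (k x) f = f x"
    by metis
  \<comment> \<open>Parseval for \<open>k x\<close> and \<open>k y\<close>, whose coefficients are
    \<open>e m x\<close> and \<open>e m y\<close>. The series therefore converges at every pair of
    points, not just almost everywhere.\<close>
  have kernel_sums: "(\<lambda>m. a m * v m x * v m y) sums k x y" if x: "x \<in> ?C" and y: "y \<in> ?C" for x y
  proof -
    have ck: "c (k z) m = sqrt (a m) * v m z" if z: "z \<in> ?C" for z m
      using Be[OF kH[OF z], of m] k[OF z eH[of m]] H.sym[OF eH kH[OF z]] by (simp add: e_def)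
    have "c (k x) m * c (k y) m = a m * v m x * v m y" for m
      unfolding ck[OF x] ck[OF y] using a_pos[of m] by (simp add: algebra_simps)
    moreover have "?B (k x) (k y) = k x y"
      using k[OF y kH[OF x]] H.sym[OF kH[OF x] kH[OF y]] by simp
    ultimately show ?thesis using Parseval[OF kH[OF x] kH[OF y]] by simp
  qed
  have kernel_eq: "kernel a v x y = k x y" if "x \<in> ?C" "y \<in> ?C" for x y
    unfolding kernel_def using kernel_sums[OF that] by (simp add: sums_iff)
  have kernelH: "(\<lambda>y. kernel a v x y) \<in> ?H" if x: "x \<in> ?C" for x
    by (rule Hper_cong[OF L_pos kH[OF x]]) (simp add: kernel_eq[OF x])

  show ?thesis
  proof (intro conjI ballI allI impI)
    fix f x assume "f \<in> ?H" "rkhs_inner L a v f f = 0" "x \<in> ?C"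
    then show "f x = 0" using definite[of f x] rkhs[of f f] by simp
  next
    fix F :: "nat \<Rightarrow> real^'d \<Rightarrow> real" assume F: "\<forall>k. F k \<in> ?H"
      and Cauchy: "\<forall>e>0. \<exists>N. \<forall>j\<ge>N. \<forall>k\<ge>N. rkhs_inner L a v (\<lambda>x. F j x - F k x) (\<lambda>x. F j x - F k x) < e"
    have "\<exists>f\<in>?H. (\<lambda>k. ?B (\<lambda>x. F k x - f x) (\<lambda>x. F k x - f x)) \<longlonglongrightarrow> 0"
    proof (rule H.complete)
      show "F k \<in> ?H" for k using F by blast
      have eq: "rkhs_inner L a v (\<lambda>x. F j x - F k x) (\<lambda>x. F j x - F k x) = ?B (\<lambda>x. F j x - F k x) (\<lambda>x. F j x - F k x)" for j k
        using F by (intro rkhs Hper_diff) auto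
      show "\<exists>N. \<forall>j\<ge>N. \<forall>k\<ge>N. ?B (\<lambda>x. F j x - F k x) (\<lambda>x. F j x - F k x) < e" if "e > 0" for e
        using Cauchy that unfolding eq by blast
    qed
    then obtain f where f: "f \<in> ?H" and lim: "(\<lambda>k. ?B (\<lambda>x. F k x - f x) (\<lambda>x. F k x - f x)) \<longlonglongrightarrow> 0" by blast
    have "rkhs_inner L a v (\<lambda>x. F k x - f x) (\<lambda>x. F k x - f x) = ?B (\<lambda>x. F k x - f x) (\<lambda>x. F k x - f x)" for k
      using F f by (intro rkhs Hper_diff) auto
    then have "(\<lambda>k. rkhs_inner L a v (\<lambda>x. F k x - f x) (\<lambda>x. F k x - f x)) \<longlonglongrightarrow> 0"
      using lim by (simp only:)
    then show "\<exists>f\<in>?H. (\<lambda>k. rkhs_inner L a v (\<lambda>x. F k x - f x) (\<lambda>x. F k x - f x)) \<longlonglongrightarrow> 0"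
      using f by blast
  next
    fix x y assume "x \<in> ?C" "y \<in> ?C"
    then show "summable (\<lambda>m. a m * v m x * v m y)" using kernel_sums sums_summable by blast
  next
    fix x assume "x \<in> ?C"
    then show "(\<lambda>y. kernel a v x y) \<in> ?H" by (rule kernelH)
  next
    fix f x assume f: "f \<in> ?H" and x: "x \<in> ?C"
    have "rkhs_inner L a v f (\<lambda>y. kernel a v x y) = ?B f (\<lambda>y. kernel a v x y)" by (rule rkhs[OF f kernelH[OF x]])
    \<comment> \<open>The series agrees with \<open>k x\<close> on the cube, and \<open>B\<close>
      sees no other values.\<close>
    also have "\<dots> = ?B f (k x)" by (rule Bform_cong) (simp_all add: kernel_eq[OF x])
    also have "\<dots> = f x" using k[OF x f] H.sym[OF f kH[OF x]] by simp
    finally show "f x = rkhs_inner L a v f (\<lambda>y. kernel a v x y)" by simp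
  next
    fix f assume f: "f \<in> ?H"
    show "rkhs_inner L a v f f = lam * Hper_norm2 L s f + mu * (\<integral>x. (Dop L s p f x)^2 \<partial>lebesgue_on \<Omega>)"
      unfolding rkhs[OF f f] by (rule B_eq)
  qed
qed

end
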